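(* Let $\delta\in(0,1)$ and $\varepsilon>0$. Suppose $\Theta\subset\mathbb{R}^p$ is compact and contained in a closed Euclidean ball of radius $r>0$, and $\boldsymbol\Psi:\Theta\to\mathbb{S}^m_{++}$ satisfies (i) $\|\boldsymbol\Psi(\boldsymbol\theta)-\boldsymbol\Psi(\boldsymbol\theta')\|_2\le L_\Psi\|\boldsymbol\theta-\boldsymbol\theta'\|_2$ for all $\boldsymbol\theta,\boldsymbol\theta'\in\Theta$, and (ii) $\alpha\mathbf{I}\preceq\boldsymbol\Psi(\boldsymbol\theta)\preceq\beta\mathbf{I}$ for all $\boldsymbol\theta\in\Theta$, with $0<\alpha\le\beta$; let $\kappa_\infty=\beta/\alpha$. Let $\widehat F_{\mathrm{SL}}$ be the SLQ estimator computed with $K$ Lanczos steps and $N$ independent Rademacher vectors (the same vectors for all $\boldsymbol\theta$). If $$K\ge \frac{\sqrt{\kappa_\infty+1}}{4}\log\Big(4\cdot\tfrac{5}{2}\varepsilon^{-1} m(\sqrt{\kappa_\infty+1}+1)\log(2\kappa_\infty)\Big),$$ $$N\ge 32\Big(\tfrac{25}{4}\varepsilon^{-2}\max_{\boldsymbol\theta\in\Theta}\|\overline{\log\boldsymbol\Psi(\boldsymbol\theta)}\|_F^2+\tfrac52\varepsilon^{-1}\max_{\boldsymbol\theta\in\Theta}\|\overline{\log\boldsymbol\Psi(\boldsymbol\theta)}\|_2\Big)\log\Big(\frac{2\gamma}{\delta}\Big),$$ where $\gamma=\max\{(3r/\eta)^p,1\}$ and $\eta=\alpha\varepsilon/(5mL_\Psi)$,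 then with probability at least $1-\delta$, $$\max_{\boldsymbol\theta\in\Theta}\big|\widehat F_{\mathrm{SL}}(\boldsymbol\theta)-\log\det(\boldsymbol\Psi(\boldsymbol\theta))\big|\le\varepsilon .$$
   Context: $\mathbb{S}^m_{++}$: symmetric positive definite $m\times m$ matrices. For a square matrix $\mathbf{B}$, $\overline{\mathbf{B}}=\mathbf{B}-\mathrm{diag}(\mathbf{B})$ denotes its off-diagonal part; $\|\cdot\|_F$ the Frobenius norm, $\|\cdot\|_2$ the spectral norm. Rademacher vectors $\mathbf{w}_i\in\{\pm1\}^m$ have i.i.d. entries uniform on $\{\pm1\}$. Stochastic Lanczos quadrature (SLQ) estimator: given independent Rademacher vectors $\mathbf{w}_1,\dots,\mathbf{w}_N$, for each $i$ run $K$ steps of the symmetric Lanczos algorithm on $\boldsymbol\Psi(\boldsymbol\theta)$ with starting vector $\mathbf{w}_i/\|\mathbf{w}_i\|_2$, producing a $K\times K$ tridiagonal matrix $\mathbf{T}_K^{(i)}$; this implicitly defines a polynomial $q_K$ (of degree at most $K-1$, depending on $i$ and $\boldsymbol\theta$) with $\mathbf{w}_i^\top q_K(\boldsymbol\Psi(\boldsymbol\theta))\mathbf{w}_i=\|\mathbf{w}_i\|_2^2\,\mathbf{e}_1^\top\log(\mathbf{T}_K^{(i)})\mathbf{e}_1$, and $\widehat F_{\mathrm{SL}}(\boldsymbol\theta)=\frac1N\sum_{i=1}^N \mathbf{w}_i^\top q_K(\boldsymbol\Psi(\boldsymbol\theta))\mathbf{w}_i$, an approximation of $\log\det\boldsymbol\Psi(\boldsymbol\theta)=\mathrm{trace}(\log\boldsymbol\Psi(\boldsymbol\theta))$.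 *)

theory Defs
  imports "HOL-Analysis.Analysis" "HOL-Probability.Probability_Mass_Function" "Jordan_Normal_Form.Determinant"
begin

definition vnorm :: "real vec \<Rightarrow> real" where
  "vnorm v = sqrt (scalar_prod v v)"

definition spec_norm :: "real mat \<Rightarrow> real" where
  "spec_norm B = Sup {vnorm (B *\<^sub>v v) | v. v \<in> carrier_vec (dim_col B) \<and> vnorm v = 1}"

definition frob_norm :: "real mat \<Rightarrow> real" where
  "frob_norm B = sqrt (\<Sum>i<dim_row B. \<Sum>j<dim_col B. (B $$ (i,j))^2)"

definition offdiag :: "real mat \<Rightarrow> real mat" where
  "offdiag B = mat (dim_row B) (dim_col B) (\<lambda>(i,j). if i = j then 0 else B $$ (i,j))"

definition sym_mat :: "real mat \<Rightarrow> bool" where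
  "sym_mat A \<longleftrightarrow> (\<exists>n. A \<in> carrier_mat n n) \<and> transpose_mat A = A"

text \<open>Primary matrix function of a symmetric (hence orthogonally diagonalisable) matrix:
  the unique n x n matrix acting as  f(lambda)  on every eigenvector of A with eigenvalue lambda.\<close>
definition mat_fun :: "(real \<Rightarrow> real) \<Rightarrow> real mat \<Rightarrow> real mat" where
  "mat_fun f A = (THE B. B \<in> carrier_mat (dim_row A) (dim_row A) \<and>
      (\<forall>v lam. v \<in> carrier_vec (dim_row A) \<longrightarrow> A *\<^sub>v v = lam \<cdot>\<^sub>v v \<longrightarrow> B *\<^sub>v v = f lam \<cdot>\<^sub>v v))"

definition mat_log :: "real mat \<Rightarrow> real mat" where
  "mat_log A = mat_fun ln A"

definition loewner_between :: "real \<Rightarrow> real mat \<Rightarrow> real \<Rightarrow> bool" where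
  "loewner_between a A b \<longleftrightarrow> (\<forall>v \<in> carrier_vec (dim_row A).
       a * scalar_prod v v \<le> scalar_prod v (A *\<^sub>v v) \<and> scalar_prod v (A *\<^sub>v v) \<le> b * scalar_prod v v)"

text \<open>Symmetric Lanczos recurrence (exact arithmetic).  Arguments: matrix A, remaining steps,
  previous Lanczos vector q_{j-1}, current vector q_j, previous beta_{j-1}.
  Returns the lists (alpha_j ...) and (beta_j ...).  On breakdown (beta_j = 0) the next vector
  is the zero vector (since 1/0 = 0), so subsequent entries vanish.\<close>
fun lanczos_aux :: "real mat \<Rightarrow> nat \<Rightarrow> real vec \<Rightarrow> real vec \<Rightarrow> real \<Rightarrow> real list \<times> real list" where
  "lanczos_aux A 0 qp q bp = ([], [])"
| "lanczos_aux A (Suc k) qp q bp =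
     (let v = A *\<^sub>v q - bp \<cdot>\<^sub>v qp;
          a = scalar_prod q v;
          v' = v - a \<cdot>\<^sub>v q;
          b = vnorm v';
          q' = (1 / b) \<cdot>\<^sub>v v';
          r = lanczos_aux A k q q' b
      in (a # fst r, b # snd r))"

definition lanczos_T :: "nat \<Rightarrow> real mat \<Rightarrow> real vec \<Rightarrow> real mat" where
  "lanczos_T K A q1 =
     (let r = lanczos_aux A K (0\<^sub>v (dim_row A)) q1 0; as = fst r; bs = snd r
      in mat K K (\<lambda>(i,j). if i = j then as ! i
                         else if j = i + 1 then bs ! i
                         else if i = j + 1 then bs ! j else 0))"

text \<open>Quadratic form  w^T q_K(A) w = ||w||^2 e_1^T log(T_K) e_1.\<close>
definition slq_quad :: "nat \<Rightarrow> real mat \<Rightarrow> real vec \<Rightarrow> real" where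
  "slq_quad K A w = (vnorm w)^2 * (mat_log (lanczos_T K A ((1 / vnorm w) \<cdot>\<^sub>v w))) $$ (0,0)"

definition slq :: "nat \<Rightarrow> real mat \<Rightarrow> real vec list \<Rightarrow> real" where
  "slq K A ws = (\<Sum>w\<leftarrow>ws. slq_quad K A w) / real (length ws)"

text \<open>All N-tuples of Rademacher vectors in {+-1}^m (uniform distribution on this finite set =
  N independent Rademacher vectors).\<close>
definition rademacher_tuples :: "nat \<Rightarrow> nat \<Rightarrow> real vec list set" where
  "rademacher_tuples N m = {ws. length ws = N \<and>
      (\<forall>w \<in> set ws. w \<in> carrier_vec m \<and> (\<forall>j<m. vec_index w j \<in> {-1, 1}))}"

end

theory Submission
  imports Defs "HOL-Probability.Distributions" "HOL-Probability.Hoeffding" "HOL-Real_Asymp.Real_Asymp"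
begin

text \<open>
  Write \<open>H(\<theta>)\<close> for the Hutchinson estimator, the mean of \<open>w\<^sup>T log \<Psi>(\<theta>) w\<close> over the sample. The Lanczos
  quadrature is exact for polynomials of degree below \<open>2K\<close> and its nodes of positive weight lie in
  \<open>[\<alpha>, \<beta>]\<close>, so the SLQ estimator differs from \<open>H(\<theta>)\<close> by at most \<open>2m\<close> times the uniform error of
  approximating \<open>ln\<close> on \<open>[\<alpha>, \<beta>]\<close>, for every sample and every \<open>\<theta>\<close>; the truncated Chebyshev series of \<open>ln\<close>
  bounds this error. Both \<open>H\<close> and \<open>log det \<Psi>\<close> are Lipschitz in \<open>\<theta>\<close> with constant \<open>m L\<^sub>\<Psi> / \<alpha>\<close>, as the
  resolvents of two matrices bounded below by \<open>\<alpha>\<close> show, so it suffices to control \<open>H - log det \<Psi>\<close> on a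
  finite net. There it is a mean of Rademacher chaoses of order two with zero diagonal, whose exponential
  moments are bounded by decoupling and a Gaussian linearisation; a Chernoff bound and a union bound over
  the net conclude.
\<close>

unbundle no vec_syntax
unbundle no inner_syntax

section \<open>Euclidean vectors and matrix norms\<close>

lemma scalar_prod_eq_sum:
  fixes v w :: "'a :: semiring_0 vec"
  assumes "w \<in> carrier_vec n"
  shows "v \<bullet> w = (\<Sum>i<n. v $ i * w $ i)"
  using assms by (auto simp: scalar_prod_def atLeast0LessThan)

lemma scalar_prod_self_nonneg: "0 \<le> v \<bullet> v" for v :: "real vec"
  by (auto simp: scalar_prod_def intro!: sum_nonneg)

lemma scalar_prod_self_eq_0_iff:
  fixes v :: "real vec"
  assumes "v \<in> carrier_vec n"
  shows "v \<bullet> v = 0 \<longleftrightarrow> v = 0\<^sub>v n"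
  using assms by (auto simp: scalar_prod_def sum_nonneg_eq_0_iff)

lemma index_mult_mat_vec_eq_sum:
  fixes A :: "'a :: semiring_0 mat"
  assumes "A \<in> carrier_mat n k" "v \<in> carrier_vec k" "i < n"
  shows "(A *\<^sub>v v) $ i = (\<Sum>j<k. A $$ (i,j) * v $ j)"
  using assms by (auto simp: scalar_prod_def atLeast0LessThan)

lemma bilinear_form_eq_sum:
  fixes A :: "'a :: semiring_0 mat"
  assumes "A \<in> carrier_mat n k" "x \<in> carrier_vec n" "y \<in> carrier_vec k"
  shows "x \<bullet> (A *\<^sub>v y) = (\<Sum>i<n. \<Sum>j<k. x $ i * A $$ (i,j) * y $ j)"
proof -
  have "x \<bullet> (A *\<^sub>v y) = (\<Sum>i<n. x $ i * (A *\<^sub>v y) $ i)"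
    by (rule scalar_prod_eq_sum) (use assms in auto)
  also have "\<dots> = (\<Sum>i<n. \<Sum>j<k. x $ i * A $$ (i,j) * y $ j)"
    by (intro sum.cong refl)
      (simp add: index_mult_mat_vec_eq_sum[OF assms(1,3)] sum_distrib_left mult.assoc del: index_mult_mat_vec)
  finally show ?thesis .
qed

lemma mat_eqI_mult_vec:
  fixes A B :: "'a :: semiring_1 mat"
  assumes "A \<in> carrier_mat n k" "B \<in> carrier_mat n k"
    and "\<And>v. v \<in> carrier_vec k \<Longrightarrow> A *\<^sub>v v = B *\<^sub>v v"
  shows "A = B"
proof (rule eq_matI)
  fix i j assume "i < dim_row B" "j < dim_col B"
  thus "A $$ (i,j) = B $$ (i,j)"
    using arg_cong[OF assms(3)[of "unit_vec k j"], of "\<lambda>v. v $ i"] assms(1,2) by auto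
qed (use assms in auto)

lemma sym_mat_scalar_prod:
  assumes "A \<in> carrier_mat n n" "sym_mat A" "x \<in> carrier_vec n" "y \<in> carrier_vec n"
  shows "x \<bullet> (A *\<^sub>v y) = (A *\<^sub>v x) \<bullet> y"
  using transpose_vec_mult_scalar[OF assms(1,4,3)] assms(2) by (simp add: sym_mat_def)

lemma sym_mat_index:
  assumes "A \<in> carrier_mat n n" "sym_mat A" "i < n" "j < n"
  shows "A $$ (i,j) = A $$ (j,i)"
  using assms by (metis sym_mat_def index_transpose_mat(1) carrier_matD)

lemma vnorm_nonneg [simp]: "0 \<le> vnorm v"
  by (simp add: vnorm_def scalar_prod_self_nonneg)

lemma vnorm_square: "(vnorm v)\<^sup>2 = v \<bullet> v"
  by (simp add: vnorm_def scalar_prod_self_nonneg)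

lemma vnorm_smult: "vnorm (c \<cdot>\<^sub>v v) = \<bar>c\<bar> * vnorm v"
proof -
  have "(c \<cdot>\<^sub>v v) \<bullet> (c \<cdot>\<^sub>v v) = c\<^sup>2 * (v \<bullet> v)"
    by (simp add: scalar_prod_def power2_eq_square sum_distrib_left mult_ac)
  thus ?thesis by (simp add: vnorm_def real_sqrt_mult)
qed

lemma vnorm_unit_vec: "i < n \<Longrightarrow> vnorm (unit_vec n i) = 1"
  by (simp add: vnorm_def)

lemma vnorm_mono:
  assumes "x \<in> carrier_vec n" "y \<in> carrier_vec n" "\<And>i. i < n \<Longrightarrow> \<bar>x $ i\<bar> \<le> \<bar>y $ i\<bar>"
  shows "vnorm x \<le> vnorm y"
  unfolding vnorm_def scalar_prod_eq_sum[OF assms(1)] scalar_prod_eq_sum[OF assms(2)]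
  using assms(3)
  by (intro real_sqrt_le_mono sum_mono) (simp add: abs_le_square_iff flip: power2_eq_square)

lemma abs_scalar_prod_le_vnorm:
  assumes "x \<in> carrier_vec n" "y \<in> carrier_vec n"
  shows "\<bar>x \<bullet> y\<bar> \<le> vnorm x * vnorm y"
proof (rule power2_le_imp_le)
  have "(x \<bullet> y)\<^sup>2 \<le> (x \<bullet> x) * (y \<bullet> y)"
    using Cauchy_Schwarz_ineq_sum[of "\<lambda>i. x $ i" "\<lambda>i. y $ i" "{..<n}"] assms
    by (simp add: scalar_prod_eq_sum power2_eq_square)
  thus "\<bar>x \<bullet> y\<bar>\<^sup>2 \<le> (vnorm x * vnorm y)\<^sup>2" by (simp add: power_mult_distrib vnorm_square)
qed simp

lemma frob_norm_nonneg [simp]: "0 \<le> frob_norm B"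
  by (simp add: frob_norm_def sum_nonneg)

lemma frob_norm_square:
  assumes "B \<in> carrier_mat n k"
  shows "(frob_norm B)\<^sup>2 = (\<Sum>i<n. \<Sum>j<k. (B $$ (i,j))\<^sup>2)"
  using assms by (simp add: frob_norm_def sum_nonneg)

lemma frob_norm_square_columns:
  assumes B: "B \<in> carrier_mat n k"
  shows "(frob_norm B)\<^sup>2 = (\<Sum>j<k. (vnorm (B *\<^sub>v unit_vec k j))\<^sup>2)"
proof -
  have "(vnorm (B *\<^sub>v unit_vec k j))\<^sup>2 = (\<Sum>i<n. (B $$ (i,j))\<^sup>2)" if "j < k" for j
    unfolding vnorm_square using B that
    by (subst scalar_prod_eq_sum[of _ n]) (auto simp: power2_eq_square)
  thus ?thesis unfolding frob_norm_square[OF B] by (subst sum.swap) simp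
qed

lemma vnorm_mult_mat_vec_le_frob_norm:
  assumes B: "B \<in> carrier_mat n k" and v: "v \<in> carrier_vec k"
  shows "vnorm (B *\<^sub>v v) \<le> frob_norm B * vnorm v"
proof (rule power2_le_imp_le)
  have "(vnorm (B *\<^sub>v v))\<^sup>2 = (\<Sum>i<n. (\<Sum>j<k. B $$ (i,j) * v $ j)\<^sup>2)"
    unfolding vnorm_square using B v
    by (subst scalar_prod_eq_sum[of _ n])
      (auto simp: index_mult_mat_vec_eq_sum[OF B v] power2_eq_square simp del: index_mult_mat_vec)
  also have "\<dots> \<le> (\<Sum>i<n. (\<Sum>j<k. (B $$ (i,j))\<^sup>2) * (\<Sum>j<k. (v $ j)\<^sup>2))"
    by (intro sum_mono Cauchy_Schwarz_ineq_sum)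
  also have "\<dots> = (frob_norm B * vnorm v)\<^sup>2"
    unfolding power_mult_distrib vnorm_square frob_norm_square[OF B] scalar_prod_eq_sum[OF v]
    by (simp add: power2_eq_square flip: sum_distrib_right)
  finally show "(vnorm (B *\<^sub>v v))\<^sup>2 \<le> (frob_norm B * vnorm v)\<^sup>2" .
qed simp

lemma bdd_above_spec_norm:
  "bdd_above {vnorm (B *\<^sub>v v) | v. v \<in> carrier_vec (dim_col B) \<and> vnorm v = 1}"
  using vnorm_mult_mat_vec_le_frob_norm[OF carrier_matI[OF refl refl], of _ B]
  by (intro bdd_aboveI[of _ "frob_norm B"]) fastforce

lemma vnorm_mult_mat_vec_le_spec_norm:
  assumes B: "B \<in> carrier_mat n k" and v: "v \<in> carrier_vec k"
  shows "vnorm (B *\<^sub>v v) \<le> spec_norm B * vnorm v"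
proof (cases "vnorm v = 0")
  case True
  thus ?thesis using vnorm_mult_mat_vec_le_frob_norm[OF B v] by simp
next
  case False
  hence pos: "vnorm v > 0" using vnorm_nonneg[of v] by linarith
  define w where "w = (1 / vnorm v) \<cdot>\<^sub>v v"
  have w: "w \<in> carrier_vec k" "vnorm w = 1" using v pos by (auto simp: w_def vnorm_smult)
  have "vnorm (B *\<^sub>v w) \<le> spec_norm B"
    unfolding spec_norm_def using w B by (intro cSup_upper bdd_above_spec_norm) auto
  moreover have "B *\<^sub>v w = (1 / vnorm v) \<cdot>\<^sub>v (B *\<^sub>v v)" using B v by (simp add: w_def mult_mat_vec)
  ultimately show ?thesis using pos by (simp add: vnorm_smult field_simps)
qed

lemma spec_norm_nonneg:
  assumes "B \<in> carrier_mat n k" "0 < k"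
  shows "0 \<le> spec_norm B"
  using order_trans[OF vnorm_nonneg vnorm_mult_mat_vec_le_spec_norm[OF assms(1) unit_vec_carrier, of 0]]
    assms(2) by (simp add: vnorm_unit_vec)

lemma spec_norm_leI:
  assumes B: "B \<in> carrier_mat n k" and k: "0 < k"
    and unit: "\<And>v. v \<in> carrier_vec k \<Longrightarrow> vnorm v = 1 \<Longrightarrow> vnorm (B *\<^sub>v v) \<le> c"
  shows "spec_norm B \<le> c"
  unfolding spec_norm_def
proof (rule cSup_least)
  show "{vnorm (B *\<^sub>v v) |v. v \<in> carrier_vec (dim_col B) \<and> vnorm v = 1} \<noteq> {}"
    using B vnorm_unit_vec[OF k] by (auto intro!: exI[of _ "unit_vec k 0"])
qed (use unit B in auto)

lemma spec_norm_le_frob_norm: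
  assumes "B \<in> carrier_mat n k" "0 < k"
  shows "spec_norm B \<le> frob_norm B"
  using vnorm_mult_mat_vec_le_frob_norm[OF assms(1)] by (intro spec_norm_leI[OF assms]) fastforce

lemma abs_bilinear_form_le_spec_norm:
  assumes "B \<in> carrier_mat n k" "x \<in> carrier_vec n" "y \<in> carrier_vec k"
  shows "\<bar>x \<bullet> (B *\<^sub>v y)\<bar> \<le> spec_norm B * vnorm x * vnorm y"
proof -
  have "\<bar>x \<bullet> (B *\<^sub>v y)\<bar> \<le> vnorm x * vnorm (B *\<^sub>v y)"
    by (rule abs_scalar_prod_le_vnorm) (use assms in auto)
  also have "\<dots> \<le> vnorm x * (spec_norm B * vnorm y)"
    by (intro mult_left_mono vnorm_mult_mat_vec_le_spec_norm) (use assms in auto)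
  finally show ?thesis by (simp add: algebra_simps)
qed

section \<open>The spectral theorem for real symmetric matrices\<close>

definition perp :: "nat \<Rightarrow> real vec set \<Rightarrow> real vec set" where
  "perp n U = {v \<in> carrier_vec n. \<forall>u\<in>U. u \<bullet> v = 0}"

lemma perp_add:
  assumes "U \<subseteq> carrier_vec n" "v \<in> perp n U" "w \<in> perp n U"
  shows "v + w \<in> perp n U"
  using assms by (auto simp: perp_def scalar_prod_add_distrib[of _ n] subset_iff)

lemma perp_smult:
  assumes "U \<subseteq> carrier_vec n" "v \<in> perp n U"
  shows "c \<cdot>\<^sub>v v \<in> perp n U"
  using assms by (auto simp: perp_def subset_iff)

lemma perp_invariant:
  assumes A: "A \<in> carrier_mat n n" "sym_mat A"
    and U: "\<And>u. u \<in> U \<Longrightarrow> u \<in> carrier_vec n \<and> (\<exists>c. A *\<^sub>v u = c \<cdot>\<^sub>v u)"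
    and v: "v \<in> perp n U"
  shows "A *\<^sub>v v \<in> perp n U"
  unfolding perp_def
proof (intro CollectI conjI ballI)
  fix u assume u: "u \<in> U"
  have v': "v \<in> carrier_vec n" "u \<bullet> v = 0" using v u by (auto simp: perp_def)
  then show "u \<bullet> (A *\<^sub>v v) = 0"
    using sym_mat_scalar_prod[OF A, of u v] U[OF u] by auto
qed (use A v in \<open>auto simp: perp_def\<close>)

lemma exists_unit_vec_perp:
  fixes u :: "nat \<Rightarrow> real vec"
  assumes "k < n" "\<And>j. j < k \<Longrightarrow> u j \<in> carrier_vec n"
  obtains v where "v \<in> perp n (u ` {..<k})" "v \<bullet> v = 1"
proof -
  define M where "M = mat n n (\<lambda>(i,j). if i < k then u i $ j else 0)"
  have M: "M \<in> carrier_mat n n" by (simp add: M_def)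
  have "transpose_mat M *\<^sub>v unit_vec n k = 0\<^sub>v n"
    using assms(1) by (intro eq_vecI) (auto simp: M_def)
  hence "det (transpose_mat M) = 0"
    using det_0_iff_vec_prod_zero[of "transpose_mat M" n] M assms(1)
    by (metis transpose_carrier_mat unit_vec_carrier unit_vec_nonzero)
  hence "det M = 0" using det_transpose[OF M] by simp
  then obtain w where w: "w \<in> carrier_vec n" "w \<noteq> 0\<^sub>v n" "M *\<^sub>v w = 0\<^sub>v n"
    using det_0_iff_vec_prod_zero[OF M] by auto
  have "u j \<bullet> w = (M *\<^sub>v w) $ j" if "j < k" for j
    using that assms w(1) by (auto simp: M_def scalar_prod_def intro!: sum.cong)
  hence perp: "w \<in> perp n (u ` {..<k})" using w assms(1) by (auto simp: perp_def)
  have pos: "w \<bullet> w > 0"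
    using w scalar_prod_self_nonneg[of w] scalar_prod_self_eq_0_iff[OF w(1)] by force
  show ?thesis
  proof (rule that)
    show "(1 / sqrt (w \<bullet> w)) \<cdot>\<^sub>v w \<in> perp n (u ` {..<k})"
      by (rule perp_smult[OF _ perp]) (use assms in auto)
    show "((1 / sqrt (w \<bullet> w)) \<cdot>\<^sub>v w) \<bullet> ((1 / sqrt (w \<bullet> w)) \<cdot>\<^sub>v w) = 1"
      using w(1) pos by (simp add: field_simps)
  qed
qed

lemma compact_unit_sphere_fun:
  "compact {x :: nat \<Rightarrow> real. (\<forall>i\<ge>n. x i = 0) \<and> (\<Sum>i<n. (x i)\<^sup>2) = 1}"
proof -
  define box where "box = PiE UNIV (\<lambda>i. if i < n then {-1..1} else {0::real})"
  have "compactin (product_topology (\<lambda>i. euclidean) UNIV) box"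
    unfolding box_def compactin_PiE by auto
  hence "compact box" by (simp add: euclidean_product_topology)
  moreover have "closed {x :: nat \<Rightarrow> real. (\<Sum>i<n. (x i)\<^sup>2) = 1}"
    by (intro closed_Collect_eq continuous_intros
        continuous_on_product_coordinates[THEN continuous_on_subset]) auto
  moreover have "{x. (\<forall>i\<ge>n. x i = 0) \<and> (\<Sum>i<n. (x i)\<^sup>2) = 1} = box \<inter> {x. (\<Sum>i<n. (x i)\<^sup>2) = 1}"
  proof -
    have "x i \<in> {-1..1}" if "(\<Sum>i<n. (x i)\<^sup>2) = 1" "i < n" for x :: "nat \<Rightarrow> real" and i
    proof -
      have "(x i)\<^sup>2 \<le> (\<Sum>i<n. (x i)\<^sup>2)" using that(2) by (intro member_le_sum) auto
      thus ?thesis using that(1) by (auto simp: abs_square_le_1 abs_le_iff)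
    qed
    thus ?thesis by (fastforce simp: box_def PiE_UNIV_domain Pi_def not_less split: if_splits)
  qed
  ultimately show ?thesis by (simp add: compact_Int_closed)
qed

lemma quadratic_form_le_if_unit_le:
  assumes A: "A \<in> carrier_mat n n" and U: "U \<subseteq> carrier_vec n"
    and unit: "\<And>w. w \<in> perp n U \<Longrightarrow> w \<bullet> w = 1 \<Longrightarrow> w \<bullet> (A *\<^sub>v w) \<le> c"
    and y: "y \<in> perp n U"
  shows "y \<bullet> (A *\<^sub>v y) \<le> c * (y \<bullet> y)"
proof (cases "y \<bullet> y = 0")
  case True
  thus ?thesis using A y scalar_prod_self_eq_0_iff[of y n] by (auto simp: perp_def)
next
  case False
  have y_carrier: "y \<in> carrier_vec n" using y by (simp add: perp_def)
  have pos: "0 < y \<bullet> y" using False scalar_prod_self_nonneg[of y] by linarith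
  define w where "w = (1 / sqrt (y \<bullet> y)) \<cdot>\<^sub>v y"
  have "w \<in> perp n U" unfolding w_def by (rule perp_smult[OF U y])
  moreover have "w \<bullet> w = 1" using y_carrier pos by (simp add: w_def field_simps)
  ultimately have "w \<bullet> (A *\<^sub>v w) \<le> c" by (rule unit)
  moreover have "w \<bullet> (A *\<^sub>v w) = (y \<bullet> (A *\<^sub>v y)) / (y \<bullet> y)"
    using A y_carrier pos by (simp add: w_def mult_mat_vec[of _ n n] field_simps)
  ultimately show ?thesis using pos by (simp add: field_simps)
qed

lemma rayleigh_quotient_attains_max:
  assumes A: "A \<in> carrier_mat n n" and U: "U \<subseteq> carrier_vec n"
    and nonempty: "v \<in> perp n U" "v \<bullet> v = 1"
  obtains x where "x \<in> perp n U" "x \<bullet> x = 1"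
    "\<And>y. y \<in> perp n U \<Longrightarrow> y \<bullet> (A *\<^sub>v y) \<le> (x \<bullet> (A *\<^sub>v x)) * (y \<bullet> y)"
proof -
  define X where "X = {x :: nat \<Rightarrow> real. (\<forall>i\<ge>n. x i = 0) \<and> (\<Sum>i<n. (x i)\<^sup>2) = 1} \<inter>
    (\<Inter>u\<in>U. {x. u \<bullet> vec n x = 0})"
  define f where "f x = vec n x \<bullet> (A *\<^sub>v vec n x)" for x
  note coordinate = continuous_on_product_coordinates[THEN continuous_on_subset]
  have "continuous_on S (\<lambda>x. u \<bullet> vec n x)" for u :: "real vec" and S
    unfolding scalar_prod_eq_sum[OF vec_carrier]
    by (simp, intro continuous_intros coordinate) auto
  hence "compact X" unfolding X_def
    by (intro compact_Int_closed compact_unit_sphere_fun closed_INT ballI closed_Collect_eq) auto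
  moreover have "continuous_on S f" for S
    unfolding f_def bilinear_form_eq_sum[OF A vec_carrier vec_carrier]
    by (simp, intro continuous_intros coordinate) auto
  moreover have to_fun: "\<exists>x\<in>X. w = vec n x" if "w \<in> perp n U" "w \<bullet> w = 1" for w
    using that by (intro bexI[of _ "\<lambda>i. if i < n then w $ i else 0"])
      (auto simp: X_def perp_def scalar_prod_eq_sum[of _ n] power2_eq_square)
  ultimately obtain x where x: "x \<in> X" "\<And>y. y \<in> X \<Longrightarrow> f y \<le> f x"
    using continuous_attains_sup[of X f] nonempty by blast
  show ?thesis
  proof (rule that[of "vec n x"])
    show "vec n x \<in> perp n U" "vec n x \<bullet> vec n x = 1"
      using x(1) by (auto simp: X_def perp_def scalar_prod_eq_sum[of _ n] power2_eq_square)
    show "y \<bullet> (A *\<^sub>v y) \<le> (vec n x \<bullet> (A *\<^sub>v vec n x)) * (y \<bullet> y)" if "y \<in> perp n U" for y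
      using to_fun x(2) by (intro quadratic_form_le_if_unit_le[OF A U _ that]) (metis f_def)
  qed
qed

lemma nonneg_quadratic_imp_linear_coeff_0:
  fixes a b :: real
  assumes "\<And>t. 0 \<le> t\<^sup>2 * a - 2 * t * b"
  shows "b = 0"
proof (rule ccontr)
  assume "b \<noteq> 0"
  define t where "t = b / (\<bar>a\<bar> + 1)"
  have "t * b > 0" using \<open>b \<noteq> 0\<close> by (simp add: t_def power2_eq_square[symmetric] add_nonneg_pos)
  have "2 * (t * b) \<le> t\<^sup>2 * a" using assms[of t] by simp
  also have "\<dots> \<le> t\<^sup>2 * (\<bar>a\<bar> + 1)" by (intro mult_left_mono) auto
  also have "\<dots> = t * b" by (simp add: t_def power2_eq_square add_nonneg_eq_0_iff)
  finally show False using \<open>t * b > 0\<close> by linarith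
qed

lemma rayleigh_maximizer_eigenvector:
  assumes A: "A \<in> carrier_mat n n" "sym_mat A" and U: "U \<subseteq> carrier_vec n"
    and invariant: "\<And>v. v \<in> perp n U \<Longrightarrow> A *\<^sub>v v \<in> perp n U"
    and x: "x \<in> perp n U" "x \<bullet> x = 1"
    and max: "\<And>y. y \<in> perp n U \<Longrightarrow> y \<bullet> (A *\<^sub>v y) \<le> (x \<bullet> (A *\<^sub>v x)) * (y \<bullet> y)"
  shows "A *\<^sub>v x = (x \<bullet> (A *\<^sub>v x)) \<cdot>\<^sub>v x"
proof -
  define c where "c = x \<bullet> (A *\<^sub>v x)"
  define y where "y = A *\<^sub>v x + (- c) \<cdot>\<^sub>v x"
  have y: "y \<in> perp n U" unfolding y_def by (intro perp_add perp_smult U invariant x)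
  have carrier: "x \<in> carrier_vec n" "y \<in> carrier_vec n" "A *\<^sub>v x \<in> carrier_vec n" "A *\<^sub>v y \<in> carrier_vec n"
    using x y A by (auto simp: perp_def)
  have "x \<bullet> y = 0"
    using carrier x(2) by (simp add: y_def scalar_prod_add_distrib[of _ n] c_def)
  hence yx: "y \<bullet> x = 0" "x \<bullet> y = 0" using comm_scalar_prod[OF carrier(1,2)] by auto
  have "y \<bullet> (A *\<^sub>v x) = y \<bullet> y + c * (y \<bullet> x)"
    using carrier by (simp add: y_def scalar_prod_add_distrib[of _ n] algebra_simps)
  hence yAx: "y \<bullet> (A *\<^sub>v x) = y \<bullet> y" using yx by simp
  hence xAy: "x \<bullet> (A *\<^sub>v y) = y \<bullet> y"
    using sym_mat_scalar_prod[OF A carrier(1,2)] comm_scalar_prod[OF carrier(2,3)] by simp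
  have "y \<bullet> y = 0"
  proof (rule nonneg_quadratic_imp_linear_coeff_0)
    fix t :: real
    define z where "z = x + t \<cdot>\<^sub>v y"
    have "z \<in> perp n U" unfolding z_def by (intro perp_add perp_smult U x y)
    moreover have "z \<bullet> z = 1 + t\<^sup>2 * (y \<bullet> y)"
      unfolding z_def using carrier x(2) yx
      by (simp add: scalar_prod_add_distrib[of _ n] add_scalar_prod_distrib[of _ n] power2_eq_square)
    moreover have "A *\<^sub>v z = A *\<^sub>v x + t \<cdot>\<^sub>v (A *\<^sub>v y)"
      unfolding z_def using A carrier
      by (simp add: mult_add_distrib_mat_vec[of _ n n] mult_mat_vec[of _ n n])
    hence "z \<bullet> (A *\<^sub>v z) = c + 2 * t * (y \<bullet> y) + t\<^sup>2 * (y \<bullet> (A *\<^sub>v y))"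
      unfolding z_def using carrier
      by (simp add: scalar_prod_add_distrib[of _ n] add_scalar_prod_distrib[of _ n] yAx xAy
          power2_eq_square c_def algebra_simps)
    ultimately show "0 \<le> t\<^sup>2 * (c * (y \<bullet> y) - y \<bullet> (A *\<^sub>v y)) - 2 * t * (y \<bullet> y)"
      using max[of z] by (simp add: c_def algebra_simps)
  qed
  hence "A *\<^sub>v x + (- c) \<cdot>\<^sub>v x = 0\<^sub>v n" using scalar_prod_self_eq_0_iff[OF carrier(2)]
    by (simp add: y_def)
  hence "A *\<^sub>v x = c \<cdot>\<^sub>v x" using carrier A by (auto simp: vec_eq_iff)
  thus ?thesis by (simp add: c_def)
qed

locale eigenbasis =
  fixes n :: nat and A :: "real mat" and u :: "nat \<Rightarrow> real vec" and \<mu> :: "nat \<Rightarrow> real"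
  assumes mat_carrier: "A \<in> carrier_mat n n"
    and mat_sym: "sym_mat A"
    and vec_carrier: "k < n \<Longrightarrow> u k \<in> carrier_vec n"
    and eigen: "k < n \<Longrightarrow> A *\<^sub>v u k = \<mu> k \<cdot>\<^sub>v u k"
    and orthonormal: "i < n \<Longrightarrow> j < n \<Longrightarrow> u i \<bullet> u j = (if i = j then 1 else 0)"

theorem sym_mat_eigenbasis:
  assumes A: "A \<in> carrier_mat n n" "sym_mat A"
  obtains u \<mu> where "eigenbasis n A u \<mu>"
proof -
  have "\<exists>u \<mu>. (\<forall>i<k. u i \<in> carrier_vec n \<and> A *\<^sub>v u i = \<mu> i \<cdot>\<^sub>v u i) \<and>
     (\<forall>i<k. \<forall>j<k. u i \<bullet> u j = (if i = j then 1 else 0))" if "k \<le> n" for k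
    using that
  proof (induction k)
    case (Suc k)
    then obtain u \<mu> where u: "\<And>i. i < k \<Longrightarrow> u i \<in> carrier_vec n"
      "\<And>i. i < k \<Longrightarrow> A *\<^sub>v u i = \<mu> i \<cdot>\<^sub>v u i"
      "\<And>i j. i < k \<Longrightarrow> j < k \<Longrightarrow> u i \<bullet> u j = (if i = j then 1 else 0)" by (metis Suc_leD)
    define U where "U = u ` {..<k}"
    have U: "U \<subseteq> carrier_vec n" using u by (auto simp: U_def)
    obtain v where "v \<in> perp n U" "v \<bullet> v = 1"
      using exists_unit_vec_perp[of k n u] u(1) Suc.prems unfolding U_def by auto
    then obtain x where x: "x \<in> perp n U" "x \<bullet> x = 1"
      "\<And>y. y \<in> perp n U \<Longrightarrow> y \<bullet> (A *\<^sub>v y) \<le> (x \<bullet> (A *\<^sub>v x)) * (y \<bullet> y)"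
      using rayleigh_quotient_attains_max[OF A(1) U] by blast
    have "A *\<^sub>v v \<in> perp n U" if "v \<in> perp n U" for v
      by (rule perp_invariant[OF A _ that]) (use u in \<open>auto simp: U_def\<close>)
    hence eigen: "A *\<^sub>v x = (x \<bullet> (A *\<^sub>v x)) \<cdot>\<^sub>v x"
      using rayleigh_maximizer_eigenvector[OF A U _ x] by blast
    have "x \<in> carrier_vec n" "u j \<bullet> x = 0" "x \<bullet> u j = 0" if "j < k" for j
      using x(1) that u(1)[OF that] comm_scalar_prod[of x n "u j"] by (auto simp: perp_def U_def)
    moreover have "x \<in> carrier_vec n" using x(1) by (simp add: perp_def)
    ultimately show ?case
      using u x(2) eigen by (intro exI[of _ "u(k := x)"] exI[of _ "\<mu>(k := x \<bullet> (A *\<^sub>v x))"])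
        (auto simp: less_Suc_eq)
  qed auto
  then obtain u \<mu> where "\<forall>i<n. u i \<in> carrier_vec n \<and> A *\<^sub>v u i = \<mu> i \<cdot>\<^sub>v u i"
    "\<forall>i<n. \<forall>j<n. u i \<bullet> u j = (if i = j then 1 else 0)" by blast
  hence "eigenbasis n A u \<mu>" using A by (intro eigenbasis.intro) auto
  thus ?thesis by (rule that)
qed

section \<open>Functions of symmetric matrices\<close>

definition trace_mat :: "'a :: comm_monoid_add mat \<Rightarrow> 'a" where
  "trace_mat A = (\<Sum>i<dim_row A. A $$ (i,i))"

definition krylov :: "real mat \<Rightarrow> real vec \<Rightarrow> nat \<Rightarrow> real vec" where
  "krylov A v j = ((*\<^sub>v) A ^^ j) v"

lemma krylov_0 [simp]: "krylov A v 0 = v"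
  by (simp add: krylov_def)

lemma krylov_Suc [simp]: "krylov A v (Suc j) = A *\<^sub>v krylov A v j"
  by (simp add: krylov_def)

lemma krylov_carrier:
  assumes "A \<in> carrier_mat n n" "v \<in> carrier_vec n"
  shows "krylov A v j \<in> carrier_vec n"
  using assms by (induction j) auto

context eigenbasis
begin

definition basis_mat :: "real mat" where
  "basis_mat = mat n n (\<lambda>(i,k). u k $ i)"

lemma basis_mat_carrier: "basis_mat \<in> carrier_mat n n"
  by (simp add: basis_mat_def)

lemma basis_mat_orthogonal:
  "transpose_mat basis_mat * basis_mat = 1\<^sub>m n" "basis_mat * transpose_mat basis_mat = 1\<^sub>m n"
proof -
  show left: "transpose_mat basis_mat * basis_mat = 1\<^sub>m n"
  proof (rule eq_matI)
    fix i j assume "i < dim_row (1\<^sub>m n :: real mat)" "j < dim_col (1\<^sub>m n :: real mat)"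
    moreover from this have "(transpose_mat basis_mat * basis_mat) $$ (i,j) = u i \<bullet> u j"
      using vec_carrier[of i] vec_carrier[of j] by (auto simp: basis_mat_def scalar_prod_def)
    ultimately show "(transpose_mat basis_mat * basis_mat) $$ (i,j) = 1\<^sub>m n $$ (i,j)"
      using orthonormal by auto
  qed (auto simp: basis_mat_def)
  show "basis_mat * transpose_mat basis_mat = 1\<^sub>m n"
    by (rule mat_mult_left_right_inverse[OF _ basis_mat_carrier left]) (simp add: basis_mat_carrier)
qed

lemma transpose_basis_mat_mult_index:
  assumes "x \<in> carrier_vec n" "k < n"
  shows "(transpose_mat basis_mat *\<^sub>v x) $ k = u k \<bullet> x"
  using assms vec_carrier[of k] by (auto simp: basis_mat_def scalar_prod_def intro!: sum.cong)

lemma parseval: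
  assumes x: "x \<in> carrier_vec n" and y: "y \<in> carrier_vec n"
  shows "x \<bullet> y = (\<Sum>k<n. (u k \<bullet> x) * (u k \<bullet> y))"
proof -
  have Uy: "transpose_mat basis_mat *\<^sub>v y \<in> carrier_vec n" using basis_mat_carrier y by auto
  have "y = basis_mat *\<^sub>v (transpose_mat basis_mat *\<^sub>v y)"
    using basis_mat_orthogonal(2) basis_mat_carrier y
    by (metis assoc_mult_mat_vec one_mult_mat_vec transpose_carrier_mat)
  hence "x \<bullet> y = (transpose_mat basis_mat *\<^sub>v x) \<bullet> (transpose_mat basis_mat *\<^sub>v y)"
    using transpose_vec_mult_scalar[OF basis_mat_carrier Uy x] by simp
  also have "\<dots> = (\<Sum>k<n. (u k \<bullet> x) * (u k \<bullet> y))"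
    unfolding scalar_prod_eq_sum[OF Uy]
    by (intro sum.cong refl) (simp add: transpose_basis_mat_mult_index x y del: index_mult_mat_vec)
  finally show ?thesis .
qed

lemma sum_coeff_square:
  assumes "x \<in> carrier_vec n"
  shows "(\<Sum>k<n. (u k \<bullet> x)\<^sup>2) = x \<bullet> x"
  by (simp add: parseval[OF assms assms] power2_eq_square)

lemma coeff_eqI:
  assumes "x \<in> carrier_vec n" "y \<in> carrier_vec n" "\<And>k. k < n \<Longrightarrow> u k \<bullet> x = u k \<bullet> y"
  shows "x = y"
proof (rule eq_vecI)
  fix a assume "a < dim_vec y"
  hence a: "a < n" using assms(2) by simp
  have "unit_vec n a \<bullet> x = unit_vec n a \<bullet> y"
    unfolding parseval[OF unit_vec_carrier assms(1)] parseval[OF unit_vec_carrier assms(2)]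
    using assms(3) by simp
  thus "x $ a = y $ a" using assms(1,2) a by simp
qed (use assms in auto)

lemma coeff_mult_mat:
  assumes "x \<in> carrier_vec n" "k < n"
  shows "u k \<bullet> (A *\<^sub>v x) = \<mu> k * (u k \<bullet> x)"
  using sym_mat_scalar_prod[OF mat_carrier mat_sym vec_carrier assms(1)] assms vec_carrier eigen
  by simp

definition spectral_mat :: "(real \<Rightarrow> real) \<Rightarrow> real mat" where
  "spectral_mat f = mat n n (\<lambda>(a,b). \<Sum>k<n. f (\<mu> k) * u k $ a * u k $ b)"

lemma spectral_mat_carrier: "spectral_mat f \<in> carrier_mat n n"
  by (simp add: spectral_mat_def)

lemma spectral_mat_bilinear:
  assumes x: "x \<in> carrier_vec n" and y: "y \<in> carrier_vec n"
  shows "x \<bullet> (spectral_mat f *\<^sub>v y) = (\<Sum>k<n. f (\<mu> k) * (u k \<bullet> x) * (u k \<bullet> y))"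
proof -
  have "x \<bullet> (spectral_mat f *\<^sub>v y) = (\<Sum>a<n. \<Sum>b<n. \<Sum>k<n. f (\<mu> k) * (u k $ a * x $ a) * (u k $ b * y $ b))"
    unfolding bilinear_form_eq_sum[OF spectral_mat_carrier x y]
    by (auto simp: spectral_mat_def sum_distrib_left sum_distrib_right algebra_simps intro!: sum.cong)
  also have "\<dots> = (\<Sum>a<n. \<Sum>k<n. \<Sum>b<n. f (\<mu> k) * (u k $ a * x $ a) * (u k $ b * y $ b))"
    by (intro sum.cong refl sum.swap)
  also have "\<dots> = (\<Sum>k<n. \<Sum>a<n. \<Sum>b<n. f (\<mu> k) * (u k $ a * x $ a) * (u k $ b * y $ b))" by (rule sum.swap)
  also have "\<dots> = (\<Sum>k<n. f (\<mu> k) * (u k \<bullet> x) * (u k \<bullet> y))"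
    unfolding scalar_prod_eq_sum[OF x] scalar_prod_eq_sum[OF y]
    by (intro sum.cong refl, simp only: mult.assoc sum_product) (simp only: sum_distrib_left mult.assoc)
  finally show ?thesis .
qed

lemma coeff_spectral_mat:
  assumes x: "x \<in> carrier_vec n" and k: "k < n"
  shows "u k \<bullet> (spectral_mat f *\<^sub>v x) = f (\<mu> k) * (u k \<bullet> x)"
proof -
  have "u k \<bullet> (spectral_mat f *\<^sub>v x) = (\<Sum>i<n. if i = k then f (\<mu> i) * (u i \<bullet> x) else 0)"
    unfolding spectral_mat_bilinear[OF vec_carrier[OF k] x]
    using k by (intro sum.cong refl) (simp add: orthonormal)
  thus ?thesis using k by simp
qed

lemma spectral_mat_unique:
  assumes B: "B \<in> carrier_mat n n" "\<And>k. k < n \<Longrightarrow> B *\<^sub>v u k = f (\<mu> k) \<cdot>\<^sub>v u k"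
  shows "B = spectral_mat f"
proof -
  note S = spectral_mat_carrier[of f]
  have S_eigen: "spectral_mat f *\<^sub>v u k = f (\<mu> k) \<cdot>\<^sub>v u k" if k: "k < n" for k
    using S vec_carrier k
    by (intro coeff_eqI) (auto simp: coeff_spectral_mat orthonormal scalar_prod_smult_distrib[of _ n])
  have "transpose_mat B = transpose_mat (spectral_mat f)"
  proof (rule mat_eqI_mult_vec)
    fix x :: "real vec" assume x: "x \<in> carrier_vec n"
    show "transpose_mat B *\<^sub>v x = transpose_mat (spectral_mat f) *\<^sub>v x"
    proof (rule coeff_eqI)
      fix k assume k: "k < n"
      have transpose: "u k \<bullet> (transpose_mat C *\<^sub>v x) = x \<bullet> (C *\<^sub>v u k)" if "C \<in> carrier_mat n n" for C
        using transpose_vec_mult_scalar[OF that vec_carrier[OF k] x] comm_scalar_prod[of "u k" n]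
          vec_carrier[OF k] x that by simp
      show "u k \<bullet> (transpose_mat B *\<^sub>v x) = u k \<bullet> (transpose_mat (spectral_mat f) *\<^sub>v x)"
        by (simp add: transpose B(1) B(2) S S_eigen k)
    qed (use B S x in auto)
  qed (use B S in auto)
  thus ?thesis by (metis transpose_transpose)
qed

lemma mat_fun_eq_spectral_mat: "mat_fun f A = spectral_mat f"
  unfolding mat_fun_def
proof (rule the_equality)
  have dim: "dim_row A = n" using mat_carrier by simp
  show "spectral_mat f \<in> carrier_mat (dim_row A) (dim_row A) \<and>
    (\<forall>v c. v \<in> carrier_vec (dim_row A) \<longrightarrow> A *\<^sub>v v = c \<cdot>\<^sub>v v \<longrightarrow> spectral_mat f *\<^sub>v v = f c \<cdot>\<^sub>v v)"
    unfolding dim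
  proof (intro conjI allI impI spectral_mat_carrier)
    fix v c assume v: "v \<in> carrier_vec n" "A *\<^sub>v v = c \<cdot>\<^sub>v v"
    show "spectral_mat f *\<^sub>v v = f c \<cdot>\<^sub>v v"
    proof (rule coeff_eqI)
      fix k assume k: "k < n"
      have "\<mu> k * (u k \<bullet> v) = c * (u k \<bullet> v)"
        using coeff_mult_mat[OF v(1) k] v vec_carrier[OF k] by auto
      hence "f (\<mu> k) * (u k \<bullet> v) = f c * (u k \<bullet> v)" by (metis mult_cancel_right)
      thus "u k \<bullet> (spectral_mat f *\<^sub>v v) = u k \<bullet> (f c \<cdot>\<^sub>v v)"
        using coeff_spectral_mat[OF v(1) k] v(1) vec_carrier[OF k] by simp
    qed (use v mult_mat_vec_carrier[OF spectral_mat_carrier v(1)] in auto)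
  qed
  fix B assume "B \<in> carrier_mat (dim_row A) (dim_row A) \<and>
    (\<forall>v c. v \<in> carrier_vec (dim_row A) \<longrightarrow> A *\<^sub>v v = c \<cdot>\<^sub>v v \<longrightarrow> B *\<^sub>v v = f c \<cdot>\<^sub>v v)"
  thus "B = spectral_mat f" unfolding dim using vec_carrier eigen by (intro spectral_mat_unique) auto
qed

lemma mat_fun_carrier: "mat_fun f A \<in> carrier_mat n n"
  by (simp add: mat_fun_eq_spectral_mat spectral_mat_carrier)

lemma mat_fun_mult_carrier: "x \<in> carrier_vec n \<Longrightarrow> mat_fun f A *\<^sub>v x \<in> carrier_vec n"
  by (rule mult_mat_vec_carrier[OF mat_fun_carrier])

lemma mat_fun_sym: "sym_mat (mat_fun f A)"
  unfolding sym_mat_def mat_fun_eq_spectral_mat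
  by (intro conjI exI[of _ n] eq_matI) (auto simp: spectral_mat_def mult_ac)

lemma coeff_mat_fun:
  assumes "x \<in> carrier_vec n" "k < n"
  shows "u k \<bullet> (mat_fun f A *\<^sub>v x) = f (\<mu> k) * (u k \<bullet> x)"
  using coeff_spectral_mat[OF assms] by (simp add: mat_fun_eq_spectral_mat)

lemma mat_fun_id: "mat_fun (\<lambda>x. x) A = A"
  unfolding mat_fun_eq_spectral_mat
  by (rule spectral_mat_unique[symmetric]) (use mat_carrier eigen in auto)

lemma mat_fun_quadratic:
  assumes "x \<in> carrier_vec n"
  shows "x \<bullet> (mat_fun f A *\<^sub>v x) = (\<Sum>k<n. f (\<mu> k) * (u k \<bullet> x)\<^sup>2)"
  unfolding mat_fun_eq_spectral_mat spectral_mat_bilinear[OF assms assms]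
  by (simp add: power2_eq_square mult.assoc)

lemma trace_mat_fun: "trace_mat (mat_fun f A) = (\<Sum>k<n. f (\<mu> k))"
proof -
  have "trace_mat (mat_fun f A) = (\<Sum>i<n. \<Sum>k<n. f (\<mu> k) * (u k $ i)\<^sup>2)"
    by (simp add: trace_mat_def mat_fun_eq_spectral_mat spectral_mat_def power2_eq_square mult.assoc)
  also have "\<dots> = (\<Sum>k<n. f (\<mu> k) * (\<Sum>i<n. (u k $ i)\<^sup>2))"
    by (subst sum.swap) (simp add: sum_distrib_left)
  also have "\<dots> = (\<Sum>k<n. f (\<mu> k) * (u k \<bullet> u k))"
    by (intro sum.cong refl) (simp add: scalar_prod_eq_sum[OF vec_carrier] power2_eq_square)
  finally show ?thesis by (simp add: orthonormal)
qed

lemma trace_mat_eq_sum_eigenvalues: "trace_mat A = (\<Sum>k<n. \<mu> k)"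
  using trace_mat_fun[of "\<lambda>x. x"] by (simp add: mat_fun_id)

lemma frob_norm_mat_fun: "(frob_norm (mat_fun f A))\<^sup>2 = (\<Sum>k<n. (f (\<mu> k))\<^sup>2)"
proof -
  have "(vnorm (mat_fun f A *\<^sub>v unit_vec n j))\<^sup>2 = (\<Sum>k<n. (f (\<mu> k))\<^sup>2 * (u k $ j)\<^sup>2)" if "j < n" for j
  proof -
    have "mat_fun f A *\<^sub>v unit_vec n j \<in> carrier_vec n" by (simp add: mat_fun_mult_carrier)
    thus ?thesis using that
      by (simp add: vnorm_square coeff_mat_fun power_mult_distrib flip: sum_coeff_square)
  qed
  hence "(frob_norm (mat_fun f A))\<^sup>2 = (\<Sum>j<n. \<Sum>k<n. (f (\<mu> k))\<^sup>2 * (u k $ j)\<^sup>2)"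
    by (simp add: frob_norm_square_columns[OF mat_fun_carrier])
  also have "\<dots> = (\<Sum>k<n. (f (\<mu> k))\<^sup>2 * (\<Sum>j<n. (u k $ j)\<^sup>2))"
    by (subst sum.swap) (simp add: sum_distrib_left)
  also have "\<dots> = (\<Sum>k<n. (f (\<mu> k))\<^sup>2 * (u k \<bullet> u k))"
    by (intro sum.cong refl) (simp add: scalar_prod_eq_sum[OF vec_carrier] power2_eq_square)
  finally show ?thesis by (simp add: orthonormal)
qed

lemma det_eq_prod_eigenvalues: "det A = (\<Prod>k<n. \<mu> k)"
proof -
  define D where "D = mat n n (\<lambda>(i,j). if i = j then \<mu> i else 0)"
  have D: "D \<in> carrier_mat n n" by (simp add: D_def)
  note U = basis_mat_carrier
  have "A * basis_mat = basis_mat * D"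
  proof (rule eq_matI)
    fix i j assume "i < dim_row (basis_mat * D)" "j < dim_col (basis_mat * D)"
    hence ij: "i < n" "j < n" using U D by auto
    have "(A * basis_mat) $$ (i,j) = (A *\<^sub>v u j) $ i"
      using ij mat_carrier vec_carrier[of j]
      by (auto simp: basis_mat_def scalar_prod_def intro!: sum.cong)
    also have "\<dots> = \<mu> j * u j $ i" using ij eigen vec_carrier[of j] by simp
    also have "\<dots> = (basis_mat * D) $$ (i,j)"
      using ij by (simp add: basis_mat_def D_def scalar_prod_def if_distrib cong: if_cong)
    finally show "(A * basis_mat) $$ (i,j) = (basis_mat * D) $$ (i,j)" .
  qed (use mat_carrier U D in auto)
  hence "A = basis_mat * D * transpose_mat basis_mat"
    using mat_carrier U basis_mat_orthogonal(2)
    by (metis assoc_mult_mat right_mult_one_mat transpose_carrier_mat)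
  hence "similar_mat A D"
    using mat_carrier U D basis_mat_orthogonal
    by (intro similar_matI[of _ _ basis_mat "transpose_mat basis_mat" n]) auto
  hence "det A = det D" by (rule det_similar)
  also have "\<dots> = prod_list (diag_mat D)"
    by (rule det_upper_triangular[OF _ D]) (auto simp: D_def upper_triangular_def)
  also have "\<dots> = (\<Prod>k<n. \<mu> k)"
    by (simp add: D_def prod_list_diag_prod atLeast0LessThan)
  finally show ?thesis .
qed

lemma eigenvalue_in_loewner_interval:
  assumes "loewner_between a A b" "k < n"
  shows "\<mu> k \<in> {a..b}"
proof -
  have "u k \<bullet> (A *\<^sub>v u k) = \<mu> k" using eigen vec_carrier orthonormal assms(2) by simp
  thus ?thesis
    using assms vec_carrier[OF assms(2)] mat_carrier orthonormal[OF assms(2) assms(2)]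
    by (auto simp: loewner_between_def dest!: bspec[of _ _ "u k"])
qed

lemma coeff_krylov:
  assumes "x \<in> carrier_vec n" "k < n"
  shows "u k \<bullet> krylov A x j = \<mu> k ^ j * (u k \<bullet> x)"
  using assms by (induction j) (simp_all add: coeff_mult_mat krylov_carrier[OF mat_carrier])

lemma krylov_moment:
  assumes "x \<in> carrier_vec n"
  shows "x \<bullet> krylov A x j = (\<Sum>k<n. \<mu> k ^ j * (u k \<bullet> x)\<^sup>2)"
  unfolding parseval[OF assms krylov_carrier[OF mat_carrier assms]]
  by (simp add: coeff_krylov[OF assms] power2_eq_square mult_ac)

lemma resolvent_solves:
  assumes x: "x \<in> carrier_vec n" and pos: "\<And>k. k < n \<Longrightarrow> 0 < \<mu> k + t"
  defines "y \<equiv> mat_fun (\<lambda>s. 1 / (s + t)) A *\<^sub>v x"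
  shows "A *\<^sub>v y + t \<cdot>\<^sub>v y = x"
proof (rule coeff_eqI)
  have y: "y \<in> carrier_vec n" unfolding y_def by (rule mat_fun_mult_carrier[OF x])
  thus "A *\<^sub>v y + t \<cdot>\<^sub>v y \<in> carrier_vec n" using mat_carrier by auto
  fix k assume k: "k < n"
  have "u k \<bullet> (A *\<^sub>v y + t \<cdot>\<^sub>v y) = (\<mu> k + t) * (u k \<bullet> y)"
    using y vec_carrier[OF k] mat_carrier
    by (simp add: scalar_prod_add_distrib[of _ n] coeff_mult_mat[OF y k] algebra_simps)
  also have "\<dots> = u k \<bullet> x"
    unfolding y_def coeff_mat_fun[OF x k] using pos[OF k] by simp
  finally show "u k \<bullet> (A *\<^sub>v y + t \<cdot>\<^sub>v y) = u k \<bullet> x" .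
qed (rule x)

lemma vnorm_mat_fun_le:
  assumes x: "x \<in> carrier_vec n" and bound: "\<And>k. k < n \<Longrightarrow> \<bar>f (\<mu> k)\<bar> \<le> c" and "0 \<le> c"
  shows "vnorm (mat_fun f A *\<^sub>v x) \<le> c * vnorm x"
proof (rule power2_le_imp_le)
  note y = mat_fun_mult_carrier[OF x, of f]
  have "(vnorm (mat_fun f A *\<^sub>v x))\<^sup>2 = (\<Sum>k<n. (f (\<mu> k))\<^sup>2 * (u k \<bullet> x)\<^sup>2)"
    by (simp add: vnorm_square coeff_mat_fun[OF x] power_mult_distrib flip: sum_coeff_square[OF y])
  also have "\<dots> \<le> (\<Sum>k<n. c\<^sup>2 * (u k \<bullet> x)\<^sup>2)"
    using power_mono[OF bound abs_ge_zero, of _ 2] by (intro sum_mono mult_right_mono) auto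
  also have "\<dots> = (c * vnorm x)\<^sup>2"
    by (simp add: power_mult_distrib vnorm_square sum_coeff_square[OF x] flip: sum_distrib_left)
  finally show "(vnorm (mat_fun f A *\<^sub>v x))\<^sup>2 \<le> (c * vnorm x)\<^sup>2" .
qed (use \<open>0 \<le> c\<close> in simp)

end

section \<open>Lipschitz continuity of the matrix logarithm\<close>

definition loewner_interval :: "nat \<Rightarrow> real \<Rightarrow> real \<Rightarrow> real mat set" where
  "loewner_interval n a b = {A \<in> carrier_mat n n. sym_mat A \<and> loewner_between a A b}"

lemma loewner_intervalD:
  assumes "A \<in> loewner_interval n a b"
  shows "A \<in> carrier_mat n n" "sym_mat A" "loewner_between a A b"
  using assms by (auto simp: loewner_interval_def)

lemma loewner_interval_eigenbasis:
  assumes "A \<in> loewner_interval n a b"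
  obtains u \<mu> where "eigenbasis n A u \<mu>" "\<And>k. k < n \<Longrightarrow> \<mu> k \<in> {a..b}"
proof -
  obtain u \<mu> where "eigenbasis n A u \<mu>" using sym_mat_eigenbasis loewner_intervalD(1,2)[OF assms] .
  thus ?thesis
    using that eigenbasis.eigenvalue_in_loewner_interval loewner_intervalD(3)[OF assms] by blast
qed

lemma mat_log_carrier: "A \<in> loewner_interval n a b \<Longrightarrow> mat_log A \<in> carrier_mat n n"
  by (elim loewner_interval_eigenbasis) (simp add: mat_log_def eigenbasis.mat_fun_carrier)

lemma mat_log_sym: "A \<in> loewner_interval n a b \<Longrightarrow> sym_mat (mat_log A)"
  by (elim loewner_interval_eigenbasis) (simp add: mat_log_def eigenbasis.mat_fun_sym)

text \<open>This is the quadratic form of the resolvent identity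
  \<open>(A + t)\<^sup>-\<^sup>1 - (B + t)\<^sup>-\<^sup>1 = (A + t)\<^sup>-\<^sup>1 (B - A) (B + t)\<^sup>-\<^sup>1\<close>.\<close>
lemma resolvent_form_diff:
  assumes A: "A \<in> carrier_mat n n" "sym_mat A" and B: "B \<in> carrier_mat n n"
    and x: "x \<in> carrier_vec n" "A *\<^sub>v x + t \<cdot>\<^sub>v x = w"
    and y: "y \<in> carrier_vec n" "B *\<^sub>v y + t \<cdot>\<^sub>v y = w"
  shows "x \<bullet> w - w \<bullet> y = x \<bullet> ((B - A) *\<^sub>v y)"
proof -
  have carrier: "A *\<^sub>v x \<in> carrier_vec n" "A *\<^sub>v y \<in> carrier_vec n" "B *\<^sub>v y \<in> carrier_vec n"
    using A(1) B x(1) y(1) by auto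
  have "x \<bullet> w = x \<bullet> (B *\<^sub>v y) + t * (x \<bullet> y)"
    unfolding y(2)[symmetric] using x(1) y(1) carrier by (simp add: scalar_prod_add_distrib[of _ n])
  moreover have "w \<bullet> y = x \<bullet> (A *\<^sub>v y) + t * (x \<bullet> y)"
    unfolding x(2)[symmetric] sym_mat_scalar_prod[OF A x(1) y(1)]
    using x(1) y(1) carrier by (simp add: add_scalar_prod_distrib[of _ n])
  moreover have "x \<bullet> ((B - A) *\<^sub>v y) = x \<bullet> (B *\<^sub>v y) - x \<bullet> (A *\<^sub>v y)"
    using A(1) B x(1) y(1) carrier
    by (simp add: minus_mult_distrib_mat_vec[of _ n n] scalar_prod_minus_distrib[of _ n])
  ultimately show ?thesis by simp
qed

lemma resolvent_form_lipschitz: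
  assumes A: "eigenbasis n A u \<mu>" "\<And>k. k < n \<Longrightarrow> \<alpha> \<le> \<mu> k"
    and B: "eigenbasis n B v \<nu>" "\<And>k. k < n \<Longrightarrow> \<alpha> \<le> \<nu> k"
    and n: "0 < n" and \<alpha>: "0 < \<alpha>" and t: "0 \<le> t" and w: "w \<in> carrier_vec n"
  defines "R \<equiv> mat_fun (\<lambda>s. 1 / (s + t))"
  shows "\<bar>w \<bullet> (R A *\<^sub>v w) - w \<bullet> (R B *\<^sub>v w)\<bar> \<le> spec_norm (A - B) * (w \<bullet> w) / (\<alpha> + t)\<^sup>2"
proof -
  interpret A: eigenbasis n A u \<mu> by fact
  interpret B: eigenbasis n B v \<nu> by fact
  define x where "x = R B *\<^sub>v w"
  define y where "y = R A *\<^sub>v w"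
  have carrier: "x \<in> carrier_vec n" "y \<in> carrier_vec n"
    unfolding x_def y_def R_def by (intro A.mat_fun_mult_carrier B.mat_fun_mult_carrier w)+
  have solves: "B *\<^sub>v x + t \<cdot>\<^sub>v x = w" "A *\<^sub>v y + t \<cdot>\<^sub>v y = w"
    unfolding x_def y_def R_def using A(2) B(2) \<alpha> t
    by (force intro: A.resolvent_solves[OF w] B.resolvent_solves[OF w])+
  have recip: "\<bar>1 / (s + t)\<bar> \<le> 1 / (\<alpha> + t)" if "\<alpha> \<le> s" for s
    using that \<alpha> t by (simp add: frac_le)
  have "vnorm x \<le> 1 / (\<alpha> + t) * vnorm w" unfolding x_def R_def
    by (rule B.vnorm_mat_fun_le[OF w]) (use recip[OF B(2)] \<alpha> t in auto)
  moreover have "vnorm y \<le> 1 / (\<alpha> + t) * vnorm w" unfolding y_def R_def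
    by (rule A.vnorm_mat_fun_le[OF w]) (use recip[OF A(2)] \<alpha> t in auto)
  ultimately have small: "vnorm x \<le> vnorm w / (\<alpha> + t)" "vnorm y \<le> vnorm w / (\<alpha> + t)" by simp_all
  have diff: "A - B \<in> carrier_mat n n" using B.mat_carrier by (rule minus_carrier_mat)
  have "\<bar>w \<bullet> (R A *\<^sub>v w) - w \<bullet> (R B *\<^sub>v w)\<bar> = \<bar>x \<bullet> ((A - B) *\<^sub>v y)\<bar>"
    using resolvent_form_diff[OF B.mat_carrier B.mat_sym A.mat_carrier carrier(1) solves(1)
        carrier(2) solves(2)]
      comm_scalar_prod[OF carrier(1) w] by (simp add: x_def y_def abs_minus_commute)
  also have "\<dots> \<le> spec_norm (A - B) * vnorm x * vnorm y"
    by (rule abs_bilinear_form_le_spec_norm[OF diff carrier])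
  also have "\<dots> \<le> spec_norm (A - B) * (vnorm w / (\<alpha> + t)) * (vnorm w / (\<alpha> + t))"
    using small spec_norm_nonneg[OF diff n] \<alpha> t
    by (intro mult_mono mult_nonneg_nonneg divide_nonneg_nonneg) auto
  finally show ?thesis by (simp add: vnorm_square[symmetric] power2_eq_square)
qed

lemma nonneg_if_antitone_tendsto_0:
  fixes f f' :: "real \<Rightarrow> real"
  assumes deriv: "\<And>t. a \<le> t \<Longrightarrow> (f has_real_derivative f' t) (at t)"
    and antitone: "\<And>t. a \<le> t \<Longrightarrow> f' t \<le> 0" and lim: "(f \<longlongrightarrow> 0) at_top"
  shows "0 \<le> f a"
proof (rule tendsto_upperbound[OF lim])
  have "f t \<le> f a" if "a \<le> t" for t
    using deriv antitone by (intro DERIV_nonpos_imp_nonincreasing[OF that]) blast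
  thus "\<forall>\<^sub>F t in at_top. f t \<le> f a"
    by (intro eventually_mono[OF eventually_ge_at_top[of a]])
qed simp

lemma abs_le_if_deriv_dominated:
  fixes g h g' h' :: "real \<Rightarrow> real"
  assumes deriv: "\<And>t. a \<le> t \<Longrightarrow> (g has_real_derivative g' t) (at t)"
      "\<And>t. a \<le> t \<Longrightarrow> (h has_real_derivative h' t) (at t)"
    and dominated: "\<And>t. a \<le> t \<Longrightarrow> \<bar>g' t\<bar> \<le> - h' t"
    and lim: "(g \<longlongrightarrow> 0) at_top" "(h \<longlongrightarrow> 0) at_top"
  shows "\<bar>g a\<bar> \<le> h a"
proof -
  have "0 \<le> h a - g a"
  proof (rule nonneg_if_antitone_tendsto_0[where f = "\<lambda>t. h t - g t" and f' = "\<lambda>t. h' t - g' t"])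
    show "((\<lambda>t. h t - g t) has_real_derivative h' t - g' t) (at t)" "h' t - g' t \<le> 0" if "a \<le> t" for t
      using deriv dominated that by (force intro: DERIV_diff simp: abs_le_iff)+
    show "((\<lambda>t. h t - g t) \<longlongrightarrow> 0) at_top" using tendsto_diff[OF lim(2,1)] by simp
  qed
  moreover have "0 \<le> h a + g a"
  proof (rule nonneg_if_antitone_tendsto_0[where f = "\<lambda>t. h t + g t" and f' = "\<lambda>t. h' t + g' t"])
    show "((\<lambda>t. h t + g t) has_real_derivative h' t + g' t) (at t)" "h' t + g' t \<le> 0" if "a \<le> t" for t
      using deriv dominated that by (force intro: DERIV_add simp: abs_le_iff)+
    show "((\<lambda>t. h t + g t) \<longlongrightarrow> 0) at_top" using tendsto_add[OF lim(2,1)] by simp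
  qed
  ultimately show ?thesis by linarith
qed

lemma weighted_log_diff_tendsto_0:
  fixes c d \<mu> \<nu> :: "'i \<Rightarrow> real"
  assumes "sum c I = sum d I"
  shows "((\<lambda>t. (\<Sum>i\<in>I. c i * ln (\<mu> i + t)) - (\<Sum>i\<in>I. d i * ln (\<nu> i + t))) \<longlongrightarrow> 0) at_top"
proof -
  have ln_gap: "((\<lambda>t. ln (a + t) - ln t) \<longlongrightarrow> 0) at_top" for a :: real by real_asymp
  have "((\<lambda>t. (\<Sum>i\<in>I. c i * (ln (\<mu> i + t) - ln t)) - (\<Sum>i\<in>I. d i * (ln (\<nu> i + t) - ln t)))
      \<longlongrightarrow> (\<Sum>i\<in>I. c i * 0) - (\<Sum>i\<in>I. d i * 0)) at_top"
    by (intro tendsto_intros ln_gap)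
  thus ?thesis using assms by (simp add: right_diff_distrib sum_subtractf flip: sum_distrib_right)
qed

lemma log_form_lipschitz:
  assumes A: "A \<in> loewner_interval n \<alpha> \<beta>" and B: "B \<in> loewner_interval n \<alpha> \<beta>"
    and n: "0 < n" and \<alpha>: "0 < \<alpha>" and w: "w \<in> carrier_vec n"
  shows "\<bar>w \<bullet> (mat_log A *\<^sub>v w) - w \<bullet> (mat_log B *\<^sub>v w)\<bar> \<le> spec_norm (A - B) * (w \<bullet> w) / \<alpha>"
proof -
  obtain u \<mu> where u: "eigenbasis n A u \<mu>" "\<And>k. k < n \<Longrightarrow> \<mu> k \<in> {\<alpha>..\<beta>}"
    using loewner_interval_eigenbasis[OF A] by blast
  obtain v \<nu> where v: "eigenbasis n B v \<nu>" "\<And>k. k < n \<Longrightarrow> \<nu> k \<in> {\<alpha>..\<beta>}"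
    using loewner_interval_eigenbasis[OF B] by blast
  interpret A: eigenbasis n A u \<mu> by fact
  interpret B: eigenbasis n B v \<nu> by fact
  define g where "g t = (\<Sum>k<n. (u k \<bullet> w)\<^sup>2 * ln (\<mu> k + t)) - (\<Sum>k<n. (v k \<bullet> w)\<^sup>2 * ln (\<nu> k + t))" for t
  define g' where "g' t = (\<Sum>k<n. (u k \<bullet> w)\<^sup>2 / (\<mu> k + t)) - (\<Sum>k<n. (v k \<bullet> w)\<^sup>2 / (\<nu> k + t))" for t
  define C where "C = spec_norm (A - B) * (w \<bullet> w)"
  have "\<bar>g 0\<bar> \<le> C / (\<alpha> + 0)"
  proof (rule abs_le_if_deriv_dominated[where h = "\<lambda>t. C / (\<alpha> + t)"])
    show "(g \<longlongrightarrow> 0) at_top" unfolding g_def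
      by (rule weighted_log_diff_tendsto_0)
        (simp add: A.sum_coeff_square[OF w] B.sum_coeff_square[OF w])
    show "((\<lambda>t. C / (\<alpha> + t)) \<longlongrightarrow> 0) at_top" by real_asymp
  next
    fix t :: real assume t: "0 \<le> t"
    have pos: "0 < \<mu> k + t" "0 < \<nu> k + t" if "k < n" for k
      using \<alpha> u(2)[OF that] v(2)[OF that] t by auto
    show "(g has_real_derivative g' t) (at t)" unfolding g_def g'_def
      by (rule DERIV_diff; rule DERIV_sum) (auto intro!: derivative_eq_intros simp: pos)
    show "((\<lambda>t. C / (\<alpha> + t)) has_real_derivative - (C / (\<alpha> + t)\<^sup>2)) (at t)"
      using \<alpha> t by (auto intro!: derivative_eq_intros simp: power2_eq_square)
    show "\<bar>g' t\<bar> \<le> - (- (C / (\<alpha> + t)\<^sup>2))"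
      using resolvent_form_lipschitz[OF u(1) _ v(1) _ n \<alpha> t w] u(2) v(2)
      by (simp add: A.mat_fun_quadratic[OF w] B.mat_fun_quadratic[OF w] g'_def C_def)
  qed
  moreover have "g 0 = w \<bullet> (mat_log A *\<^sub>v w) - w \<bullet> (mat_log B *\<^sub>v w)"
    by (simp add: mat_log_def A.mat_fun_quadratic[OF w] B.mat_fun_quadratic[OF w] g_def mult.commute)
  ultimately show ?thesis by (simp add: C_def)
qed

lemma ln_det_eq_trace_mat_log:
  assumes A: "A \<in> loewner_interval n \<alpha> \<beta>" and \<alpha>: "0 < \<alpha>"
  shows "ln (det A) = trace_mat (mat_log A)"
proof -
  obtain u \<mu> where u: "eigenbasis n A u \<mu>" "\<And>k. k < n \<Longrightarrow> \<mu> k \<in> {\<alpha>..\<beta>}"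
    using loewner_interval_eigenbasis[OF A] by blast
  have "0 < \<mu> k" if "k < n" for k using \<alpha> u(2)[OF that] by simp
  thus ?thesis
    unfolding mat_log_def eigenbasis.trace_mat_fun[OF u(1)] eigenbasis.det_eq_prod_eigenvalues[OF u(1)]
    by (intro ln_prod) (auto simp: less_imp_neq[symmetric])
qed

lemma trace_mat_eq_sum_forms:
  fixes B :: "'a :: semiring_1 mat"
  assumes "B \<in> carrier_mat n n"
  shows "trace_mat B = (\<Sum>i<n. unit_vec n i \<bullet> (B *\<^sub>v unit_vec n i))"
  using assms by (auto simp: trace_mat_def intro!: sum.cong)

lemma ln_det_lipschitz:
  assumes A: "A \<in> loewner_interval n \<alpha> \<beta>" and B: "B \<in> loewner_interval n \<alpha> \<beta>"
    and n: "0 < n" and \<alpha>: "0 < \<alpha>"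
  shows "\<bar>ln (det A) - ln (det B)\<bar> \<le> real n * spec_norm (A - B) / \<alpha>"
proof -
  have "ln (det A) - ln (det B) = (\<Sum>i<n. unit_vec n i \<bullet> (mat_log A *\<^sub>v unit_vec n i)
      - unit_vec n i \<bullet> (mat_log B *\<^sub>v unit_vec n i))"
    by (simp add: ln_det_eq_trace_mat_log[OF A \<alpha>] ln_det_eq_trace_mat_log[OF B \<alpha>] sum_subtractf
        trace_mat_eq_sum_forms[OF mat_log_carrier[OF A]] trace_mat_eq_sum_forms[OF mat_log_carrier[OF B]])
  also have "\<bar>\<dots>\<bar> \<le> (\<Sum>i<n. spec_norm (A - B) / \<alpha>)"
  proof (intro order_trans[OF sum_abs] sum_mono)
    fix i assume "i \<in> {..<n}"
    thus "\<bar>unit_vec n i \<bullet> (mat_log A *\<^sub>v unit_vec n i) - unit_vec n i \<bullet> (mat_log B *\<^sub>v unit_vec n i)\<bar> \<le>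
        spec_norm (A - B) / \<alpha>"
      using log_form_lipschitz[OF A B n \<alpha> unit_vec_carrier, of i] by simp
  qed
  finally show ?thesis by simp
qed

section \<open>Polynomial approximation of the logarithm\<close>

fun chebyshev :: "nat \<Rightarrow> real poly" where
  "chebyshev 0 = 1"
| "chebyshev (Suc 0) = [:0, 1:]"
| "chebyshev (Suc (Suc k)) = [:0, 2:] * chebyshev (Suc k) - chebyshev k"

lemma degree_chebyshev_le: "degree (chebyshev k) \<le> k"
proof (induction k rule: chebyshev.induct)
  case (3 k)
  have "degree ([:0, 2:] * chebyshev (Suc k)) \<le> degree [:0, 2 :: real:] + degree (chebyshev (Suc k))"
    by (rule degree_mult_le)
  thus ?case using 3 by (auto intro!: degree_diff_le)
qed auto

lemma poly_chebyshev_cos: "poly (chebyshev k) (cos \<phi>) = cos (real k * \<phi>)"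
proof (induction k rule: chebyshev.induct)
  case (3 k)
  thus ?case
    using cos_add[of "real (Suc k) * \<phi>" \<phi>] cos_diff[of "real (Suc k) * \<phi>" \<phi>]
    by (simp add: algebra_simps)
qed auto

text \<open>The term of index \<open>0\<close> vanishes, because \<open>x / 0 = 0\<close>.\<close>
lemma ln_cos_sums:
  fixes q \<phi> :: real
  assumes "\<bar>q\<bar> < 1"
  shows "(\<lambda>k. - 2 * (- q) ^ k / real k * cos (real k * \<phi>)) sums ln (1 + 2 * q * cos \<phi> + q\<^sup>2)"
proof -
  define z where "z = of_real q * cis \<phi>"
  have z: "cmod z < 1" using assms by (simp add: z_def norm_mult)
  hence nz: "1 + z \<noteq> 0" by (metis add_eq_0_iff less_irrefl norm_minus_cancel norm_one)
  have "(\<lambda>k. 2 * Re (- ((- z) ^ k) / of_nat k)) sums (2 * Re (ln (1 + z)))"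
    by (intro sums_mult sums_Re Ln_series' z)
  moreover have "2 * Re (- ((- z) ^ k) / of_nat k) = - 2 * (- q) ^ k / real k * cos (real k * \<phi>)" for k
  proof -
    have "- z = of_real (- q) * cis \<phi>" by (simp add: z_def)
    hence "(- z) ^ k = of_real ((- q) ^ k) * cis (real k * \<phi>)"
      by (simp only: power_mult_distrib of_real_power Complex.DeMoivre)
    thus ?thesis by simp
  qed
  moreover have "2 * Re (ln (1 + z)) = ln (1 + 2 * q * cos \<phi> + q\<^sup>2)"
  proof -
    have "(cmod (1 + z))\<^sup>2 = (1 + q * cos \<phi>)\<^sup>2 + (q * sin \<phi>)\<^sup>2"
      by (simp add: z_def cmod_power2)
    also have "\<dots> = 1 + 2 * q * cos \<phi> + q\<^sup>2 * ((sin \<phi>)\<^sup>2 + (cos \<phi>)\<^sup>2)"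
      by (simp only: power2_eq_square) (simp add: algebra_simps del: sin_cos_squared_add3)
    finally have "(cmod (1 + z))\<^sup>2 = 1 + 2 * q * cos \<phi> + q\<^sup>2" by simp
    moreover have "ln ((cmod (1 + z))\<^sup>2) = 2 * ln (cmod (1 + z))" using nz by (simp add: ln_realpow)
    ultimately show ?thesis using nz by simp
  qed
  ultimately show ?thesis by (simp only:)
qed

lemma ln_cos_truncation_error:
  fixes q \<phi> :: real
  assumes q: "0 \<le> q" "q < 1" and n: "0 < n"
  shows "\<bar>ln (1 + 2 * q * cos \<phi> + q\<^sup>2) - (\<Sum>k<n. - 2 * (- q) ^ k / real k * cos (real k * \<phi>))\<bar>
    \<le> 2 / (1 - q) / real n * q ^ n"
proof -
  define t where "t k = - 2 * (- q) ^ k / real k * cos (real k * \<phi>)" for k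
  have tail: "(\<lambda>k. t (k + n)) sums (ln (1 + 2 * q * cos \<phi> + q\<^sup>2) - sum t {..<n})"
    unfolding t_def using q by (intro sums_split_initial_segment ln_cos_sums) auto
  have geometric: "(\<lambda>k. 2 * q ^ n / real n * q ^ k) sums (2 * q ^ n / real n * (1 / (1 - q)))"
    using q by (intro sums_mult geometric_sums) auto
  have dominated: "norm (t (k + n)) \<le> 2 * q ^ n / real n * q ^ k" for k
  proof -
    have "\<bar>t (k + n)\<bar> = 2 * q ^ (k + n) / real (k + n) * \<bar>cos (real (k + n) * \<phi>)\<bar>"
      using q by (simp add: t_def abs_mult power_abs)
    also have "\<dots> \<le> 2 * q ^ (k + n) / real n * 1"
      using q n by (intro mult_mono frac_le abs_cos_le_one) auto
    finally show ?thesis by (simp add: power_add mult_ac)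
  qed
  have "\<bar>ln (1 + 2 * q * cos \<phi> + q\<^sup>2) - sum t {..<n}\<bar> \<le> 2 * q ^ n / real n * (1 / (1 - q))"
    using norm_suminf_le[OF dominated sums_summable[OF geometric]]
      sums_unique[OF geometric] sums_unique[OF tail]
    by simp
  thus ?thesis by (simp add: t_def mult_ac)
qed

lemma ln_poly_approx_normalized:
  fixes q :: real
  assumes q: "0 \<le> q" "q < 1" and n: "0 < n"
  obtains p where "degree p < n"
    "\<And>y. y \<in> {-1..1} \<Longrightarrow> \<bar>ln (1 + 2 * q * y + q\<^sup>2) - poly p y\<bar> \<le> 2 / (1 - q) / real n * q ^ n"
proof
  define p where "p = (\<Sum>k<n. Polynomial.smult (- 2 * (- q) ^ k / real k) (chebyshev k))"
  have "degree p \<le> n - 1" unfolding p_def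
    by (intro degree_sum_le order_trans[OF degree_smult_le] order_trans[OF degree_chebyshev_le]) auto
  thus "degree p < n" using n by simp
  fix y :: real assume "y \<in> {-1..1}"
  hence "poly p y = (\<Sum>k<n. - 2 * (- q) ^ k / real k * cos (real k * arccos y))"
    using poly_chebyshev_cos[of _ "arccos y"] by (simp add: p_def poly_sum)
  thus "\<bar>ln (1 + 2 * q * y + q\<^sup>2) - poly p y\<bar> \<le> 2 / (1 - q) / real n * q ^ n"
    using ln_cos_truncation_error[OF q n, of "arccos y"] \<open>y \<in> {-1..1}\<close> by simp
qed

text \<open>If \<open>q = 0\<close>, the interval is a point and \<open>y = 0\<close>, because \<open>x / 0 = 0\<close>.\<close>
lemma affine_normalization:
  fixes q d x :: real
  assumes q: "0 \<le> q" and d: "0 < d" and x: "x \<in> {d * (1 - q)\<^sup>2..d * (1 + q)\<^sup>2}"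
  defines "y \<equiv> poly [: - (1 + q\<^sup>2) / (2 * q), 1 / (2 * q * d) :] x"
  shows "x = d * (1 + 2 * q * y + q\<^sup>2)" "y \<in> {-1..1}"
proof -
  show x_eq: "x = d * (1 + 2 * q * y + q\<^sup>2)"
  proof (cases "q = 0")
    case True
    thus ?thesis using x by simp
  qed (use d in \<open>simp add: y_def field_simps\<close>)
  show "y \<in> {-1..1}"
  proof (cases "q = 0")
    case False
    have "d * (1 - q)\<^sup>2 \<le> d * (1 + 2 * q * y + q\<^sup>2)" "d * (1 + 2 * q * y + q\<^sup>2) \<le> d * (1 + q)\<^sup>2"
      using x x_eq by auto
    hence "(1 - q)\<^sup>2 \<le> 1 + 2 * q * y + q\<^sup>2" "1 + 2 * q * y + q\<^sup>2 \<le> (1 + q)\<^sup>2"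
      by (simp_all only: mult_le_cancel_left_pos[OF d])
    hence "q * (-1) \<le> q * y" "q * y \<le> q * 1" by (auto simp: power2_eq_square algebra_simps)
    moreover have "0 < q" using q False by simp
    ultimately show ?thesis by (simp only: mult_le_cancel_left_pos atLeastAtMost_iff)
  qed (simp add: y_def)
qed

text \<open>With \<open>d = ((sqrt \<alpha> + sqrt \<beta>) / 2)\<^sup>2\<close> the interval \<open>[\<alpha>, \<beta>]\<close> is the range of \<open>d (1 + 2 q y + q\<^sup>2)\<close> for
  \<open>y \<in> [-1, 1]\<close>.\<close>
lemma ln_poly_approx:
  fixes \<alpha> \<beta> :: real
  assumes \<alpha>: "0 < \<alpha>" "\<alpha> \<le> \<beta>" and n: "0 < n"
  defines "q \<equiv> (sqrt (\<beta> / \<alpha>) - 1) / (sqrt (\<beta> / \<alpha>) + 1)"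
  obtains p where "degree p < n"
    "\<And>x. x \<in> {\<alpha>..\<beta>} \<Longrightarrow> \<bar>ln x - poly p x\<bar> \<le> (sqrt (\<beta> / \<alpha>) + 1) / real n * q ^ n"
proof -
  define s where "s = sqrt (\<beta> / \<alpha>)"
  have s: "1 \<le> s" "\<beta> = \<alpha> * s\<^sup>2" using \<alpha> by (auto simp: s_def)
  have q: "q = (s - 1) / (s + 1)" "0 \<le> q" "q < 1" using s(1) by (auto simp: q_def s_def[symmetric])
  have "(s + 1) / 2 * (1 - q) = 1" "(s + 1) / 2 * (1 + q) = s" "2 / (1 - q) = s + 1"
    using s(1) by (auto simp: q(1) divide_simps)
  note endpoints = this(1,2) and error_factor = this(3)
  define d where "d = \<alpha> * ((s + 1) / 2)\<^sup>2"
  have d_mult: "d * x\<^sup>2 = \<alpha> * ((s + 1) / 2 * x)\<^sup>2" for x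
    by (simp add: d_def power_mult_distrib power_divide)
  have d: "0 < d" "\<alpha> = d * (1 - q)\<^sup>2" "\<beta> = d * (1 + q)\<^sup>2"
    unfolding d_mult endpoints using \<alpha>(1) s by (simp_all add: d_def)
  obtain p where p: "degree p < n"
    "\<And>y. y \<in> {-1..1} \<Longrightarrow> \<bar>ln (1 + 2 * q * y + q\<^sup>2) - poly p y\<bar> \<le> 2 / (1 - q) / real n * q ^ n"
    using ln_poly_approx_normalized[OF q(2,3) n] by blast
  define aff where "aff = [: - (1 + q\<^sup>2) / (2 * q), 1 / (2 * q * d) :]"
  show ?thesis
  proof (rule that[of "[:ln d:] + pcompose p aff"])
    have "degree (pcompose p aff) \<le> degree p"
      using degree_pcompose_le[of p aff] by (simp add: aff_def split: if_splits)
    thus "degree ([:ln d:] + pcompose p aff) < n" using p(1) by (intro degree_add_less) auto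
  next
    fix x assume x: "x \<in> {\<alpha>..\<beta>}"
    define y where "y = poly aff x"
    have y: "x = d * (1 + 2 * q * y + q\<^sup>2)" "y \<in> {-1..1}"
      unfolding y_def aff_def by (rule affine_normalization[OF q(2) d(1)]; use x d(2,3) in simp)+
    have "0 < x / d" using x \<alpha> d(1) by simp
    hence "ln x = ln d + ln (1 + 2 * q * y + q\<^sup>2)" using d(1) by (simp add: y(1) ln_mult)
    thus "\<bar>ln x - poly ([:ln d:] + pcompose p aff) x\<bar> \<le> (sqrt (\<beta> / \<alpha>) + 1) / real n * q ^ n"
      using p(2)[OF y(2)] by (simp add: poly_pcompose y_def s_def error_factor)
  qed
qed

lemma diff_quotient_le_exp:
  fixes s :: real
  assumes "1 < s"
  shows "(s - 1) / (s + 1) \<le> exp (- 2 / s)"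
proof -
  define x where "x = 1 / s"
  have x: "0 < x" "x < 1" using assms by (auto simp: x_def)
  define f where "f = (\<lambda>y :: real. ln (1 + y) - ln (1 - y) - 2 * y)"
  have "f 0 \<le> f x"
  proof (rule DERIV_nonneg_imp_nondecreasing[of 0 x f])
    fix y assume y: "0 \<le> y" "y \<le> x"
    have "(f has_real_derivative (1 / (1 + y) + 1 / (1 - y) - 2)) (at y)"
      unfolding f_def using y x by (auto intro!: derivative_eq_intros)
    moreover have "1 / (1 + y) + 1 / (1 - y) - 2 = 2 * y\<^sup>2 / ((1 + y) * (1 - y))"
      using y x by (simp add: divide_simps) (simp add: algebra_simps power2_eq_square)
    moreover have "\<dots> \<ge> 0" using y x by simp
    ultimately show "\<exists>z. (f has_real_derivative z) (at y) \<and> 0 \<le> z" by metis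
  qed (use x in auto)
  hence "ln ((1 - x) / (1 + x)) \<le> - 2 * x" using x by (simp add: ln_div f_def)
  hence "(1 - x) / (1 + x) \<le> exp (- 2 * x)"
    using x exp_le_cancel_iff[of "ln ((1 - x) / (1 + x))"] by simp
  moreover have "1 - x = (s - 1) / s" "1 + x = (s + 1) / s" using assms
    by (auto simp: x_def field_simps)
  hence "(1 - x) / (1 + x) = (s - 1) / (s + 1)" using assms by simp
  ultimately show ?thesis by (simp add: x_def)
qed

section \<open>Lanczos quadrature\<close>

definition tridiag_mat :: "nat \<Rightarrow> (nat \<Rightarrow> real) \<Rightarrow> (nat \<Rightarrow> real) \<Rightarrow> real mat" where
  "tridiag_mat K d e = mat K K (\<lambda>(i,j). if i = j then d i else if j = i + 1 then e i
     else if i = j + 1 then e j else 0)"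

lemma tridiag_mat_carrier: "tridiag_mat K d e \<in> carrier_mat K K"
  by (simp add: tridiag_mat_def)

lemma tridiag_mat_sym: "sym_mat (tridiag_mat K d e)"
  unfolding sym_mat_def by (intro conjI exI[of _ K] eq_matI) (auto simp: tridiag_mat_def)

lemma krylov_scalar_prod_add:
  assumes A: "A \<in> carrier_mat n n" "sym_mat A" and x: "x \<in> carrier_vec n" and y: "y \<in> carrier_vec n"
  shows "x \<bullet> krylov A y (i + j) = krylov A x i \<bullet> krylov A y j"
proof (induction i arbitrary: j)
  case (Suc i)
  have "x \<bullet> krylov A y (Suc i + j) = krylov A x i \<bullet> (A *\<^sub>v krylov A y j)"
    using Suc.IH[of "Suc j"] by simp
  also have "\<dots> = krylov A x (Suc i) \<bullet> krylov A y j"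
    using sym_mat_scalar_prod[OF A krylov_carrier[OF A(1) x] krylov_carrier[OF A(1) y]] by simp
  finally show ?case .
qed simp

text \<open>The Lanczos vectors are numbered from \<open>1\<close> and preceded by \<open>q 0 = 0\<close>; \<open>a j\<close> is the diagonal
  coefficient of \<open>q (j + 1)\<close> and \<open>b j\<close> the coefficient linking \<open>q j\<close> to \<open>q (j + 1)\<close>. After a breakdown
  all later vectors and coefficients vanish.\<close>
locale lanczos_recurrence =
  fixes n :: nat and A :: "real mat" and q :: "nat \<Rightarrow> real vec" and a b :: "nat \<Rightarrow> real"
  assumes mat_carrier: "A \<in> carrier_mat n n" and mat_sym: "sym_mat A"
    and vec_carrier: "q j \<in> carrier_vec n"
    and vec_0: "q 0 = 0\<^sub>v n" and offdiag_0: "b 0 = 0"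
    and vec_1_unit: "q (Suc 0) \<bullet> q (Suc 0) = 1"
    and diag_eq: "a j = q (Suc j) \<bullet> (A *\<^sub>v q (Suc j) - b j \<cdot>\<^sub>v q j)"
    and recurrence: "A *\<^sub>v q (Suc j) = b j \<cdot>\<^sub>v q j + a j \<cdot>\<^sub>v q (Suc j) + b (Suc j) \<cdot>\<^sub>v q (Suc (Suc j))"
    and vec_breakdown: "b (Suc j) = 0 \<Longrightarrow> q (Suc (Suc j)) = 0\<^sub>v n"
    and vec_unit: "b (Suc j) \<noteq> 0 \<Longrightarrow> q (Suc (Suc j)) \<bullet> q (Suc (Suc j)) = 1"
begin

lemma mat_vec_carrier: "A *\<^sub>v q j \<in> carrier_vec n"
  by (rule mult_mat_vec_carrier[OF mat_carrier vec_carrier])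

lemma scalar_prod_commute: "q i \<bullet> q j = q j \<bullet> q i"
  by (rule comm_scalar_prod[OF vec_carrier vec_carrier])

lemma scalar_prod_zero: "0\<^sub>v n \<bullet> q j = 0" "q j \<bullet> 0\<^sub>v n = 0"
  using vec_carrier by auto

lemma zero_or_unit: "q (Suc j) = 0\<^sub>v n \<or> q (Suc j) \<bullet> q (Suc j) = 1"
  using vec_1_unit vec_breakdown vec_unit by (cases j) auto

lemma scalar_prod_recurrence: "q i \<bullet> (A *\<^sub>v q (Suc j)) =
    b j * (q i \<bullet> q j) + a j * (q i \<bullet> q (Suc j)) + b (Suc j) * (q i \<bullet> q (Suc (Suc j)))"
  unfolding recurrence using vec_carrier
  by (simp add: scalar_prod_add_distrib[of _ n] scalar_prod_smult_distrib[of _ n])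

lemma form_sym: "q i \<bullet> (A *\<^sub>v q j) = q j \<bullet> (A *\<^sub>v q i)"
  using sym_mat_scalar_prod[OF mat_carrier mat_sym vec_carrier vec_carrier, of i j]
    comm_scalar_prod[OF mat_vec_carrier vec_carrier] by simp

lemma coeffs_after_breakdown:
  assumes zero: "q (Suc j) = 0\<^sub>v n"
  shows "a j = 0" "b j = 0" "b (Suc j) = 0"
proof -
  show "a j = 0" using diag_eq[of j] zero vec_carrier[of j] mat_vec_carrier[of "Suc j"] by simp
  show "b j = 0"
  proof (cases j)
    case (Suc i)
    thus ?thesis using vec_unit[of i] zero scalar_prod_zero(1)[of 0] vec_0 by force
  qed (simp add: offdiag_0)
  have "q (Suc (Suc j)) \<bullet> (A *\<^sub>v q (Suc j)) = 0"
    unfolding form_sym[of "Suc (Suc j)"] using mat_vec_carrier zero by simp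
  hence "b (Suc j) * (q (Suc (Suc j)) \<bullet> q (Suc (Suc j))) = 0"
    using scalar_prod_recurrence[of "Suc (Suc j)" j] \<open>b j = 0\<close> zero scalar_prod_zero by simp
  thus "b (Suc j) = 0" using vec_unit[of j] by (cases "b (Suc j) = 0") auto
qed

lemma coeff_mult_self:
  "a j * (q (Suc j) \<bullet> q (Suc j)) = a j"
  "b j * (q (Suc j) \<bullet> q (Suc j)) = b j"
  "b j * (q j \<bullet> q j) = b j"
proof -
  show "a j * (q (Suc j) \<bullet> q (Suc j)) = a j" "b j * (q (Suc j) \<bullet> q (Suc j)) = b j"
    using zero_or_unit[of j] coeffs_after_breakdown[of j] by auto
  show "b j * (q j \<bullet> q j) = b j"
    using zero_or_unit[of "j - 1"] coeffs_after_breakdown(3)[of "j - 1"] offdiag_0 by (cases j) auto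
qed

lemma form_below_next:
  assumes orth: "\<And>i j. i < j \<Longrightarrow> j \<le> Suc h \<Longrightarrow> q i \<bullet> q j = 0" and i: "i \<le> h"
  shows "q i \<bullet> (A *\<^sub>v q (Suc h)) = b h * (q i \<bullet> q h)"
proof (cases i)
  case 0
  thus ?thesis using vec_0 scalar_prod_zero mat_vec_carrier by simp
next
  case (Suc i')
  have "q i \<bullet> (A *\<^sub>v q (Suc h)) = b i * (q (Suc i) \<bullet> q (Suc h))"
    unfolding form_sym[of i] unfolding Suc scalar_prod_recurrence
    using orth[of i' "Suc h"] orth[of "Suc i'" "Suc h"] Suc i
    by (simp add: scalar_prod_commute[of "Suc h"])
  also have "\<dots> = b h * (q i \<bullet> q h)"
  proof (cases "i = h")
    case True
    thus ?thesis using coeff_mult_self(2,3)[of h] by auto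
  next
    case False
    thus ?thesis using orth[of "Suc i" "Suc h"] orth[of i h] i by simp
  qed
  finally show ?thesis .
qed

lemma orthogonal_next:
  assumes orth: "\<And>i j. i < j \<Longrightarrow> j \<le> Suc h \<Longrightarrow> q i \<bullet> q j = 0" and i: "i \<le> Suc h"
  shows "q i \<bullet> q (Suc (Suc h)) = 0"
proof (cases "b (Suc h) = 0")
  case True
  thus ?thesis using vec_breakdown scalar_prod_zero by simp
next
  case False
  have "q i \<bullet> (A *\<^sub>v q (Suc h)) = b h * (q i \<bullet> q h) + a h * (q i \<bullet> q (Suc h))"
  proof (cases "i = Suc h")
    case True
    have "a h = q (Suc h) \<bullet> (A *\<^sub>v q (Suc h)) - b h * (q (Suc h) \<bullet> q h)"
      unfolding diag_eq[of h] using vec_carrier mat_vec_carrier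
      by (simp add: scalar_prod_minus_distrib[of _ n] scalar_prod_smult_distrib[of _ n])
    thus ?thesis unfolding True using coeff_mult_self(1)[of h] by linarith
  next
    case False
    hence "i \<le> h" using i by simp
    moreover from this have "q i \<bullet> q (Suc h) = 0" by (intro orth) auto
    ultimately show ?thesis using form_below_next[OF orth] by simp
  qed
  thus ?thesis using scalar_prod_recurrence[of i h] False by simp
qed

lemma orthogonal:
  assumes "i \<noteq> j"
  shows "q i \<bullet> q j = 0"
proof -
  have below: "q i \<bullet> q j = 0" if "i < j" "j \<le> k" for i j k
    using that
  proof (induction k arbitrary: i j)
    case (Suc k)
    show ?case
    proof (cases "j \<le> k")
      case False
      hence j: "j = Suc k" "i \<le> k" using Suc.prems by auto
      show ?thesis
      proof (cases k)
        case 0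
        thus ?thesis using j vec_0 scalar_prod_zero by simp
      next
        case k: (Suc h)
        show ?thesis unfolding j k by (rule orthogonal_next) (use Suc.IH j k in auto)
      qed
    qed (use Suc in auto)
  qed simp
  show ?thesis using below[of i j j] below[of j i i] assms scalar_prod_commute[of i j]
    by (cases "i < j") auto
qed

abbreviation T :: "nat \<Rightarrow> real mat" where
  "T K \<equiv> tridiag_mat K a (\<lambda>i. b (Suc i))"

definition lanczos_basis :: "nat \<Rightarrow> real mat" where
  "lanczos_basis K = mat n K (\<lambda>(i,j). q (Suc j) $ i)"

lemma lanczos_basis_carrier: "lanczos_basis K \<in> carrier_mat n K"
  by (simp add: lanczos_basis_def)

lemma col_lanczos_basis: "j < K \<Longrightarrow> col (lanczos_basis K) j = q (Suc j)"
  using vec_carrier[of "Suc j"] by (intro eq_vecI) (auto simp: lanczos_basis_def)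

lemma lanczos_basis_mult_carrier: "z \<in> carrier_vec K \<Longrightarrow> lanczos_basis K *\<^sub>v z \<in> carrier_vec n"
  by (rule mult_mat_vec_carrier[OF lanczos_basis_carrier])

lemma tridiag_entry_eq_form:
  assumes "i < K" "j < K"
  shows "T K $$ (i,j) = q (Suc i) \<bullet> (A *\<^sub>v q (Suc j))"
proof -
  consider "i = j" | "j = Suc i" | "i = Suc j" | "i \<noteq> j" "j \<noteq> Suc i" "i \<noteq> Suc j" by blast
  thus ?thesis
  proof cases
    case 1
    thus ?thesis unfolding scalar_prod_recurrence 1
      using assms coeff_mult_self(1)[of j] by (simp add: tridiag_mat_def orthogonal)
  next
    case 2
    thus ?thesis unfolding scalar_prod_recurrence
      using assms coeff_mult_self(3)[of j] by (simp add: tridiag_mat_def orthogonal)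
  next
    case 3
    thus ?thesis unfolding scalar_prod_recurrence
      using assms coeff_mult_self(2)[of i] by (simp add: tridiag_mat_def orthogonal)
  next
    case 4
    thus ?thesis unfolding scalar_prod_recurrence
      using assms by (simp add: tridiag_mat_def orthogonal)
  qed
qed

lemma compression_eq_tridiag: "transpose_mat (lanczos_basis K) * (A * lanczos_basis K) = T K"
proof (rule eq_matI)
  fix i j assume "i < dim_row (T K)" "j < dim_col (T K)"
  hence ij: "i < K" "j < K" by (auto simp: tridiag_mat_def)
  have "(transpose_mat (lanczos_basis K) * (A * lanczos_basis K)) $$ (i,j) =
      col (lanczos_basis K) i \<bullet> col (A * lanczos_basis K) j"
    using ij lanczos_basis_carrier[of K] mat_carrier by simp
  also have "\<dots> = q (Suc i) \<bullet> (A *\<^sub>v q (Suc j))"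
    using ij col_mult2[OF mat_carrier lanczos_basis_carrier] by (simp add: col_lanczos_basis)
  finally show "(transpose_mat (lanczos_basis K) * (A * lanczos_basis K)) $$ (i,j) = T K $$ (i,j)"
    using tridiag_entry_eq_form[OF ij] by simp
qed (use lanczos_basis_carrier mat_carrier in \<open>auto simp: tridiag_mat_def\<close>)

lemma compressed_form:
  assumes y: "y \<in> carrier_vec K" and z: "z \<in> carrier_vec K"
  shows "(lanczos_basis K *\<^sub>v y) \<bullet> (A *\<^sub>v (lanczos_basis K *\<^sub>v z)) = y \<bullet> (T K *\<^sub>v z)"
proof -
  note Q = lanczos_basis_carrier[of K]
  have AQz: "A *\<^sub>v (lanczos_basis K *\<^sub>v z) \<in> carrier_vec n"
    using mat_carrier lanczos_basis_mult_carrier[OF z] by auto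
  have "T K *\<^sub>v z = transpose_mat (lanczos_basis K) *\<^sub>v (A *\<^sub>v (lanczos_basis K *\<^sub>v z))"
    unfolding compression_eq_tridiag[symmetric] using mat_carrier Q z
    by (simp add: assoc_mult_mat_vec[of _ K n _ K] assoc_mult_mat_vec[of _ n n _ K])
  thus ?thesis
    using transpose_vec_mult_scalar[OF Q y AQz] comm_scalar_prod[OF lanczos_basis_mult_carrier[OF y] AQz]
      comm_scalar_prod[OF y, of "transpose_mat (lanczos_basis K) *\<^sub>v (A *\<^sub>v (lanczos_basis K *\<^sub>v z))"] Q AQz
    by simp
qed

lemma lanczos_basis_norm:
  assumes y: "y \<in> carrier_vec K"
  shows "(lanczos_basis K *\<^sub>v y) \<bullet> (lanczos_basis K *\<^sub>v y) = (\<Sum>j<K. (y $ j)\<^sup>2 * (q (Suc j) \<bullet> q (Suc j)))"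
proof -
  have gram: "(transpose_mat (lanczos_basis K) * lanczos_basis K) $$ (i,j) =
      (if i = j then q (Suc j) \<bullet> q (Suc j) else 0)" if "i < K" "j < K" for i j
    using that lanczos_basis_carrier[of K] orthogonal[of "Suc i" "Suc j"]
    by (simp add: col_lanczos_basis)
  have G: "transpose_mat (lanczos_basis K) * lanczos_basis K \<in> carrier_mat K K"
    using lanczos_basis_carrier[of K] by auto
  have "(lanczos_basis K *\<^sub>v y) \<bullet> (lanczos_basis K *\<^sub>v y) =
      y \<bullet> ((transpose_mat (lanczos_basis K) * lanczos_basis K) *\<^sub>v y)"
    using transpose_vec_mult_scalar[OF lanczos_basis_carrier y lanczos_basis_mult_carrier[OF y]]
      comm_scalar_prod[OF y, of "transpose_mat (lanczos_basis K) *\<^sub>v (lanczos_basis K *\<^sub>v y)"]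
      lanczos_basis_carrier[of K] y by simp
  also have "\<dots> = (\<Sum>i<K. \<Sum>j<K. if i = j then (y $ j)\<^sup>2 * (q (Suc j) \<bullet> q (Suc j)) else 0)"
    unfolding bilinear_form_eq_sum[OF G y y]
    by (intro sum.cong refl) (simp add: gram power2_eq_square del: index_mult_mat)
  finally show ?thesis by simp
qed

lemma lanczos_basis_isometric:
  assumes y: "y \<in> carrier_vec K" and supp: "\<And>j. j < K \<Longrightarrow> q (Suc j) = 0\<^sub>v n \<Longrightarrow> y $ j = 0"
  shows "(lanczos_basis K *\<^sub>v y) \<bullet> (lanczos_basis K *\<^sub>v y) = y \<bullet> y"
  unfolding lanczos_basis_norm[OF y] scalar_prod_eq_sum[OF y]
  using supp zero_or_unit by (intro sum.cong refl) (force simp: power2_eq_square)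

lemma tridiag_column_combination:
  assumes "j < K" "x < n"
  shows "(\<Sum>i<K. q (Suc i) $ x * T K $$ (i,j)) =
    (A *\<^sub>v q (Suc j)) $ x - (if Suc j < K then 0 else b (Suc j) * q (Suc (Suc j)) $ x)"
proof -
  have "(\<Sum>i<K. q (Suc i) $ x * T K $$ (i,j)) = (\<Sum>i<K. (if i = j then a j * q (Suc j) $ x else 0)
     + (if Suc i = j then b j * q j $ x else 0) + (if i = Suc j then b (Suc j) * q (Suc (Suc j)) $ x else 0))"
    using assms by (intro sum.cong refl) (auto simp: tridiag_mat_def)
  also have "\<dots> = a j * q (Suc j) $ x + (\<Sum>i<K. if Suc i = j then b j * q j $ x else 0)
     + (if Suc j < K then b (Suc j) * q (Suc (Suc j)) $ x else 0)"
    using assms by (simp add: sum.distrib)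
  also have "(\<Sum>i<K. if Suc i = j then b j * q j $ x else 0) = b j * q j $ x"
    using assms by (cases j) (auto simp: offdiag_0)
  finally show ?thesis
    unfolding recurrence using assms carrier_vecD[OF vec_carrier] by simp
qed

lemma lanczos_basis_intertwines:
  assumes z: "z \<in> carrier_vec K" and last: "z $ (K - 1) = 0"
  shows "A *\<^sub>v (lanczos_basis K *\<^sub>v z) = lanczos_basis K *\<^sub>v (T K *\<^sub>v z)"
proof -
  note Q = lanczos_basis_carrier[of K] and T = tridiag_mat_carrier[of K a "\<lambda>i. b (Suc i)"]
  have "(A * lanczos_basis K) *\<^sub>v z = (lanczos_basis K * T K) *\<^sub>v z"
  proof (rule eq_vecI)
    fix x assume "x < dim_vec ((lanczos_basis K * T K) *\<^sub>v z)"
    hence x: "x < n" using Q by simp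
    have "(A * lanczos_basis K) $$ (x,j) * z $ j = (lanczos_basis K * T K) $$ (x,j) * z $ j"
      if j: "j < K" for j
    proof (cases "Suc j < K")
      case True
      have "(A * lanczos_basis K) $$ (x,j) = (A *\<^sub>v q (Suc j)) $ x"
        using x j mat_carrier Q by (simp add: col_lanczos_basis)
      also have "\<dots> = (\<Sum>i<K. lanczos_basis K $$ (x,i) * T K $$ (i,j))"
        using tridiag_column_combination[OF j x] True x by (simp add: lanczos_basis_def)
      also have "\<dots> = (lanczos_basis K * T K) $$ (x,j)"
        using x j Q T by (auto simp: scalar_prod_def atLeast0LessThan)
      finally show ?thesis by simp
    next
      case False
      hence "j = K - 1" using j by simp
      thus ?thesis using last by simp
    qed
    thus "((A * lanczos_basis K) *\<^sub>v z) $ x = ((lanczos_basis K * T K) *\<^sub>v z) $ x"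
      using index_mult_mat_vec_eq_sum[OF mult_carrier_mat[OF mat_carrier Q] z x]
        index_mult_mat_vec_eq_sum[OF mult_carrier_mat[OF Q T] z x] by (auto intro: sum.cong)
  qed (use mat_carrier Q in auto)
  thus ?thesis using assoc_mult_mat_vec[OF mat_carrier Q z] assoc_mult_mat_vec[OF Q T z] by simp
qed

abbreviation e1 :: "nat \<Rightarrow> real vec" where
  "e1 K \<equiv> unit_vec K 0"

lemma krylov_tridiag_carrier: "krylov (T K) (e1 K) i \<in> carrier_vec K"
  by (simp add: krylov_carrier tridiag_mat_carrier)

lemma krylov_tridiag_Suc_index:
  "j < K \<Longrightarrow> krylov (T K) (e1 K) (Suc i) $ j = (\<Sum>k<K. T K $$ (j,k) * krylov (T K) (e1 K) i $ k)"
  unfolding krylov_Suc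
  by (rule index_mult_mat_vec_eq_sum[OF tridiag_mat_carrier krylov_tridiag_carrier])

lemma krylov_tridiag_support:
  assumes "i < j" "j < K"
  shows "krylov (T K) (e1 K) i $ j = 0"
  using assms
proof (induction i arbitrary: j)
  case (Suc i)
  have "T K $$ (j,k) * krylov (T K) (e1 K) i $ k = 0" if "k < K" for k
    using Suc that by (cases "i < k") (simp_all add: tridiag_mat_def)
  thus ?case unfolding krylov_tridiag_Suc_index[OF Suc.prems(2)] by (intro sum.neutral) auto
qed simp

lemma krylov_tridiag_breakdown:
  assumes "j < K" "q (Suc j) = 0\<^sub>v n"
  shows "krylov (T K) (e1 K) i $ j = 0"
proof (cases i)
  case 0
  have "j \<noteq> 0" using vec_1_unit assms(2) scalar_prod_zero(1)[of "Suc 0"] by (metis zero_neq_one)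
  thus ?thesis using 0 assms by simp
next
  case (Suc i')
  have "T K $$ (j,k) = 0" if "k < K" for k
    using tridiag_entry_eq_form[OF assms(1) that] assms(2) mat_vec_carrier by simp
  thus ?thesis unfolding Suc krylov_tridiag_Suc_index[OF assms(1)] by simp
qed

lemma krylov_eq_lanczos_basis_mult:
  "i < K \<Longrightarrow> krylov A (q 1) i = lanczos_basis K *\<^sub>v krylov (T K) (e1 K) i"
proof (induction i)
  case 0
  have "lanczos_basis K *\<^sub>v e1 K = col (lanczos_basis K) 0"
    using 0 lanczos_basis_carrier[of K] by (intro eq_vecI) auto
  thus ?case using 0 by (simp add: col_lanczos_basis)
next
  case (Suc i)
  hence "krylov (T K) (e1 K) i $ (K - 1) = 0" by (intro krylov_tridiag_support) auto
  thus ?case using Suc lanczos_basis_intertwines[OF krylov_tridiag_carrier] by simp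
qed

lemma krylov_moments_agree:
  assumes "m < 2 * K"
  shows "q 1 \<bullet> krylov A (q 1) m = e1 K \<bullet> krylov (T K) (e1 K) m"
proof -
  define i where "i = m div 2"
  define y where "y = krylov (T K) (e1 K) i"
  have i: "i < K" using assms by (auto simp: i_def)
  have y: "y \<in> carrier_vec K" unfolding y_def by (rule krylov_tridiag_carrier)
  have Qy: "krylov A (q 1) i = lanczos_basis K *\<^sub>v y"
    unfolding y_def by (rule krylov_eq_lanczos_basis_mult[OF i])
  note split = krylov_scalar_prod_add[OF mat_carrier mat_sym vec_carrier vec_carrier]
    krylov_scalar_prod_add[OF tridiag_mat_carrier tridiag_mat_sym unit_vec_carrier unit_vec_carrier]
  show ?thesis
  proof (cases "even m")
    case True
    hence "m = i + i" by (auto simp: i_def)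
    moreover have "(lanczos_basis K *\<^sub>v y) \<bullet> (lanczos_basis K *\<^sub>v y) = y \<bullet> y"
      unfolding y_def by (intro lanczos_basis_isometric krylov_tridiag_carrier krylov_tridiag_breakdown)
    ultimately show ?thesis by (simp only: split Qy flip: y_def)
  next
    case False
    hence "m = i + Suc i" by (simp add: i_def) presburger
    thus ?thesis using compressed_form[OF y y] by (simp only: split krylov_Suc Qy flip: y_def)
  qed
qed

lemma ritz_value_bounds:
  assumes loewner: "loewner_between \<alpha> A \<beta>" and \<alpha>: "0 < \<alpha>"
    and y: "y \<in> carrier_vec K" "T K *\<^sub>v y = \<tau> \<cdot>\<^sub>v y" and K: "0 < K" and first: "y $ 0 \<noteq> 0"
  shows "\<tau> \<in> {\<alpha>..\<beta>}"
proof -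
  define z where "z = lanczos_basis K *\<^sub>v y"
  have z: "z \<in> carrier_vec n" unfolding z_def by (rule lanczos_basis_mult_carrier[OF y(1)])
  have bounds: "\<alpha> * (z \<bullet> z) \<le> z \<bullet> (A *\<^sub>v z)" "z \<bullet> (A *\<^sub>v z) \<le> \<beta> * (z \<bullet> z)"
    using loewner mat_carrier z unfolding loewner_between_def by auto
  have form: "z \<bullet> (A *\<^sub>v z) = \<tau> * (y \<bullet> y)" using compressed_form[OF y(1) y(1)] y by (simp add: z_def)
  have "0 < (y $ 0)\<^sup>2 * (q (Suc 0) \<bullet> q (Suc 0))" using first vec_1_unit by simp
  also have "\<dots> \<le> z \<bullet> z" unfolding z_def lanczos_basis_norm[OF y(1)]
    by (rule member_le_sum) (use K scalar_prod_self_nonneg in auto)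
  finally have pos: "0 < z \<bullet> z" .
  hence "0 < \<alpha> * (z \<bullet> z)" using \<alpha> by simp
  hence \<tau>: "\<tau> \<noteq> 0" using bounds form by auto
  have "y $ j = 0" if j: "j < K" "q (Suc j) = 0\<^sub>v n" for j
  proof -
    have "\<tau> * y $ j = (T K *\<^sub>v y) $ j" using y j(1) by simp
    also have "\<dots> = (\<Sum>k<K. T K $$ (j,k) * y $ k)"
      by (rule index_mult_mat_vec_eq_sum[OF tridiag_mat_carrier y(1) j(1)])
    also have "\<dots> = 0" using tridiag_entry_eq_form[OF j(1)] j(2) mat_vec_carrier by simp
    finally show ?thesis using \<tau> by simp
  qed
  hence "z \<bullet> z = y \<bullet> y" unfolding z_def by (rule lanczos_basis_isometric[OF y(1)])
  thus ?thesis using bounds form pos by (simp add: mult_le_cancel_right_pos)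
qed

lemma quadrature_exact:
  assumes p: "degree p < 2 * K" and T: "eigenbasis K (T K) y \<tau>" and A: "eigenbasis n A u \<mu>"
  shows "(\<Sum>k<K. poly p (\<tau> k) * (y k \<bullet> e1 K)\<^sup>2) = (\<Sum>k<n. poly p (\<mu> k) * (u k \<bullet> q 1)\<^sup>2)"
proof -
  interpret T: eigenbasis K "T K" y \<tau> by fact
  interpret A: eigenbasis n A u \<mu> by fact
  have "(\<Sum>k<K. poly p (\<tau> k) * (y k \<bullet> e1 K)\<^sup>2) = (\<Sum>i\<le>degree p. coeff p i * (e1 K \<bullet> krylov (T K) (e1 K) i))"
    unfolding poly_altdef T.krylov_moment[OF unit_vec_carrier] sum_distrib_left sum_distrib_right
    by (subst sum.swap) (simp add: mult.assoc)
  also have "\<dots> = (\<Sum>i\<le>degree p. coeff p i * (q 1 \<bullet> krylov A (q 1) i))"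
    using p by (intro sum.cong refl arg_cong2[of _ _ _ _ "(*)"] krylov_moments_agree[symmetric]) auto
  also have "\<dots> = (\<Sum>k<n. poly p (\<mu> k) * (u k \<bullet> q 1)\<^sup>2)"
    unfolding poly_altdef A.krylov_moment[OF vec_carrier] sum_distrib_left sum_distrib_right
    by (subst sum.swap) (simp add: mult.assoc)
  finally show ?thesis .
qed

end

lemma abs_weighted_sum_diff_le:
  fixes f g w :: "'a \<Rightarrow> real"
  assumes "\<And>i. i \<in> I \<Longrightarrow> 0 \<le> w i" "\<And>i. i \<in> I \<Longrightarrow> w i \<noteq> 0 \<Longrightarrow> \<bar>f i - g i\<bar> \<le> e"
  shows "\<bar>(\<Sum>i\<in>I. f i * w i) - (\<Sum>i\<in>I. g i * w i)\<bar> \<le> e * (\<Sum>i\<in>I. w i)"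
  unfolding sum_subtractf[symmetric] left_diff_distrib[symmetric] sum_distrib_left
proof (intro order_trans[OF sum_abs] sum_mono)
  fix i assume "i \<in> I"
  thus "\<bar>(f i - g i) * w i\<bar> \<le> e * w i"
    using assms by (cases "w i = 0") (auto simp: abs_mult intro!: mult_right_mono)
qed

lemma (in lanczos_recurrence) log_quadrature_error:
  assumes loewner: "loewner_between \<alpha> A \<beta>" and \<alpha>: "0 < \<alpha>" and K: "0 < K"
    and p: "degree p < 2 * K" "\<And>x. x \<in> {\<alpha>..\<beta>} \<Longrightarrow> \<bar>ln x - poly p x\<bar> \<le> e"
  shows "\<bar>mat_log (T K) $$ (0,0) - q 1 \<bullet> (mat_log A *\<^sub>v q 1)\<bar> \<le> 2 * e"
proof -
  obtain y \<tau> where T: "eigenbasis K (T K) y \<tau>"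
    using sym_mat_eigenbasis[OF tridiag_mat_carrier tridiag_mat_sym] .
  obtain u \<mu> where A: "eigenbasis n A u \<mu>" using sym_mat_eigenbasis[OF mat_carrier mat_sym] .
  interpret T: eigenbasis K "T K" y \<tau> by fact
  interpret A: eigenbasis n A u \<mu> by fact
  have "mat_log (T K) $$ (0,0) = e1 K \<bullet> (mat_log (T K) *\<^sub>v e1 K)"
    using K T.mat_fun_carrier[of ln] by (simp add: mat_log_def)
  hence log_T: "mat_log (T K) $$ (0,0) = (\<Sum>k<K. ln (\<tau> k) * (y k \<bullet> e1 K)\<^sup>2)"
    by (simp add: mat_log_def T.mat_fun_quadratic)
  have "\<bar>(\<Sum>k<K. ln (\<tau> k) * (y k \<bullet> e1 K)\<^sup>2) - (\<Sum>k<K. poly p (\<tau> k) * (y k \<bullet> e1 K)\<^sup>2)\<bar>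
      \<le> e * (\<Sum>k<K. (y k \<bullet> e1 K)\<^sup>2)"
  proof (rule abs_weighted_sum_diff_le)
    fix k assume k: "k \<in> {..<K}" and "(y k \<bullet> e1 K)\<^sup>2 \<noteq> 0"
    hence "y k $ 0 \<noteq> 0" using K by simp
    hence "\<tau> k \<in> {\<alpha>..\<beta>}"
      using k by (intro ritz_value_bounds[OF loewner \<alpha> T.vec_carrier T.eigen K]) auto
    thus "\<bar>ln (\<tau> k) - poly p (\<tau> k)\<bar> \<le> e" by (rule p(2))
  qed simp
  also have "\<dots> = e" using T.sum_coeff_square[OF unit_vec_carrier, of 0] K by simp
  finally have T_error: "\<bar>(\<Sum>k<K. ln (\<tau> k) * (y k \<bullet> e1 K)\<^sup>2) - (\<Sum>k<K. poly p (\<tau> k) * (y k \<bullet> e1 K)\<^sup>2)\<bar> \<le> e" .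
  have "\<bar>(\<Sum>k<n. ln (\<mu> k) * (u k \<bullet> q 1)\<^sup>2) - (\<Sum>k<n. poly p (\<mu> k) * (u k \<bullet> q 1)\<^sup>2)\<bar>
      \<le> e * (\<Sum>k<n. (u k \<bullet> q 1)\<^sup>2)"
    using A.eigenvalue_in_loewner_interval[OF loewner] p(2) by (intro abs_weighted_sum_diff_le) auto
  also have "\<dots> = e" using A.sum_coeff_square[OF vec_carrier, of 1] vec_1_unit by simp
  finally have A_error: "\<bar>(\<Sum>k<n. ln (\<mu> k) * (u k \<bullet> q 1)\<^sup>2) - (\<Sum>k<n. poly p (\<mu> k) * (u k \<bullet> q 1)\<^sup>2)\<bar> \<le> e" .
  have log_A: "q 1 \<bullet> (mat_log A *\<^sub>v q 1) = (\<Sum>k<n. ln (\<mu> k) * (u k \<bullet> q 1)\<^sup>2)"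
    unfolding mat_log_def by (rule A.mat_fun_quadratic[OF vec_carrier])
  show ?thesis using T_error A_error quadrature_exact[OF p(1) T A] unfolding log_T log_A by linarith
qed

definition lanczos_step :: "real mat \<Rightarrow> real vec \<times> real vec \<times> real \<Rightarrow> real vec \<times> real vec \<times> real" where
  "lanczos_step A = (\<lambda>(p, q, b). let v = A *\<^sub>v q - b \<cdot>\<^sub>v p; r = v - (q \<bullet> v) \<cdot>\<^sub>v q
     in (q, (1 / vnorm r) \<cdot>\<^sub>v r, vnorm r))"

definition lanczos_diag :: "real mat \<Rightarrow> real vec \<times> real vec \<times> real \<Rightarrow> real" where
  "lanczos_diag A = (\<lambda>(p, q, b). q \<bullet> (A *\<^sub>v q - b \<cdot>\<^sub>v p))"

lemma lanczos_aux_eq_map: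
  "lanczos_aux A k p q b =
    (map (\<lambda>i. lanczos_diag A ((lanczos_step A ^^ i) (p, q, b))) [0..<k],
     map (\<lambda>i. snd (snd ((lanczos_step A ^^ Suc i) (p, q, b)))) [0..<k])"
proof (induction k arbitrary: p q b)
  case (Suc k)
  have upt: "[0..<Suc k] = 0 # map Suc [0..<k]" by (simp add: upt_conv_Cons map_Suc_upt del: upt_Suc)
  have step: "lanczos_step A (p, q, b) = (let v = A *\<^sub>v q - b \<cdot>\<^sub>v p; r = v - (q \<bullet> v) \<cdot>\<^sub>v q
      in (q, (1 / vnorm r) \<cdot>\<^sub>v r, vnorm r))" by (simp add: lanczos_step_def)
  show ?case
    unfolding upt lanczos_aux.simps Suc.IH
    by (simp add: funpow_Suc_right step lanczos_diag_def Let_def o_def del: funpow.simps)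
qed simp

lemma lanczos_recurrence_normalized_residuals:
  fixes q :: "nat \<Rightarrow> real vec" and a b :: "nat \<Rightarrow> real"
  assumes A: "A \<in> carrier_mat n n" "sym_mat A" and q_1: "q 1 \<in> carrier_vec n" "q 1 \<bullet> q 1 = 1"
    and q_0: "q 0 = 0\<^sub>v n" and b_0: "b 0 = 0"
    and a: "\<And>j. a j = q (Suc j) \<bullet> (A *\<^sub>v q (Suc j) - b j \<cdot>\<^sub>v q j)"
  defines "r \<equiv> \<lambda>j. A *\<^sub>v q (Suc j) - b j \<cdot>\<^sub>v q j - a j \<cdot>\<^sub>v q (Suc j)"
  assumes b: "\<And>j. b (Suc j) = vnorm (r j)"
    and q: "\<And>j. q (Suc (Suc j)) = (1 / vnorm (r j)) \<cdot>\<^sub>v r j"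
  shows "lanczos_recurrence n A q a b"
proof
  have "q j \<in> carrier_vec n \<and> q (Suc j) \<in> carrier_vec n" for j
    by (induction j) (use A q_1 in \<open>auto simp: q_0 q r_def\<close>)
  thus q_carrier: "q j \<in> carrier_vec n" for j by blast
  have r_carrier: "r j \<in> carrier_vec n" for j using q_carrier A by (auto simp: r_def)
  fix j
  have "b (Suc j) \<cdot>\<^sub>v q (Suc (Suc j)) = r j"
  proof (cases "vnorm (r j) = 0")
    case True
    hence "r j = 0\<^sub>v n" using vnorm_square[of "r j"] scalar_prod_self_eq_0_iff[OF r_carrier] by simp
    thus ?thesis unfolding b q True by (intro eq_vecI) auto
  qed (simp add: b q smult_smult_assoc)
  thus "A *\<^sub>v q (Suc j) = b j \<cdot>\<^sub>v q j + a j \<cdot>\<^sub>v q (Suc j) + b (Suc j) \<cdot>\<^sub>v q (Suc (Suc j))"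
    using A by (intro eq_vecI) (auto simp: r_def carrier_vecD[OF q_carrier])
  show "q (Suc (Suc j)) = 0\<^sub>v n" if "b (Suc j) = 0"
    using that r_carrier[of j] by (intro eq_vecI) (auto simp: q b)
  show "q (Suc (Suc j)) \<bullet> q (Suc (Suc j)) = 1" if "b (Suc j) \<noteq> 0"
    using that unfolding vnorm_square[symmetric] q b by (simp add: vnorm_smult)
qed (use A q_1 q_0 b_0 a in auto)

lemma lanczos_T_recurrence:
  assumes A: "A \<in> carrier_mat n n" "sym_mat A" and v: "v \<in> carrier_vec n" "v \<bullet> v = 1"
  obtains q a b where "lanczos_recurrence n A q a b" "q 1 = v"
    "\<And>K. lanczos_T K A v = tridiag_mat K a (\<lambda>i. b (Suc i))"
proof -
  define state where "state j = (lanczos_step A ^^ j) (0\<^sub>v n, v, 0)" for j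
  define q where "q j = fst (state j)" for j
  define b where "b j = snd (snd (state j))" for j
  define a where "a j = lanczos_diag A (state j)" for j
  have state_Suc: "state (Suc j) = lanczos_step A (state j)" for j by (simp add: state_def)
  have "fst (snd (state j)) = q (Suc j)" for j
    unfolding q_def state_Suc
    by (cases "state j" rule: prod_cases3) (simp add: lanczos_step_def Let_def)
  hence state: "state j = (q j, q (Suc j), b j)" for j by (metis b_def q_def prod.collapse)
  have start: "q 0 = 0\<^sub>v n" "q 1 = v" "b 0 = 0" using state[of 0] by (auto simp: state_def)
  have a_eq: "a j = q (Suc j) \<bullet> (A *\<^sub>v q (Suc j) - b j \<cdot>\<^sub>v q j)" for j
    by (simp add: a_def state lanczos_diag_def)
  have "lanczos_recurrence n A q a b"
    using state_Suc A v start a_eq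
    by (intro lanczos_recurrence_normalized_residuals) (auto simp: state lanczos_step_def Let_def)
  moreover have "lanczos_T K A v = tridiag_mat K a (\<lambda>i. b (Suc i))" for K
    unfolding lanczos_T_def tridiag_mat_def Let_def a_def b_def state_def
    using A by (intro eq_matI) (auto simp: lanczos_aux_eq_map simp del: funpow.simps)
  ultimately show ?thesis using that start by blast
qed

lemma slq_quad_error:
  assumes A: "A \<in> loewner_interval n \<alpha> \<beta>" and \<alpha>: "0 < \<alpha>" and w: "w \<in> carrier_vec n" "w \<bullet> w \<noteq> 0"
    and K: "0 < K" and p: "degree p < 2 * K" "\<And>x. x \<in> {\<alpha>..\<beta>} \<Longrightarrow> \<bar>ln x - poly p x\<bar> \<le> e"
  shows "\<bar>slq_quad K A w - w \<bullet> (mat_log A *\<^sub>v w)\<bar> \<le> (w \<bullet> w) * (2 * e)"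
proof -
  define v where "v = (1 / vnorm w) \<cdot>\<^sub>v w"
  have pos: "0 < w \<bullet> w" using w(2) scalar_prod_self_nonneg[of w] by linarith
  hence norm: "vnorm w > 0" by (simp add: vnorm_def)
  have v: "v \<in> carrier_vec n" "v \<bullet> v = 1"
    unfolding vnorm_square[symmetric] v_def using w norm by (auto simp: vnorm_smult)
  obtain q a b where rec: "lanczos_recurrence n A q a b" "q 1 = v"
    "lanczos_T K A v = tridiag_mat K a (\<lambda>i. b (Suc i))"
    using lanczos_T_recurrence[OF loewner_intervalD(1,2)[OF A] v] by metis
  have "\<bar>mat_log (lanczos_T K A v) $$ (0,0) - v \<bullet> (mat_log A *\<^sub>v v)\<bar> \<le> 2 * e"
    using lanczos_recurrence.log_quadrature_error[OF rec(1) loewner_intervalD(3)[OF A] \<alpha> K p] rec(2,3)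
    by simp
  moreover have "w \<bullet> (mat_log A *\<^sub>v w) = (w \<bullet> w) * (v \<bullet> (mat_log A *\<^sub>v v))"
    unfolding v_def using w norm mat_log_carrier[OF A]
    by (simp add: mult_mat_vec[of _ n n] vnorm_square[symmetric] power2_eq_square)
  moreover have "slq_quad K A w = (w \<bullet> w) * mat_log (lanczos_T K A v) $$ (0,0)"
    by (simp add: slq_quad_def v_def vnorm_square)
  ultimately show ?thesis
    using pos by (simp add: abs_mult flip: right_diff_distrib)
qed

section \<open>Exponential moments of Rademacher chaos\<close>

definition avg :: "'a set \<Rightarrow> ('a \<Rightarrow> real) \<Rightarrow> real" where
  "avg S f = (\<Sum>x\<in>S. f x) / real (card S)"

lemma avg_const: "finite S \<Longrightarrow> S \<noteq> {} \<Longrightarrow> avg S (\<lambda>_. c) = c"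
  by (simp add: avg_def)

lemma avg_mono: "(\<And>x. x \<in> S \<Longrightarrow> f x \<le> g x) \<Longrightarrow> avg S f \<le> avg S g"
  unfolding avg_def by (intro divide_right_mono sum_mono) auto

lemma avg_cong: "(\<And>x. x \<in> S \<Longrightarrow> f x = g x) \<Longrightarrow> avg S f = avg S g"
  unfolding avg_def by (intro arg_cong2[of _ _ _ _ "(/)"] sum.cong) auto

lemma avg_nonneg: "(\<And>x. x \<in> S \<Longrightarrow> 0 \<le> f x) \<Longrightarrow> 0 \<le> avg S f"
  unfolding avg_def by (intro divide_nonneg_nonneg sum_nonneg) auto

lemma avg_mult_left: "avg S (\<lambda>x. c * f x) = c * avg S f"
  by (simp add: avg_def sum_distrib_left)

lemma avg_sum: "avg S (\<lambda>x. \<Sum>i\<in>A. f i x) = (\<Sum>i\<in>A. avg S (f i))"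
  unfolding avg_def sum_divide_distrib[symmetric] by (subst sum.swap) simp

lemma avg_swap: "avg S (\<lambda>x. avg S' (\<lambda>y. f x y)) = avg S' (\<lambda>y. avg S (\<lambda>x. f x y))"
  unfolding avg_def sum_divide_distrib[symmetric] by (subst sum.swap) (simp add: mult.commute)

lemma exp_avg_le:
  assumes "finite S" "S \<noteq> {}"
  shows "exp (avg S f) \<le> avg S (\<lambda>x. exp (f x))"
proof -
  have "exp (\<Sum>x\<in>S. (1 / real (card S)) *\<^sub>R f x) \<le> (\<Sum>x\<in>S. 1 / real (card S) * exp (f x))"
    using assms by (intro convex_on_sum[OF _ _ exp_convex]) auto
  thus ?thesis by (simp add: avg_def sum_divide_distrib)
qed

definition sign_vecs :: "nat \<Rightarrow> real vec set" where
  "sign_vecs m = {w \<in> carrier_vec m. \<forall>j<m. w $ j \<in> {-1, 1}}"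

lemma sign_vecs_carrier: "w \<in> sign_vecs m \<Longrightarrow> w \<in> carrier_vec m"
  by (simp add: sign_vecs_def)

lemma sign_vecs_bij: "bij_betw (vec m) (PiE {..<m} (\<lambda>_. {-1, 1})) (sign_vecs m)"
proof (rule bij_betwI[where g = "\<lambda>w. \<lambda>i\<in>{..<m}. w $ i"])
  show "(\<lambda>i\<in>{..<m}. vec m x $ i) = x" if "x \<in> PiE {..<m} (\<lambda>_. {-1, 1})" for x :: "nat \<Rightarrow> real"
    using that by (intro ext) (auto simp: PiE_def extensional_def)
qed (auto simp: sign_vecs_def PiE_def Pi_def)

lemma finite_sign_vecs: "finite (sign_vecs m)"
  using bij_betw_finite[OF sign_vecs_bij[of m]] by (simp add: finite_PiE)

lemma card_sign_vecs: "card (sign_vecs m) = 2 ^ m"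
  using bij_betw_same_card[OF sign_vecs_bij[of m]] by (simp add: card_PiE numeral_2_eq_2)

lemma sign_vecs_nonempty: "sign_vecs m \<noteq> {}"
  using card_sign_vecs[of m] by auto

lemma sign_vecs_scalar_prod_self:
  assumes "w \<in> sign_vecs m"
  shows "w \<bullet> w = real m"
proof -
  have "w \<bullet> w = (\<Sum>i<m. w $ i * w $ i)" by (rule scalar_prod_eq_sum[OF sign_vecs_carrier[OF assms]])
  also have "\<dots> = (\<Sum>i<m. 1)" using assms by (intro sum.cong refl) (auto simp: sign_vecs_def)
  finally show ?thesis by simp
qed

lemma avg_sign_vecs_prod:
  fixes f :: "nat \<Rightarrow> real \<Rightarrow> real"
  shows "avg (sign_vecs m) (\<lambda>w. \<Prod>i<m. f i (w $ i)) = (\<Prod>i<m. (f i (-1) + f i 1) / 2)"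
proof -
  have "(\<Sum>w\<in>sign_vecs m. \<Prod>i<m. f i (w $ i)) = (\<Sum>g\<in>PiE {..<m} (\<lambda>_. {-1, 1}). \<Prod>i<m. f i (vec m g $ i))"
    by (rule sum.reindex_bij_betw[OF sign_vecs_bij, symmetric])
  also have "\<dots> = (\<Sum>g\<in>PiE {..<m} (\<lambda>_. {-1, 1}). \<Prod>i<m. f i (g i))" by simp
  also have "\<dots> = (\<Prod>i<m. \<Sum>y\<in>{-1, 1}. f i y)" by (rule prod_sum_PiE[symmetric]) auto
  finally show ?thesis by (simp add: avg_def card_sign_vecs prod_dividef)
qed

lemma cosh_le_exp_square: "cosh x \<le> exp (x\<^sup>2 / 2)" for x :: real
proof -
  define y where "y = \<bar>x\<bar>"
  have "1 + 1 / 2 * (exp (2 * y) - 1) = exp y * cosh y"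
    by (simp add: cosh_field_def distrib_left add_divide_distrib diff_divide_distrib flip: exp_add)
  hence "- (2 * y) * (1 / 2) + ln (exp y * cosh y) \<le> (2 * y)\<^sup>2 / 8"
    using Hoeffdings_lemma_aux[of "2 * y" "1 / 2"] by (simp add: y_def)
  hence "ln (cosh y) \<le> y\<^sup>2 / 2" by (simp add: ln_mult cosh_real_pos power_mult_distrib)
  hence "cosh y \<le> exp (y\<^sup>2 / 2)" by (metis cosh_real_pos exp_le_cancel_iff exp_ln)
  thus ?thesis by (simp add: y_def)
qed

lemma avg_exp_linear_form:
  assumes "b \<in> carrier_vec m"
  shows "avg (sign_vecs m) (\<lambda>x. exp (b \<bullet> x)) \<le> exp (b \<bullet> b / 2)"
proof -
  have "avg (sign_vecs m) (\<lambda>x. exp (b \<bullet> x)) = avg (sign_vecs m) (\<lambda>x. \<Prod>i<m. exp (b $ i * (x $ i)))"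
    by (intro avg_cong) (simp add: scalar_prod_eq_sum[OF sign_vecs_carrier] exp_sum)
  also have "\<dots> = (\<Prod>i<m. cosh (b $ i))"
    unfolding avg_sign_vecs_prod[of m "\<lambda>i t. exp (b $ i * t)"]
    by (intro prod.cong refl) (simp add: cosh_field_def)
  also have "\<dots> \<le> (\<Prod>i<m. exp ((b $ i)\<^sup>2 / 2))"
    by (intro prod_mono conjI cosh_le_exp_square) (simp add: cosh_real_nonneg)
  also have "\<dots> = exp (b \<bullet> b / 2)"
    by (simp add: exp_sum[symmetric] scalar_prod_eq_sum[OF assms] sum_divide_distrib power2_eq_square)
  finally show ?thesis .
qed

lemma complete_gaussian_square:
  fixes a c g :: real
  assumes "a < 1"
  shows "c\<^sup>2 / (2 * (1 - a)) - (g - c / (1 - a))\<^sup>2 * (1 - a) / 2 = c * g + a * g\<^sup>2 / 2 - g\<^sup>2 / 2"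
proof -
  define d where "d = 1 - a"
  have d: "0 < d" "a = 1 - d" using assms by (auto simp: d_def)
  have "(g - c / d)\<^sup>2 * d = d * g\<^sup>2 - 2 * c * g + c\<^sup>2 / d"
    using d(1) by (simp add: power2_diff power_divide field_simps power2_eq_square)
  thus ?thesis unfolding d(2) by (simp add: algebra_simps diff_divide_distrib add_divide_distrib)
qed

lemma std_normal_exp_quadratic:
  fixes a c :: real
  assumes a: "a < 1"
  shows "has_bochner_integral lborel (\<lambda>g. std_normal_density g * exp (c * g + a * g\<^sup>2 / 2))
    (1 / sqrt (1 - a) * exp (c\<^sup>2 / (2 * (1 - a))))"
proof -
  define \<sigma> where "\<sigma> = 1 / sqrt (1 - a)"
  define \<mu> where "\<mu> = c / (1 - a)"
  define C where "C = \<sigma> * exp (c\<^sup>2 / (2 * (1 - a)))"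
  have \<sigma>: "0 < \<sigma>" "\<sigma>\<^sup>2 = 1 / (1 - a)" using a by (auto simp: \<sigma>_def power_divide)
  have "has_bochner_integral lborel (normal_density \<mu> \<sigma>) 1"
    using \<sigma> by (simp add: has_bochner_integral_iff)
  from has_bochner_integral_mult_right[OF this, of C]
  have "has_bochner_integral lborel (\<lambda>g. C * normal_density \<mu> \<sigma> g) C" by simp
  moreover have "C * normal_density \<mu> \<sigma> g = std_normal_density g * exp (c * g + a * g\<^sup>2 / 2)" for g
  proof -
    have "sqrt (2 * pi * \<sigma>\<^sup>2) = sqrt (2 * pi) * \<sigma>" using \<sigma>(1) by (simp add: real_sqrt_mult)
    hence "normal_density \<mu> \<sigma> g = 1 / (sqrt (2 * pi) * \<sigma>) * exp (- ((g - \<mu>)\<^sup>2 * (1 - a) / 2))"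
      by (simp add: normal_density_def \<sigma>(2))
    hence "C * normal_density \<mu> \<sigma> g =
        1 / sqrt (2 * pi) * (exp (c\<^sup>2 / (2 * (1 - a))) * exp (- ((g - \<mu>)\<^sup>2 * (1 - a) / 2)))"
      using \<sigma>(1) by (simp add: C_def)
    also have "\<dots> = 1 / sqrt (2 * pi) * exp (c\<^sup>2 / (2 * (1 - a)) - (g - \<mu>)\<^sup>2 * (1 - a) / 2)"
      by (simp flip: exp_add)
    also have "\<dots> = 1 / sqrt (2 * pi) * exp (c * g + a * g\<^sup>2 / 2 - g\<^sup>2 / 2)"
      unfolding \<mu>_def complete_gaussian_square[OF a] ..
    also have "\<dots> = std_normal_density g * exp (c * g + a * g\<^sup>2 / 2)"
      by (simp add: std_normal_density_def flip: exp_add)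
    finally show ?thesis .
  qed
  ultimately show ?thesis by (simp add: C_def \<sigma>_def)
qed

lemma has_bochner_integral_mono:
  fixes f g :: "'a \<Rightarrow> real"
  assumes "has_bochner_integral M f x" "has_bochner_integral M g y" "\<And>w. f w \<le> g w"
  shows "x \<le> y"
  using integral_mono[of M f g] assms by (simp add: has_bochner_integral_iff)

text \<open>Hubbard--Stratonovich: \<open>exp (z (v x)\<^sup>2 / 2)\<close> is the Gaussian average of \<open>exp (sqrt z g (v x))\<close>, which
  the hypothesis bounds for each value of \<open>g\<close>.\<close>
lemma avg_exp_square_le:
  fixes p v :: "'a \<Rightarrow> real"
  assumes z: "0 \<le> z" "z < 1"
    and linear: "\<And>s. avg S (\<lambda>x. exp (p x + s * v x)) \<le> C * exp (s * \<beta> + s\<^sup>2 / 2)"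
  shows "avg S (\<lambda>x. exp (p x + z * (v x)\<^sup>2 / 2)) \<le> C * (1 / sqrt (1 - z) * exp (z * \<beta>\<^sup>2 / (2 * (1 - z))))"
proof -
  have "has_bochner_integral lborel (\<lambda>g. std_normal_density g * exp (p x + sqrt z * g * v x))
      (exp (p x + z * (v x)\<^sup>2 / 2))" for x
    using has_bochner_integral_mult_right[OF std_normal_exp_quadratic[of 0 "sqrt z * v x"], of "exp (p x)"] z(1)
    by (simp add: exp_add power_mult_distrib mult_ac)
  hence lhs: "has_bochner_integral lborel
      (\<lambda>g. std_normal_density g * avg S (\<lambda>x. exp (p x + sqrt z * g * v x)))
      (avg S (\<lambda>x. exp (p x + z * (v x)\<^sup>2 / 2)))"
    unfolding avg_def times_divide_eq_right sum_distrib_left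
    by (intro has_bochner_integral_divide has_bochner_integral_sum) auto
  have rhs: "has_bochner_integral lborel
      (\<lambda>g. std_normal_density g * (C * exp (sqrt z * g * \<beta> + (sqrt z * g)\<^sup>2 / 2)))
      (C * (1 / sqrt (1 - z) * exp (z * \<beta>\<^sup>2 / (2 * (1 - z)))))"
    using has_bochner_integral_mult_right[OF std_normal_exp_quadratic[OF z(2), of "sqrt z * \<beta>"], of C] z(1)
    by (simp add: power_mult_distrib mult_ac)
  show ?thesis
    by (rule has_bochner_integral_mono[OF lhs rhs]) (intro mult_left_mono linear, simp)
qed

lemma avg_exp_quadratic_form:
  fixes a :: "nat \<Rightarrow> real"
  assumes "\<And>i. i < k \<Longrightarrow> u i \<in> carrier_vec m"
    and "\<And>i j. i < k \<Longrightarrow> j < k \<Longrightarrow> u i \<bullet> u j = (if i = j then 1 else 0)"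
    and "\<And>i. i < k \<Longrightarrow> 0 \<le> a i \<and> a i < 1" and "b \<in> carrier_vec m"
  shows "avg (sign_vecs m) (\<lambda>x. exp ((\<Sum>i<k. a i * (u i \<bullet> x)\<^sup>2 / 2) + b \<bullet> x)) \<le>
    (\<Prod>i<k. 1 / sqrt (1 - a i)) * exp ((\<Sum>i<k. a i * (u i \<bullet> b)\<^sup>2 / (2 * (1 - a i))) + b \<bullet> b / 2)"
  using assms
proof (induction k arbitrary: b)
  case 0
  thus ?case using avg_exp_linear_form by simp
next
  case (Suc k)
  note b = \<open>b \<in> carrier_vec m\<close>
  define P where "P = (\<Prod>i<k. 1 / sqrt (1 - a i))"
  define E where "E = (\<Sum>i<k. a i * (u i \<bullet> b)\<^sup>2 / (2 * (1 - a i)))"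
  have u: "u i \<in> carrier_vec m" if "i \<le> k" for i using Suc.prems(1) that by simp
  have uk: "u k \<in> carrier_vec m" "u k \<bullet> u k = 1" "\<And>i. i < k \<Longrightarrow> u i \<bullet> u k = 0"
    using u Suc.prems(2) by auto
  have "avg (sign_vecs m) (\<lambda>x. exp ((\<Sum>i<k. a i * (u i \<bullet> x)\<^sup>2 / 2) + b \<bullet> x + a k * (u k \<bullet> x)\<^sup>2 / 2)) \<le>
      P * exp (E + b \<bullet> b / 2) * (1 / sqrt (1 - a k) * exp (a k * (u k \<bullet> b)\<^sup>2 / (2 * (1 - a k))))"
  proof (rule avg_exp_square_le)
    fix s
    define b' where "b' = b + s \<cdot>\<^sub>v u k"
    have b': "b' \<in> carrier_vec m" using b uk(1) by (simp add: b'_def)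
    have "avg (sign_vecs m) (\<lambda>x. exp ((\<Sum>i<k. a i * (u i \<bullet> x)\<^sup>2 / 2) + b \<bullet> x + s * (u k \<bullet> x))) =
        avg (sign_vecs m) (\<lambda>x. exp ((\<Sum>i<k. a i * (u i \<bullet> x)\<^sup>2 / 2) + b' \<bullet> x))"
      using b uk(1)
      by (intro avg_cong) (simp add: b'_def add_scalar_prod_distrib[of _ m] sign_vecs_carrier)
    also have "\<dots> \<le> P * exp ((\<Sum>i<k. a i * (u i \<bullet> b')\<^sup>2 / (2 * (1 - a i))) + b' \<bullet> b' / 2)"
      unfolding P_def using Suc.prems b' by (intro Suc.IH) auto
    also have "(\<Sum>i<k. a i * (u i \<bullet> b')\<^sup>2 / (2 * (1 - a i))) = E"
      unfolding E_def using b uk u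
      by (intro sum.cong refl)
        (simp add: b'_def scalar_prod_add_distrib[of _ m] scalar_prod_smult_distrib[of _ m])
    also have "b' \<bullet> b' = b \<bullet> b + 2 * (s * (u k \<bullet> b)) + s\<^sup>2"
      unfolding b'_def using b uk comm_scalar_prod[OF b uk(1)]
      by (simp add: add_scalar_prod_distrib[of _ m] scalar_prod_add_distrib[of _ m] power2_eq_square
          algebra_simps)
    also have "E + (b \<bullet> b + 2 * (s * (u k \<bullet> b)) + s\<^sup>2) / 2 = (E + b \<bullet> b / 2) + (s * (u k \<bullet> b) + s\<^sup>2 / 2)"
      by (simp only: add_divide_distrib)
    finally show "avg (sign_vecs m) (\<lambda>x. exp ((\<Sum>i<k. a i * (u i \<bullet> x)\<^sup>2 / 2) + b \<bullet> x + s * (u k \<bullet> x))) \<le>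
        P * exp (E + b \<bullet> b / 2) * exp (s * (u k \<bullet> b) + s\<^sup>2 / 2)"
      by (simp only: exp_add mult.assoc)
  qed (use Suc.prems(3)[of k] in auto)
  thus ?case by (simp add: P_def E_def exp_add mult_ac)
qed

lemma inverse_sqrt_le_exp:
  fixes a :: real
  assumes "a < 1"
  shows "1 / sqrt (1 - a) \<le> exp (a / (1 - a) / 2)"
proof (rule power2_le_imp_le)
  have "(1 / sqrt (1 - a))\<^sup>2 = 1 / (1 - a)" using assms by (simp add: power_divide)
  also have "\<dots> = 1 + a / (1 - a)" using assms by (simp add: field_simps)
  also have "\<dots> \<le> exp (a / (1 - a))" by (rule exp_ge_add_one_self)
  also have "exp y = (exp (y / 2))\<^sup>2" for y :: real by (simp add: power2_eq_square flip: exp_add)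
  finally show "(1 / sqrt (1 - a))\<^sup>2 \<le> (exp (a / (1 - a) / 2))\<^sup>2" .
qed simp

lemma avg_exp_psd_form:
  assumes G: "eigenbasis m G u g" and g: "\<And>k. k < m \<Longrightarrow> c * g k \<in> {0..s}" and s: "s < 1"
  shows "avg (sign_vecs m) (\<lambda>x. exp (c * (x \<bullet> (G *\<^sub>v x)) / 2)) \<le> exp (c * trace_mat G / (1 - s) / 2)"
proof -
  interpret eigenbasis m G u g by fact
  define a where "a k = c * g k" for k
  have a: "0 \<le> a k" "a k \<le> s" "a k < 1" if "k < m" for k using g[OF that] s by (auto simp: a_def)
  have "c * (x \<bullet> (G *\<^sub>v x)) / 2 = (\<Sum>k<m. a k * (u k \<bullet> x)\<^sup>2 / 2) + 0\<^sub>v m \<bullet> x" if "x \<in> sign_vecs m" for x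
    using mat_fun_quadratic[OF sign_vecs_carrier[OF that], of "\<lambda>x. x"]
      scalar_prod_left_zero[OF sign_vecs_carrier[OF that]]
    by (simp add: mat_fun_id a_def sum_divide_distrib sum_distrib_left mult.assoc)
  hence "avg (sign_vecs m) (\<lambda>x. exp (c * (x \<bullet> (G *\<^sub>v x)) / 2)) =
      avg (sign_vecs m) (\<lambda>x. exp ((\<Sum>k<m. a k * (u k \<bullet> x)\<^sup>2 / 2) + 0\<^sub>v m \<bullet> x))"
    by (intro avg_cong) simp
  also have "\<dots> \<le> (\<Prod>k<m. 1 / sqrt (1 - a k)) *
      exp ((\<Sum>k<m. a k * (u k \<bullet> 0\<^sub>v m)\<^sup>2 / (2 * (1 - a k))) + 0\<^sub>v m \<bullet> 0\<^sub>v m / 2)"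
    by (rule avg_exp_quadratic_form) (use vec_carrier orthonormal a in auto)
  also have "\<dots> = (\<Prod>k<m. 1 / sqrt (1 - a k))" using scalar_prod_right_zero[OF vec_carrier] by simp
  also have "\<dots> \<le> (\<Prod>k<m. exp (a k / (1 - s) / 2))"
  proof (intro prod_mono conjI)
    fix k assume "k \<in> {..<m}"
    hence k: "0 \<le> a k" "a k \<le> s" "a k < 1" using a by auto
    have "1 / sqrt (1 - a k) \<le> exp (a k / (1 - a k) / 2)" by (rule inverse_sqrt_le_exp[OF k(3)])
    also have "\<dots> \<le> exp (a k / (1 - s) / 2)" using k s by (simp add: divide_left_mono)
    finally show "1 / sqrt (1 - a k) \<le> exp (a k / (1 - s) / 2)" .
    show "0 \<le> 1 / sqrt (1 - a k)" using k by simp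
  qed
  also have "\<dots> = exp (c * trace_mat G / (1 - s) / 2)"
    by (simp add: exp_sum[symmetric] trace_mat_eq_sum_eigenvalues a_def sum_divide_distrib sum_distrib_left)
  finally show ?thesis .
qed

lemma gram_mat_form:
  assumes M: "M \<in> carrier_mat n m" and v: "v \<in> carrier_vec m"
  shows "v \<bullet> ((transpose_mat M * M) *\<^sub>v v) = (vnorm (M *\<^sub>v v))\<^sup>2"
proof -
  have Mv: "M *\<^sub>v v \<in> carrier_vec n" using M v by auto
  have "v \<bullet> ((transpose_mat M * M) *\<^sub>v v) = v \<bullet> (transpose_mat M *\<^sub>v (M *\<^sub>v v))"
    using M v by (subst assoc_mult_mat_vec[of _ m n _ m]) auto
  thus ?thesis
    using transpose_vec_mult_scalar[OF M v Mv] comm_scalar_prod[OF v, of "transpose_mat M *\<^sub>v (M *\<^sub>v v)"] M Mv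
    by (simp add: vnorm_square)
qed

lemma gram_mat_eigenbasis:
  assumes M: "M \<in> carrier_mat n m"
  obtains u g where "eigenbasis m (transpose_mat M * M) u g" "\<And>k. k < m \<Longrightarrow> g k \<in> {0..(spec_norm M)\<^sup>2}"
proof -
  have G: "transpose_mat M * M \<in> carrier_mat m m" "sym_mat (transpose_mat M * M)"
    using M by (auto simp: sym_mat_def transpose_mult[of _ m n] intro!: exI[of _ m])
  obtain u g where u: "eigenbasis m (transpose_mat M * M) u g" using sym_mat_eigenbasis[OF G] .
  interpret eigenbasis m "transpose_mat M * M" u g by fact
  have "g k \<in> {0..(spec_norm M)\<^sup>2}" if k: "k < m" for k
  proof -
    have "g k = (vnorm (M *\<^sub>v u k))\<^sup>2"
      using gram_mat_form[OF M vec_carrier[OF k]] eigen[OF k] orthonormal[OF k k] vec_carrier[OF k]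
      by simp
    moreover have "vnorm (M *\<^sub>v u k) \<le> spec_norm M"
      using vnorm_mult_mat_vec_le_spec_norm[OF M vec_carrier[OF k]] orthonormal[OF k k]
      by (simp add: vnorm_def)
    ultimately show ?thesis by (simp add: power_mono)
  qed
  thus ?thesis using that u by blast
qed

lemma trace_gram_mat:
  assumes M: "M \<in> carrier_mat n m"
  shows "trace_mat (transpose_mat M * M) = (frob_norm M)\<^sup>2"
proof -
  have "transpose_mat M * M \<in> carrier_mat m m" using M by auto
  thus ?thesis
    by (simp add: trace_mat_eq_sum_forms frob_norm_square_columns[OF M] gram_mat_form[OF M])
qed

lemma decoupled_chaos_mgf:
  assumes M: "M \<in> carrier_mat n m" and t: "t\<^sup>2 * (spec_norm M)\<^sup>2 < 1"
  shows "avg (sign_vecs m) (\<lambda>y. avg (sign_vecs n) (\<lambda>x. exp (t * (x \<bullet> (M *\<^sub>v y))))) \<le>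
    exp (t\<^sup>2 * (frob_norm M)\<^sup>2 / (1 - t\<^sup>2 * (spec_norm M)\<^sup>2) / 2)"
proof -
  define G where "G = transpose_mat M * M"
  obtain u g where G: "eigenbasis m G u g" "\<And>k. k < m \<Longrightarrow> g k \<in> {0..(spec_norm M)\<^sup>2}"
    using gram_mat_eigenbasis[OF M] unfolding G_def by blast
  have inner: "avg (sign_vecs n) (\<lambda>x. exp (t * (x \<bullet> (M *\<^sub>v y)))) \<le> exp (t\<^sup>2 * (y \<bullet> (G *\<^sub>v y)) / 2)"
    if y: "y \<in> sign_vecs m" for y
  proof -
    define b where "b = t \<cdot>\<^sub>v (M *\<^sub>v y)"
    have My: "M *\<^sub>v y \<in> carrier_vec n" "b \<in> carrier_vec n" using M sign_vecs_carrier[OF y]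
      by (auto simp: b_def)
    have "avg (sign_vecs n) (\<lambda>x. exp (t * (x \<bullet> (M *\<^sub>v y)))) = avg (sign_vecs n) (\<lambda>x. exp (b \<bullet> x))"
      using My(1) comm_scalar_prod[OF sign_vecs_carrier My(1)] sign_vecs_carrier
      by (intro avg_cong) (simp add: b_def)
    also have "\<dots> \<le> exp (b \<bullet> b / 2)" by (rule avg_exp_linear_form[OF My(2)])
    also have "b \<bullet> b = t\<^sup>2 * (y \<bullet> (G *\<^sub>v y))"
      unfolding G_def gram_mat_form[OF M sign_vecs_carrier[OF y]] b_def vnorm_square[symmetric] vnorm_smult
      by (simp add: power_mult_distrib)
    finally show ?thesis .
  qed
  have "avg (sign_vecs m) (\<lambda>y. exp (t\<^sup>2 * (y \<bullet> (G *\<^sub>v y)) / 2)) \<le>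
      exp (t\<^sup>2 * trace_mat G / (1 - t\<^sup>2 * (spec_norm M)\<^sup>2) / 2)"
    using G(2) by (intro avg_exp_psd_form[OF G(1) _ t]) (auto intro: mult_left_mono)
  thus ?thesis
    using order_trans[OF avg_mono[OF inner]] by (simp add: G_def trace_gram_mat[OF M])
qed

definition restrict_vec :: "nat set \<Rightarrow> 'a :: zero vec \<Rightarrow> 'a vec" where
  "restrict_vec I v = vec (dim_vec v) (\<lambda>i. if i \<in> I then v $ i else 0)"

definition cross_block :: "nat set \<Rightarrow> 'a :: zero mat \<Rightarrow> 'a mat" where
  "cross_block I B = mat (dim_row B) (dim_col B) (\<lambda>(i,j). if i \<in> I \<and> j \<notin> I then B $$ (i,j) else 0)"

lemma restrict_vec_carrier: "v \<in> carrier_vec n \<Longrightarrow> restrict_vec I v \<in> carrier_vec n"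
  by (simp add: restrict_vec_def)

lemma vnorm_restrict_vec_le: "vnorm (restrict_vec I v) \<le> vnorm v"
  by (rule vnorm_mono[of _ "dim_vec v"]) (auto simp: restrict_vec_def)

lemma cross_block_carrier: "B \<in> carrier_mat n k \<Longrightarrow> cross_block I B \<in> carrier_mat n k"
  by (simp add: cross_block_def)

lemma cross_block_index:
  assumes "B \<in> carrier_mat n k" "i < n" "j < k"
  shows "cross_block I B $$ (i,j) = (if i \<in> I \<and> j \<notin> I then B $$ (i,j) else 0)"
  using assms by (simp add: cross_block_def)

lemma cross_block_mult:
  fixes B :: "'a :: semiring_0 mat"
  assumes B: "B \<in> carrier_mat n k" and v: "v \<in> carrier_vec k"
  shows "cross_block I B *\<^sub>v v = restrict_vec I (B *\<^sub>v restrict_vec (- I) v)"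
proof (rule eq_vecI)
  fix i assume "i < dim_vec (restrict_vec I (B *\<^sub>v restrict_vec (- I) v))"
  hence i: "i < n" using B by (simp add: restrict_vec_def)
  have "(cross_block I B *\<^sub>v v) $ i = (\<Sum>j<k. cross_block I B $$ (i,j) * v $ j)"
    by (rule index_mult_mat_vec_eq_sum[OF cross_block_carrier[OF B] v i])
  also have "\<dots> = (if i \<in> I then \<Sum>j<k. B $$ (i,j) * restrict_vec (- I) v $ j else 0)"
    using i v by (auto simp: cross_block_index[OF B] restrict_vec_def intro!: sum.cong)
  also have "\<dots> = restrict_vec I (B *\<^sub>v restrict_vec (- I) v) $ i"
    unfolding index_mult_mat_vec_eq_sum[OF B restrict_vec_carrier[OF v] i, symmetric]
    using i B by (simp add: restrict_vec_def)
  finally show "(cross_block I B *\<^sub>v v) $ i = restrict_vec I (B *\<^sub>v restrict_vec (- I) v) $ i" .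
qed (use B in \<open>simp add: cross_block_def restrict_vec_def\<close>)

lemma spec_norm_cross_block_le:
  assumes B: "B \<in> carrier_mat n k" and k: "0 < k"
  shows "spec_norm (cross_block I B) \<le> spec_norm B"
proof (rule spec_norm_leI[OF cross_block_carrier[OF B] k])
  fix v :: "real vec" assume v: "v \<in> carrier_vec k" "vnorm v = 1"
  have "vnorm (cross_block I B *\<^sub>v v) \<le> vnorm (B *\<^sub>v restrict_vec (- I) v)"
    unfolding cross_block_mult[OF B v(1)] by (rule vnorm_restrict_vec_le)
  also have "\<dots> \<le> spec_norm B * vnorm (restrict_vec (- I) v)"
    by (rule vnorm_mult_mat_vec_le_spec_norm[OF B restrict_vec_carrier[OF v(1)]])
  also have "\<dots> \<le> spec_norm B * 1"
    using vnorm_restrict_vec_le[of "- I" v] v(2) by (intro mult_left_mono spec_norm_nonneg[OF B k]) simp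
  finally show "vnorm (cross_block I B *\<^sub>v v) \<le> spec_norm B" by simp
qed

lemma frob_norm_cross_block_le:
  assumes B: "B \<in> carrier_mat n n" "sym_mat B"
  shows "(frob_norm (cross_block I B))\<^sup>2 \<le> (frob_norm B)\<^sup>2 / 2"
proof -
  let ?C = "cross_block I B"
  have "2 * (\<Sum>i<n. \<Sum>j<n. (?C $$ (i,j))\<^sup>2) = (\<Sum>i<n. \<Sum>j<n. (?C $$ (i,j))\<^sup>2 + (?C $$ (j,i))\<^sup>2)"
    unfolding sum.distrib by (subst sum.swap[of "\<lambda>i j. (?C $$ (j,i))\<^sup>2"]) simp
  also have "\<dots> \<le> (\<Sum>i<n. \<Sum>j<n. (B $$ (i,j))\<^sup>2)"
  proof (intro sum_mono)
    fix i j assume "i \<in> {..<n}" "j \<in> {..<n}"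
    thus "(?C $$ (i,j))\<^sup>2 + (?C $$ (j,i))\<^sup>2 \<le> (B $$ (i,j))\<^sup>2"
      using sym_mat_index[OF B, of i j] by (simp add: cross_block_index[OF B(1)])
  qed
  finally show ?thesis
    by (simp add: frob_norm_square[OF B(1)] frob_norm_square[OF cross_block_carrier[OF B(1)]])
qed

lemma card_Pow_separating:
  assumes A: "finite A" "i \<in> A" "j \<in> A" "i \<noteq> j"
  shows "card {I \<in> Pow A. i \<in> I \<and> j \<notin> I} = 2 ^ (card A - 2)"
proof -
  have "bij_betw (insert i) (Pow (A - {i, j})) {I \<in> Pow A. i \<in> I \<and> j \<notin> I}"
    by (rule bij_betwI[where g = "\<lambda>I. I - {i}"]) (use A in auto)
  hence "card {I \<in> Pow A. i \<in> I \<and> j \<notin> I} = card (Pow (A - {i, j}))"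
    by (rule bij_betw_same_card[symmetric])
  thus ?thesis using A by (simp add: card_Pow card_Diff_subset)
qed

lemma avg_Pow_separating:
  assumes "finite A" "i \<in> A" "j \<in> A" "i \<noteq> j"
  shows "avg (Pow A) (\<lambda>I. if i \<in> I \<and> j \<notin> I then c else 0) = c / 4"
proof -
  have "2 \<le> card A" using card_mono[of A "{i, j}"] assms by simp
  then obtain k where "card A = 2 + k" using le_Suc_ex by blast
  hence "(2 :: real) ^ card A = 4 * 2 ^ (card A - 2)" by (simp add: power_add)
  moreover have "(\<Sum>I\<in>Pow A. if i \<in> I \<and> j \<notin> I then c else 0) = 2 ^ (card A - 2) * c"
    using assms(1) card_Pow_separating[OF assms] by (simp flip: sum.inter_filter)
  ultimately show ?thesis using assms(1) by (simp add: avg_def card_Pow)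
qed

lemma avg_cross_block_form:
  assumes B: "B \<in> carrier_mat m m" "\<And>i. i < m \<Longrightarrow> B $$ (i,i) = 0" and x: "x \<in> carrier_vec m"
  shows "avg (Pow {..<m}) (\<lambda>I. 4 * (x \<bullet> (cross_block I B *\<^sub>v x))) = x \<bullet> (B *\<^sub>v x)"
proof -
  have "avg (Pow {..<m}) (\<lambda>I. 4 * (x \<bullet> (cross_block I B *\<^sub>v x))) = (\<Sum>i<m. \<Sum>j<m.
      avg (Pow {..<m}) (\<lambda>I. if i \<in> I \<and> j \<notin> I then 4 * (x $ i * B $$ (i,j) * x $ j) else 0))"
    unfolding bilinear_form_eq_sum[OF cross_block_carrier[OF B(1)] x x] sum_distrib_left avg_sum
    by (intro sum.cong refl avg_cong) (simp add: cross_block_index[OF B(1)])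
  also have "\<dots> = (\<Sum>i<m. \<Sum>j<m. x $ i * B $$ (i,j) * x $ j)"
  proof (intro sum.cong refl)
    fix i j assume ij: "i \<in> {..<m}" "j \<in> {..<m}"
    show "avg (Pow {..<m}) (\<lambda>I. if i \<in> I \<and> j \<notin> I then 4 * (x $ i * B $$ (i,j) * x $ j) else 0) =
        x $ i * B $$ (i,j) * x $ j"
    proof (cases "i = j")
      case True
      thus ?thesis using ij B(2)[of i] by (simp add: avg_def)
    qed (use ij in \<open>simp add: avg_Pow_separating\<close>)
  qed
  finally show ?thesis using bilinear_form_eq_sum[OF B(1) x x] by simp
qed

definition merge_vec :: "nat set \<Rightarrow> 'a vec \<Rightarrow> 'a vec \<Rightarrow> 'a vec" where
  "merge_vec I x y = vec (dim_vec x) (\<lambda>i. if i \<in> I then x $ i else y $ i)"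

lemma merge_sign_vecs:
  assumes "x \<in> sign_vecs m" "y \<in> sign_vecs m"
  shows "merge_vec I x y \<in> sign_vecs m"
proof -
  have "x $ j \<in> {-1, 1}" "y $ j \<in> {-1, 1}" if "j < m" for j using assms that
    by (auto simp: sign_vecs_def)
  moreover have "dim_vec x = m" using assms by (simp add: sign_vecs_def)
  ultimately show ?thesis by (simp add: sign_vecs_def merge_vec_def)
qed

lemma avg_merge_vec:
  "avg (sign_vecs m) (\<lambda>y. avg (sign_vecs m) (\<lambda>x. h (merge_vec I x y))) = avg (sign_vecs m) h"
proof -
  have involutive: "merge_vec I (merge_vec I x y) (merge_vec I y x) = x"
    if "x \<in> sign_vecs m" "y \<in> sign_vecs m" for x y
    using that by (intro eq_vecI) (auto simp: sign_vecs_def merge_vec_def)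
  let ?swap = "\<lambda>(y, x). (merge_vec I y x, merge_vec I x y)"
  have "(\<Sum>(y,x)\<in>sign_vecs m \<times> sign_vecs m. h (merge_vec I x y)) = (\<Sum>(y,x)\<in>sign_vecs m \<times> sign_vecs m. h x)"
    by (rule sum.reindex_bij_witness[of _ ?swap ?swap]) (auto simp: merge_sign_vecs involutive)
  hence "(\<Sum>y\<in>sign_vecs m. \<Sum>x\<in>sign_vecs m. h (merge_vec I x y)) = 2 ^ m * (\<Sum>x\<in>sign_vecs m. h x)"
    by (simp add: card_sign_vecs flip: sum.cartesian_product)
  thus ?thesis by (simp add: avg_def card_sign_vecs flip: sum_divide_distrib)
qed

lemma cross_block_form_merge_vec:
  fixes B :: "'a :: semiring_0 mat"
  assumes B: "B \<in> carrier_mat m m" and x: "x \<in> carrier_vec m" and y: "y \<in> carrier_vec m"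
  shows "merge_vec I x y \<bullet> (cross_block I B *\<^sub>v merge_vec I x y) = x \<bullet> (cross_block I B *\<^sub>v y)"
proof -
  have z: "merge_vec I x y \<in> carrier_vec m" using x by (simp add: merge_vec_def)
  show ?thesis
    unfolding bilinear_form_eq_sum[OF cross_block_carrier[OF B] z z]
      bilinear_form_eq_sum[OF cross_block_carrier[OF B] x y]
    using x by (intro sum.cong refl) (simp add: cross_block_index[OF B] merge_vec_def)
qed

lemma cross_block_chaos_mgf:
  assumes B: "B \<in> carrier_mat m m" "sym_mat B" and m: "0 < m" and t: "t\<^sup>2 * (spec_norm B)\<^sup>2 < 1"
  shows "avg (sign_vecs m) (\<lambda>x. exp (t * (x \<bullet> (cross_block I B *\<^sub>v x)))) \<le>
    exp (t\<^sup>2 * (frob_norm B)\<^sup>2 / (1 - t\<^sup>2 * (spec_norm B)\<^sup>2) / 4)"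
proof -
  note C = cross_block_carrier[OF B(1), of I]
  have spec: "t\<^sup>2 * (spec_norm (cross_block I B))\<^sup>2 \<le> t\<^sup>2 * (spec_norm B)\<^sup>2"
    by (intro mult_left_mono power_mono spec_norm_cross_block_le[OF B(1) m] spec_norm_nonneg[OF C m]) simp
  have frob: "t\<^sup>2 * (frob_norm (cross_block I B))\<^sup>2 \<le> t\<^sup>2 * ((frob_norm B)\<^sup>2 / 2)"
    by (intro mult_left_mono frob_norm_cross_block_le[OF B]) simp
  have "avg (sign_vecs m) (\<lambda>x. exp (t * (x \<bullet> (cross_block I B *\<^sub>v x)))) = avg (sign_vecs m) (\<lambda>y.
      avg (sign_vecs m) (\<lambda>x. exp (t * (merge_vec I x y \<bullet> (cross_block I B *\<^sub>v merge_vec I x y)))))"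
    by (rule avg_merge_vec[symmetric])
  also have "\<dots> = avg (sign_vecs m) (\<lambda>y. avg (sign_vecs m) (\<lambda>x. exp (t * (x \<bullet> (cross_block I B *\<^sub>v y)))))"
    by (intro avg_cong) (simp add: cross_block_form_merge_vec[OF B(1)] sign_vecs_carrier)
  also have "\<dots> \<le> exp (t\<^sup>2 * (frob_norm (cross_block I B))\<^sup>2 / (1 - t\<^sup>2 * (spec_norm (cross_block I B))\<^sup>2) / 2)"
    using spec t by (intro decoupled_chaos_mgf[OF C]) simp
  also have "\<dots> \<le> exp (t\<^sup>2 * ((frob_norm B)\<^sup>2 / 2) / (1 - t\<^sup>2 * (spec_norm B)\<^sup>2) / 2)"
    using spec frob t by (intro exp_le_cancel_iff[THEN iffD2] divide_right_mono frac_le) auto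
  also have "t\<^sup>2 * (f / 2) / d / 2 = t\<^sup>2 * f / d / 4" for f d :: real by simp
  finally show ?thesis .
qed

text \<open>Decoupling: the terms of \<open>x \<bullet> (B *\<^sub>v x)\<close> that link a set of coordinates to its complement are bilinear
  in independent sign vectors.\<close>
theorem rademacher_chaos_mgf:
  assumes B: "B \<in> carrier_mat m m" "sym_mat B" "\<And>i. i < m \<Longrightarrow> B $$ (i,i) = 0" and m: "0 < m"
    and t: "16 * t\<^sup>2 * (spec_norm B)\<^sup>2 < 1"
  shows "avg (sign_vecs m) (\<lambda>x. exp (t * (x \<bullet> (B *\<^sub>v x)))) \<le>
    exp (4 * t\<^sup>2 * (frob_norm B)\<^sup>2 / (1 - 16 * t\<^sup>2 * (spec_norm B)\<^sup>2))"
proof -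
  let ?P = "Pow {..<m}" and ?S = "sign_vecs m"
  let ?bound = "exp (4 * t\<^sup>2 * (frob_norm B)\<^sup>2 / (1 - 16 * t\<^sup>2 * (spec_norm B)\<^sup>2))"
  have "t * (x \<bullet> (B *\<^sub>v x)) = avg ?P (\<lambda>I. t * (4 * (x \<bullet> (cross_block I B *\<^sub>v x))))" if "x \<in> ?S" for x
    using avg_cross_block_form[OF B(1,3) sign_vecs_carrier[OF that]]
    by (simp only: avg_mult_left[where c = t])
  hence "avg ?S (\<lambda>x. exp (t * (x \<bullet> (B *\<^sub>v x)))) =
      avg ?S (\<lambda>x. exp (avg ?P (\<lambda>I. t * (4 * (x \<bullet> (cross_block I B *\<^sub>v x))))))"
    by (intro avg_cong) (simp only:)
  also have "\<dots> \<le> avg ?S (\<lambda>x. avg ?P (\<lambda>I. exp (t * (4 * (x \<bullet> (cross_block I B *\<^sub>v x))))))"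
    by (intro avg_mono exp_avg_le) auto
  also have "\<dots> = avg ?P (\<lambda>I. avg ?S (\<lambda>x. exp (t * (4 * (x \<bullet> (cross_block I B *\<^sub>v x))))))"
    by (rule avg_swap)
  also have "\<dots> \<le> avg ?P (\<lambda>_. ?bound)"
  proof (rule avg_mono)
    fix I
    have "avg ?S (\<lambda>x. exp (4 * t * (x \<bullet> (cross_block I B *\<^sub>v x)))) \<le>
        exp ((4 * t)\<^sup>2 * (frob_norm B)\<^sup>2 / (1 - (4 * t)\<^sup>2 * (spec_norm B)\<^sup>2) / 4)"
      by (rule cross_block_chaos_mgf[OF B(1,2) m]) (use t in \<open>simp add: power_mult_distrib\<close>)
    also have "(4 * t)\<^sup>2 = 16 * t\<^sup>2" by (simp add: power_mult_distrib)
    also have "16 * t\<^sup>2 * f / d / 4 = 4 * t\<^sup>2 * f / d" for f d :: real by simp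
    finally show "avg ?S (\<lambda>x. exp (t * (4 * (x \<bullet> (cross_block I B *\<^sub>v x))))) \<le> ?bound"
      by (simp only: mult_ac)
  qed
  also have "\<dots> = ?bound" by (rule avg_const) auto
  finally show ?thesis .
qed

section \<open>Nets in Euclidean space\<close>

definition separated :: "real \<Rightarrow> 'a :: metric_space set \<Rightarrow> bool" where
  "separated \<rho> F \<longleftrightarrow> (\<forall>x\<in>F. \<forall>y\<in>F. x \<noteq> y \<longrightarrow> \<rho> \<le> dist x y)"

lemma disjoint_family_balls_separated:
  assumes "separated \<rho> F"
  shows "disjoint_family_on (\<lambda>x. ball x (\<rho> / 2)) F"
  unfolding disjoint_family_on_def
proof (intro ballI impI)
  fix x y assume xy: "x \<in> F" "y \<in> F" "x \<noteq> y"
  show "ball x (\<rho> / 2) \<inter> ball y (\<rho> / 2) = {}"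
  proof (rule ccontr)
    assume "ball x (\<rho> / 2) \<inter> ball y (\<rho> / 2) \<noteq> {}"
    then obtain z where "dist x z < \<rho> / 2" "dist y z < \<rho> / 2" by auto
    hence "dist x y < \<rho>" using dist_triangle2[of x y z] by simp
    thus False using assms xy by (force simp: separated_def)
  qed
qed

lemma card_separated_le:
  fixes c :: "'a :: euclidean_space"
  assumes F: "finite F" "F \<subseteq> cball c r" "separated \<rho> F" and r: "0 \<le> r" and \<rho>: "0 < \<rho>"
  shows "real (card F) \<le> (1 + 2 * r / \<rho>) ^ DIM('a)"
proof -
  define V where "V = measure lborel (ball 0 1 :: 'a set)"
  have V: "0 < V" by (simp add: V_def content_ball_pos)
  have "real (card F) * ((\<rho> / 2) ^ DIM('a) * V) = (\<Sum>x\<in>F. measure lborel (ball x (\<rho> / 2)))"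
    using \<rho> by (simp add: V_def content_ball_conv_unit_ball[of "\<rho> / 2"])
  also have "\<dots> = measure lborel (\<Union>x\<in>F. ball x (\<rho> / 2))"
    using emeasure_lborel_ball_finite[of _ "\<rho> / 2"]
    by (intro measure_finite_Union[symmetric] F(1) disjoint_family_balls_separated[OF F(3)])
      (auto simp: less_top)
  also have "\<dots> \<le> measure lborel (cball c (r + \<rho> / 2))"
  proof (rule measure_mono_fmeasurable)
    show "(\<Union>x\<in>F. ball x (\<rho> / 2)) \<subseteq> cball c (r + \<rho> / 2)"
    proof
      fix z assume "z \<in> (\<Union>x\<in>F. ball x (\<rho> / 2))"
      then obtain x where "x \<in> F" "dist x z < \<rho> / 2" by auto
      moreover from this have "dist c x \<le> r" using F(2) by auto
      ultimately show "z \<in> cball c (r + \<rho> / 2)" using dist_triangle[of c z x] by simp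
    qed
    show "(\<Union>x\<in>F. ball x (\<rho> / 2)) \<in> sets lborel" by (simp add: borel_open open_UN)
    show "cball c (r + \<rho> / 2) \<in> fmeasurable lborel" by (intro fmeasurable_compact compact_cball)
  qed
  also have "\<dots> = (r + \<rho> / 2) ^ DIM('a) * V"
    using \<rho> r by (simp add: V_def content_cball_conv_ball content_ball_conv_unit_ball[of "r + \<rho> / 2"])
  also have "r + \<rho> / 2 = (1 + 2 * r / \<rho>) * (\<rho> / 2)" using \<rho> by (simp add: field_simps)
  finally have "real (card F) * ((\<rho> / 2) ^ DIM('a) * V) \<le> (1 + 2 * r / \<rho>) ^ DIM('a) * ((\<rho> / 2) ^ DIM('a) * V)"
    by (simp only: power_mult_distrib mult.assoc)
  thus ?thesis using V \<rho> by (simp add: mult_le_cancel_right_pos)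
qed

lemma finite_net:
  fixes c :: "'a :: euclidean_space"
  assumes T: "T \<subseteq> cball c r" and r: "0 \<le> r" and \<rho>: "0 < \<rho>"
  obtains F where "finite F" "F \<subseteq> T" "real (card F) \<le> (1 + 2 * r / \<rho>) ^ DIM('a)"
    "\<And>x. x \<in> T \<Longrightarrow> \<exists>y\<in>F. dist x y \<le> \<rho>"
proof -
  define P where "P F \<longleftrightarrow> finite F \<and> F \<subseteq> T \<and> separated \<rho> F" for F
  have bound: "real (card F) \<le> (1 + 2 * r / \<rho>) ^ DIM('a)" if "P F" for F
    using that T by (intro card_separated_le[OF _ _ _ r \<rho>, of F c]) (auto simp: P_def)
  have "\<exists>F. P F \<and> (\<forall>G. P G \<longrightarrow> card G \<le> card F)"
  proof (rule ex_has_greatest_nat[of P "{}"])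
    show "P {}" by (simp add: P_def separated_def)
    show "\<forall>G. P G \<longrightarrow> card G < Suc (nat \<lfloor>(1 + 2 * r / \<rho>) ^ DIM('a)\<rfloor>)"
      using bound le_nat_floor by (metis less_Suc_eq_le)
  qed
  then obtain F where F: "P F" "\<And>G. P G \<Longrightarrow> card G \<le> card F" by blast
  have "\<exists>y\<in>F. dist x y \<le> \<rho>" if x: "x \<in> T" for x
  proof (rule ccontr)
    assume "\<not> (\<exists>y\<in>F. dist x y \<le> \<rho>)"
    hence far: "\<rho> < dist x y" if "y \<in> F" for y using that by force
    hence "P (insert x F)" using F(1) x by (auto simp: P_def separated_def dist_commute less_imp_le)
    moreover have "x \<notin> F" using far[of x] \<rho> by auto
    ultimately show False using F(2)[of "insert x F"] F(1) by (simp add: P_def)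
  qed
  thus ?thesis using that[of F] F(1) bound by (auto simp: P_def)
qed

text \<open>The factor \<open>4/3\<close> makes the volume bound \<open>(3r/\<eta>)\<^sup>p\<close> with \<open>\<eta> = h/L\<close> valid for all \<open>\<eta>\<close>: a net of radius
  \<open>4\<eta>/3\<close> has at most \<open>(1 + 3r/(2\<eta>))\<^sup>p\<close> points, which suffices when \<open>\<eta> \<le> 3r/2\<close>, and otherwise a single
  point is enough.\<close>
lemma finite_net_lipschitz:
  fixes T :: "'a :: euclidean_space set" and d :: "'a \<Rightarrow> 'a \<Rightarrow> real"
  assumes T: "T \<subseteq> cball c r" "T \<noteq> {}" and r: "0 < r" and L: "0 \<le> L" and h: "0 < h"
    and lipschitz: "\<And>x y. x \<in> T \<Longrightarrow> y \<in> T \<Longrightarrow> d x y \<le> L * norm (x - y)"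
  obtains F where "finite F" "F \<subseteq> T" "real (card F) \<le> max ((3 * r / (h / L)) ^ DIM('a)) 1"
    "\<And>x. x \<in> T \<Longrightarrow> \<exists>y\<in>F. d x y \<le> 4 / 3 * h"
proof (cases "L * (2 * r) \<le> 4 / 3 * h")
  case True
  obtain y where y: "y \<in> T" using T by blast
  have "d x y \<le> 4 / 3 * h" if x: "x \<in> T" for x
  proof -
    have "norm (x - y) \<le> 2 * r"
      using subsetD[OF T(1) x] subsetD[OF T(1) y] dist_triangle3[of x y c] by (simp add: dist_norm)
    thus ?thesis using lipschitz[OF x y] True mult_left_mono[OF _ L, of "norm (x - y)" "2 * r"]
      by linarith
  qed
  thus ?thesis using y by (intro that[of "{y}"]) auto
next
  case False
  hence L_pos: "0 < L" using L h by (cases "L = 0") auto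
  define \<eta> where "\<eta> = h / L"
  have \<eta>: "0 < \<eta>" "\<eta> < 3 / 2 * r" "L * (4 / 3 * \<eta>) = 4 / 3 * h"
    using False L_pos h by (auto simp: \<eta>_def field_simps)
  obtain F where F: "finite F" "F \<subseteq> T" "real (card F) \<le> (1 + 2 * r / (4 / 3 * \<eta>)) ^ DIM('a)"
    "\<And>x. x \<in> T \<Longrightarrow> \<exists>y\<in>F. dist x y \<le> 4 / 3 * \<eta>"
    using finite_net[OF T(1), of "4 / 3 * \<eta>"] r \<eta>(1) by auto
  have "(1 + 2 * r / (4 / 3 * \<eta>)) ^ DIM('a) \<le> (3 * r / \<eta>) ^ DIM('a)"
    using r \<eta> by (intro power_mono) (auto simp: field_simps)
  hence card: "real (card F) \<le> max ((3 * r / (h / L)) ^ DIM('a)) 1" using F(3) by (simp add: \<eta>_def)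
  show ?thesis
  proof (rule that[OF F(1,2) card])
    fix x assume x: "x \<in> T"
    then obtain y where y: "y \<in> F" "norm (x - y) \<le> 4 / 3 * \<eta>" using F(4) by (auto simp: dist_norm)
    have "d x y \<le> L * norm (x - y)" using lipschitz[OF x] y(1) F(2) by blast
    also have "\<dots> \<le> 4 / 3 * h" using mult_left_mono[OF y(2) L] \<eta>(3) by simp
    finally show "\<exists>y\<in>F. d x y \<le> 4 / 3 * h" using y(1) by blast
  qed
qed

section \<open>Choice of parameters\<close>

lemma chaos_exponent_le:
  fixes F S \<tau> :: real
  assumes FS: "0 \<le> F" "0 \<le> S" and \<tau>: "0 < \<tau>"
  defines "D \<equiv> F / \<tau>\<^sup>2 + S / \<tau>"
  assumes D: "0 < D"
  defines "s \<equiv> 1 / (8 * D * \<tau>)"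
  shows "16 * s\<^sup>2 * S\<^sup>2 < 1" "4 * s\<^sup>2 * F / (1 - 16 * s\<^sup>2 * S\<^sup>2) \<le> 1 / (16 * D)"
proof -
  define f where "f = F / \<tau>\<^sup>2"
  define g where "g = S / \<tau>"
  have fg: "0 \<le> f" "0 \<le> g" "D = f + g" "F = f * \<tau>\<^sup>2" "S = g * \<tau>"
    using FS \<tau> by (auto simp: f_def g_def D_def)
  have s\<tau>: "s * \<tau> = 1 / (8 * D)" using D \<tau> by (simp add: s_def)
  have "16 * s\<^sup>2 * S\<^sup>2 = 16 * (s * \<tau>)\<^sup>2 * g\<^sup>2" by (simp add: fg(5) power_mult_distrib)
  also have "\<dots> = 1 / 4 * (g / D)\<^sup>2" unfolding s\<tau> by (simp add: power_divide power_mult_distrib)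
  also have "\<dots> \<le> 1 / 4 * (g / D)"
    using power_decreasing[of 1 2 "g / D"] fg(1-3) D by (intro mult_left_mono) auto
  finally have gap: "16 * s\<^sup>2 * S\<^sup>2 \<le> 1 / 4 * (g / D)" .
  have "g / D = 1 - f / D" using D by (simp add: fg(3) field_simps)
  moreover have "0 \<le> f / D" "0 \<le> g / D" using fg(1,2) D by auto
  ultimately have denom: "f / D \<le> 1 - 16 * s\<^sup>2 * S\<^sup>2" "16 * s\<^sup>2 * S\<^sup>2 < 1" using gap by linarith+
  show "16 * s\<^sup>2 * S\<^sup>2 < 1" by (rule denom(2))
  have "4 * s\<^sup>2 * F = 4 * (s * \<tau>)\<^sup>2 * f" by (simp add: fg(4) power_mult_distrib)
  also have "\<dots> = 1 / (16 * D) * (f / D)" unfolding s\<tau> by (simp add: power_divide power2_eq_square)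
  also have "\<dots> \<le> 1 / (16 * D) * (1 - 16 * s\<^sup>2 * S\<^sup>2)" using denom(1) D by (intro mult_left_mono) auto
  finally show "4 * s\<^sup>2 * F / (1 - 16 * s\<^sup>2 * S\<^sup>2) \<le> 1 / (16 * D)" using denom(2)
    by (simp add: divide_le_eq)
qed

lemma chernoff_parameter:
  fixes F S \<tau> N \<Lambda> :: real
  assumes FS: "0 \<le> F" "0 \<le> S" and \<tau>: "0 < \<tau>" and \<Lambda>: "0 < \<Lambda>" and N: "0 < N"
    and N_ge: "32 * (F / \<tau>\<^sup>2 + S / \<tau>) * \<Lambda> \<le> N"
  obtains s where "0 < s" "16 * s\<^sup>2 * S\<^sup>2 < 1"
    "\<Lambda> \<le> N * (s * (19 / 24 * \<tau>) - 4 * s\<^sup>2 * F / (1 - 16 * s\<^sup>2 * S\<^sup>2))"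
proof -
  define D where "D = F / \<tau>\<^sup>2 + S / \<tau>"
  have nonneg: "0 \<le> F / \<tau>\<^sup>2" "0 \<le> S / \<tau>" using FS \<tau> by auto
  show ?thesis
  proof (cases "D = 0")
    case True
    hence zero: "F = 0" "S = 0" using nonneg \<tau> by (auto simp: D_def add_nonneg_eq_0_iff)
    show ?thesis
      by (rule that[of "\<Lambda> / (N * (19 / 24 * \<tau>))"]) (use zero N \<Lambda> \<tau> in auto)
  next
    case False
    hence D: "0 < D" using nonneg by (simp add: D_def)
    define s where "s = 1 / (8 * D * \<tau>)"
    note exponent = chaos_exponent_le[OF FS \<tau> D[unfolded D_def], folded D_def, folded s_def]
    have "s * (19 / 24 * \<tau>) = 19 / (192 * D)" using D \<tau> by (simp add: s_def)
    moreover have "1 / (32 * D) \<le> 19 / (192 * D) - 1 / (16 * D)" using D by (simp add: field_simps)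
    ultimately have rate: "1 / (32 * D) \<le> s * (19 / 24 * \<tau>) - 4 * s\<^sup>2 * F / (1 - 16 * s\<^sup>2 * S\<^sup>2)"
      using exponent(2) by linarith
    have "32 * D * \<Lambda> \<le> N" using N_ge by (simp only: D_def)
    hence "\<Lambda> \<le> N * (1 / (32 * D))" using D by (simp add: field_simps)
    also have "\<dots> \<le> N * (s * (19 / 24 * \<tau>) - 4 * s\<^sup>2 * F / (1 - 16 * s\<^sup>2 * S\<^sup>2))"
      using rate N by (intro mult_left_mono) auto
    finally show ?thesis using that[of s] exponent(1) D \<tau> by (simp add: s_def)
  qed
qed

lemma convergence_rate_le_exp:
  fixes \<kappa> :: real
  assumes "1 \<le> \<kappa>"
  shows "(sqrt \<kappa> - 1) / (sqrt \<kappa> + 1) \<le> exp (- 2 / sqrt (\<kappa> + 1))"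
proof -
  define z where "z = sqrt \<kappa>"
  define s where "s = sqrt (\<kappa> + 1)"
  have zs: "1 \<le> z" "z \<le> s" "1 < s" using assms by (auto simp: z_def s_def)
  have "(z - 1) / (z + 1) = 1 - 2 / (z + 1)" using zs by (simp add: field_simps)
  also have "\<dots> \<le> 1 - 2 / (s + 1)" using zs by (simp add: frac_le)
  also have "\<dots> = (s - 1) / (s + 1)" using zs by (simp add: field_simps)
  also have "\<dots> \<le> exp (- 2 / s)" by (rule diff_quotient_le_exp[OF zs(3)])
  finally show ?thesis by (simp add: z_def s_def)
qed

lemma lanczos_steps_suffice:
  fixes \<kappa> \<epsilon> m :: real
  assumes \<kappa>: "1 \<le> \<kappa>" and \<epsilon>: "0 < \<epsilon>" and m: "0 < m" and K: "0 < K"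
    and K_ge: "sqrt (\<kappa> + 1) / 4 *
      ln (4 * (5/2) * inverse \<epsilon> * m * (sqrt (\<kappa> + 1) + 1) * ln (2 * \<kappa>)) \<le> real K"
  shows "(sqrt \<kappa> + 1) / real (2 * K) * ((sqrt \<kappa> - 1) / (sqrt \<kappa> + 1)) ^ (2 * K) \<le> 3 / 40 * \<epsilon> / m"
proof -
  define s where "s = sqrt (\<kappa> + 1)"
  define q where "q = (sqrt \<kappa> - 1) / (sqrt \<kappa> + 1)"
  define X where "X = 4 * (5/2) * inverse \<epsilon> * m * (s + 1) * ln (2 * \<kappa>)"
  have s: "1 < s" "sqrt \<kappa> \<le> s" using \<kappa> by (auto simp: s_def)
  have q: "0 \<le> q" using \<kappa> by (simp add: q_def)
  have "2 / 3 \<le> ln (2 :: real)" by (rule ln2_ge_two_thirds)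
  also have "\<dots> \<le> ln (2 * \<kappa>)" using \<kappa> by simp
  finally have ln_ge: "2 / 3 \<le> ln (2 * \<kappa>)" .
  have X: "0 < X" unfolding X_def using \<epsilon> m s ln_ge by (intro mult_pos_pos) auto
  have "q ^ (2 * K) \<le> exp (- 2 / s) ^ (2 * K)"
    unfolding q_def s_def using q by (intro power_mono convergence_rate_le_exp \<kappa>) (simp add: q_def)
  also have "\<dots> = exp (- (4 * real K / s))" by (simp flip: exp_of_nat_mult)
  also have "\<dots> \<le> exp (- ln X)"
  proof -
    have "s / 4 * ln X \<le> real K" using K_ge by (simp add: X_def s_def)
    hence "ln X \<le> 4 * real K / s" using s by (simp add: field_simps)
    thus ?thesis by simp
  qed
  also have "\<dots> = 1 / X" using X by (simp add: exp_minus inverse_eq_divide)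
  finally have rate: "q ^ (2 * K) \<le> 1 / X" .
  have "(sqrt \<kappa> + 1) / real (2 * K) * q ^ (2 * K) \<le> (s + 1) / 2 * (1 / X)"
    using s \<kappa> K q by (intro mult_mono frac_le rate) auto
  also have "\<dots> = \<epsilon> / (20 * m) * (1 / ln (2 * \<kappa>))"
    using s m \<epsilon> ln_ge by (simp add: X_def inverse_eq_divide divide_simps)
  also have "\<dots> \<le> \<epsilon> / (20 * m) * (1 / (2 / 3))"
    using \<epsilon> m ln_ge by (intro mult_left_mono divide_left_mono) auto
  finally show ?thesis by (simp add: q_def)
qed

lemma exists_quadrature_poly:
  fixes \<alpha> \<beta> \<epsilon> m :: real
  assumes \<alpha>: "0 < \<alpha>" "\<alpha> \<le> \<beta>" and \<epsilon>: "0 < \<epsilon>" and m: "0 < m" and K: "0 < K"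
    and K_ge: "sqrt (\<beta>/\<alpha> + 1) / 4 *
      ln (4 * (5/2) * inverse \<epsilon> * m * (sqrt (\<beta>/\<alpha> + 1) + 1) * ln (2 * (\<beta>/\<alpha>))) \<le> real K"
  obtains p where "degree p < 2 * K" "\<And>x. x \<in> {\<alpha>..\<beta>} \<Longrightarrow> \<bar>ln x - poly p x\<bar> \<le> 3 / 40 * \<epsilon> / m"
proof -
  obtain p where p: "degree p < 2 * K" "\<And>x. x \<in> {\<alpha>..\<beta>} \<Longrightarrow> \<bar>ln x - poly p x\<bar> \<le>
      (sqrt (\<beta> / \<alpha>) + 1) / real (2 * K) * ((sqrt (\<beta> / \<alpha>) - 1) / (sqrt (\<beta> / \<alpha>) + 1)) ^ (2 * K)"
    using ln_poly_approx[OF \<alpha>, of "2 * K"] K by auto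
  have "1 \<le> \<beta> / \<alpha>" using \<alpha> by simp
  from lanczos_steps_suffice[OF this \<epsilon> m K K_ge] show ?thesis
    using order_trans p by (intro that[of p]) blast+
qed

section \<open>Concentration of the Hutchinson trace estimator\<close>

definition hutchinson :: "real mat \<Rightarrow> real vec list \<Rightarrow> real" where
  "hutchinson B ws = (\<Sum>w\<leftarrow>ws. w \<bullet> (B *\<^sub>v w)) / real (length ws)"

lemma rademacher_tuples_eq: "rademacher_tuples N m = {ws. set ws \<subseteq> sign_vecs m \<and> length ws = N}"
  by (auto simp: rademacher_tuples_def sign_vecs_def)

lemma finite_rademacher_tuples: "finite (rademacher_tuples N m)"
  unfolding rademacher_tuples_eq by (rule finite_lists_length_eq[OF finite_sign_vecs])

lemma rademacher_tuples_nonempty: "rademacher_tuples N m \<noteq> {}"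
proof -
  obtain w where "w \<in> sign_vecs m" using sign_vecs_nonempty by blast
  hence "replicate N w \<in> rademacher_tuples N m"
    by (simp add: rademacher_tuples_eq set_replicate_conv_if)
  thus ?thesis by blast
qed

lemma set_pmf_rademacher_tuples: "set_pmf (pmf_of_set (rademacher_tuples N m)) = rademacher_tuples N m"
  by (rule set_pmf_of_set[OF rademacher_tuples_nonempty finite_rademacher_tuples])

lemma avg_exp_sum_list:
  assumes S: "finite S" "S \<noteq> {}"
  shows "avg {ws. set ws \<subseteq> S \<and> length ws = N} (\<lambda>ws. exp (\<Sum>w\<leftarrow>ws. f w)) = avg S (\<lambda>w. exp (f w)) ^ N"
proof -
  have "(\<Sum>ws | set ws \<subseteq> S \<and> length ws = N. exp (\<Sum>w\<leftarrow>ws. f w)) = (\<Sum>w\<in>S. exp (f w)) ^ N"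
  proof (induction N)
    case 0
    have "{ws. set ws \<subseteq> S \<and> length ws = 0} = {[]}" by auto
    thus ?case by simp
  next
    case (Suc N)
    let ?T = "{ws. set ws \<subseteq> S \<and> length ws = N}"
    have "(\<Sum>ws | set ws \<subseteq> S \<and> length ws = Suc N. exp (\<Sum>w\<leftarrow>ws. f w)) =
        (\<Sum>(w, ws)\<in>S \<times> ?T. exp (f w) * exp (\<Sum>w\<leftarrow>ws. f w))"
      by (rule sum.reindex_bij_witness[of _ "\<lambda>(w, ws). w # ws" "\<lambda>ws. (hd ws, tl ws)"])
        (auto simp: length_Suc_conv exp_add)
    also have "\<dots> = (\<Sum>w\<in>S. exp (f w)) * (\<Sum>ws\<in>?T. exp (\<Sum>w\<leftarrow>ws. f w))"
      by (simp add: sum_product flip: sum.cartesian_product)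
    finally show ?case using Suc by simp
  qed
  thus ?thesis by (simp add: avg_def card_lists_length_eq[OF S(1)] power_divide)
qed

lemma rademacher_chernoff:
  "measure_pmf.prob (pmf_of_set (rademacher_tuples N m)) {ws. c \<le> (\<Sum>w\<leftarrow>ws. f w)}
    \<le> exp (- c) * avg (sign_vecs m) (\<lambda>w. exp (f w)) ^ N"
proof -
  let ?p = "pmf_of_set (rademacher_tuples N m)"
  have "integrable ?p (\<lambda>ws. exp (\<Sum>w\<leftarrow>ws. f w))"
    by (rule integrable_measure_pmf_finite)
      (simp add: set_pmf_rademacher_tuples finite_rademacher_tuples)
  hence "measure_pmf.prob ?p {ws. c \<le> (\<Sum>w\<leftarrow>ws. f w)} \<le>
      exp (- c) * measure_pmf.expectation ?p (\<lambda>ws. exp (\<Sum>w\<leftarrow>ws. f w))"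
    using measure_pmf.Chernoff_ineq_ge[of 1 ?p UNIV "\<lambda>ws. \<Sum>w\<leftarrow>ws. f w" c]
    by (simp add: set_integrable_def set_lebesgue_integral_def)
  also have "measure_pmf.expectation ?p (\<lambda>ws. exp (\<Sum>w\<leftarrow>ws. f w)) =
      avg (rademacher_tuples N m) (\<lambda>ws. exp (\<Sum>w\<leftarrow>ws. f w))"
    by (simp add: integral_pmf_of_set[OF rademacher_tuples_nonempty finite_rademacher_tuples] avg_def)
  also have "\<dots> = avg (sign_vecs m) (\<lambda>w. exp (f w)) ^ N"
    unfolding rademacher_tuples_eq by (rule avg_exp_sum_list[OF finite_sign_vecs sign_vecs_nonempty])
  finally show ?thesis .
qed

lemma rademacher_chaos_sum_tail:
  assumes B: "B \<in> carrier_mat m m" "sym_mat B" "\<And>i. i < m \<Longrightarrow> B $$ (i,i) = 0" and m: "0 < m"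
    and S: "spec_norm B \<le> S" and F: "(frob_norm B)\<^sup>2 \<le> F" and s: "16 * s\<^sup>2 * S\<^sup>2 < 1"
  shows "measure_pmf.prob (pmf_of_set (rademacher_tuples N m)) {ws. c \<le> (\<Sum>w\<leftarrow>ws. s * (w \<bullet> (B *\<^sub>v w)))}
    \<le> exp (real N * (4 * s\<^sup>2 * F / (1 - 16 * s\<^sup>2 * S\<^sup>2)) - c)"
proof -
  define \<psi> where "\<psi> = 4 * s\<^sup>2 * F / (1 - 16 * s\<^sup>2 * S\<^sup>2)"
  have "(spec_norm B)\<^sup>2 \<le> S\<^sup>2" by (intro power_mono S spec_norm_nonneg[OF B(1) m])
  hence spec: "16 * s\<^sup>2 * (spec_norm B)\<^sup>2 \<le> 16 * s\<^sup>2 * S\<^sup>2" by (intro mult_left_mono) auto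
  have "avg (sign_vecs m) (\<lambda>w. exp (s * (w \<bullet> (B *\<^sub>v w)))) \<le>
      exp (4 * s\<^sup>2 * (frob_norm B)\<^sup>2 / (1 - 16 * s\<^sup>2 * (spec_norm B)\<^sup>2))"
    by (rule rademacher_chaos_mgf[OF B m le_less_trans[OF spec s]])
  also have "\<dots> \<le> exp \<psi>" unfolding \<psi>_def
    using spec s F order_trans[OF zero_le_power2 F]
    by (intro exp_le_cancel_iff[THEN iffD2] frac_le mult_left_mono) auto
  finally have "avg (sign_vecs m) (\<lambda>w. exp (s * (w \<bullet> (B *\<^sub>v w)))) ^ N \<le> exp \<psi> ^ N"
    by (intro power_mono avg_nonneg) auto
  hence "exp (- c) * avg (sign_vecs m) (\<lambda>w. exp (s * (w \<bullet> (B *\<^sub>v w)))) ^ N \<le> exp (real N * \<psi> - c)"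
    by (simp add: exp_diff exp_minus field_simps flip: exp_of_nat_mult)
  thus ?thesis unfolding \<psi>_def by (rule order_trans[OF rademacher_chernoff])
qed

lemma hutchinson_tail:
  assumes B: "B \<in> carrier_mat m m" "sym_mat B" "\<And>i. i < m \<Longrightarrow> B $$ (i,i) = 0" and m: "0 < m"
    and S: "spec_norm B \<le> S" and F: "(frob_norm B)\<^sup>2 \<le> F"
    and \<tau>: "0 < \<tau>" and \<Lambda>: "0 < \<Lambda>" and N: "0 < N" "32 * (F / \<tau>\<^sup>2 + S / \<tau>) * \<Lambda> \<le> real N"
  shows "measure_pmf.prob (pmf_of_set (rademacher_tuples N m)) {ws. 19 / 24 * \<tau> \<le> \<bar>hutchinson B ws\<bar>}
    \<le> 2 * exp (- \<Lambda>)"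
proof -
  let ?p = "pmf_of_set (rademacher_tuples N m)"
  have "0 \<le> F" "0 \<le> S"
    using order_trans[OF zero_le_power2 F] order_trans[OF spec_norm_nonneg[OF B(1) m] S] .
  then obtain s where s: "0 < s" "16 * s\<^sup>2 * S\<^sup>2 < 1"
    "\<Lambda> \<le> real N * (s * (19 / 24 * \<tau>) - 4 * s\<^sup>2 * F / (1 - 16 * s\<^sup>2 * S\<^sup>2))"
    using chernoff_parameter[OF _ _ \<tau> \<Lambda> _ N(2)] N(1) by auto
  define E where "E \<sigma> = {ws. real N * (s * (19 / 24 * \<tau>)) \<le> (\<Sum>w\<leftarrow>ws. \<sigma> * (w \<bullet> (B *\<^sub>v w)))}" for \<sigma>
  have one_sided: "measure_pmf.prob ?p (E \<sigma>) \<le> exp (- \<Lambda>)" if "\<sigma>\<^sup>2 = s\<^sup>2" for \<sigma>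
  proof -
    have "measure_pmf.prob ?p (E \<sigma>) \<le>
        exp (real N * (4 * \<sigma>\<^sup>2 * F / (1 - 16 * \<sigma>\<^sup>2 * S\<^sup>2)) - real N * (s * (19 / 24 * \<tau>)))"
      unfolding E_def
    proof (rule rademacher_chaos_sum_tail[OF B m S F])
      show "16 * \<sigma>\<^sup>2 * S\<^sup>2 < 1" using s(2) by (simp add: that)
    qed
    also have "\<dots> \<le> exp (- \<Lambda>)" using s(3) by (simp add: that right_diff_distrib)
    finally show ?thesis .
  qed
  have "ws \<in> E s \<union> E (- s)" if ws: "ws \<in> rademacher_tuples N m" "19 / 24 * \<tau> \<le> \<bar>hutchinson B ws\<bar>" for ws
  proof -
    have "real N * (19 / 24 * \<tau>) \<le> \<bar>\<Sum>w\<leftarrow>ws. w \<bullet> (B *\<^sub>v w)\<bar>"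
      using ws N(1) by (simp add: hutchinson_def rademacher_tuples_eq abs_divide field_simps)
    hence "s * (real N * (19 / 24 * \<tau>)) \<le> s * \<bar>\<Sum>w\<leftarrow>ws. w \<bullet> (B *\<^sub>v w)\<bar>" using s(1) by simp
    thus ?thesis unfolding E_def Un_iff mem_Collect_eq sum_list_const_mult
      by (cases "0 \<le> (\<Sum>w\<leftarrow>ws. w \<bullet> (B *\<^sub>v w))") (auto simp: mult_ac)
  qed
  hence "measure_pmf.prob ?p {ws. 19 / 24 * \<tau> \<le> \<bar>hutchinson B ws\<bar>} \<le> measure_pmf.prob ?p (E s \<union> E (- s))"
    by (intro measure_pmf.finite_measure_mono_AE)
      (auto simp: AE_measure_pmf_iff set_pmf_rademacher_tuples)
  also have "\<dots> \<le> measure_pmf.prob ?p (E s) + measure_pmf.prob ?p (E (- s))"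
    by (rule measure_Un_le) auto
  also have "\<dots> \<le> 2 * exp (- \<Lambda>)" using one_sided[of s] one_sided[of "- s"] by simp
  finally show ?thesis .
qed

lemma offdiag_carrier: "B \<in> carrier_mat n k \<Longrightarrow> offdiag B \<in> carrier_mat n k"
  by (simp add: offdiag_def)

lemma offdiag_sym:
  assumes "B \<in> carrier_mat n n" "sym_mat B"
  shows "sym_mat (offdiag B)"
  unfolding sym_mat_def[of "offdiag B"]
  by (intro conjI exI[of _ n] eq_matI)
    (use assms(1) sym_mat_index[OF assms] in \<open>auto simp: offdiag_def\<close>)

lemma offdiag_diagonal: "B \<in> carrier_mat n n \<Longrightarrow> i < n \<Longrightarrow> offdiag B $$ (i,i) = 0"
  by (simp add: offdiag_def)

lemma frob_norm_offdiag_le: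
  assumes "B \<in> carrier_mat n k"
  shows "(frob_norm (offdiag B))\<^sup>2 \<le> (frob_norm B)\<^sup>2"
  unfolding frob_norm_square[OF assms] frob_norm_square[OF offdiag_carrier[OF assms]]
  using assms by (intro sum_mono) (auto simp: offdiag_def)

lemma sign_vecs_form_offdiag:
  assumes B: "B \<in> carrier_mat m m" and w: "w \<in> sign_vecs m"
  shows "w \<bullet> (B *\<^sub>v w) = trace_mat B + w \<bullet> (offdiag B *\<^sub>v w)"
proof -
  note w' = sign_vecs_carrier[OF w]
  have "w \<bullet> (B *\<^sub>v w) - w \<bullet> (offdiag B *\<^sub>v w) = (\<Sum>i<m. \<Sum>j<m. if i = j then B $$ (i,i) else 0)"
    unfolding bilinear_form_eq_sum[OF B w' w'] bilinear_form_eq_sum[OF offdiag_carrier[OF B] w' w']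
      sum_subtractf[symmetric]
    using B w by (intro sum.cong refl) (auto simp: offdiag_def sign_vecs_def)
  thus ?thesis using B by (simp add: trace_mat_def)
qed

lemma hutchinson_offdiag:
  assumes B: "B \<in> carrier_mat m m" and ws: "set ws \<subseteq> sign_vecs m" "ws \<noteq> []"
  shows "hutchinson B ws = trace_mat B + hutchinson (offdiag B) ws"
proof -
  have "(\<Sum>w\<leftarrow>ws. w \<bullet> (B *\<^sub>v w)) = (\<Sum>w\<leftarrow>ws. trace_mat B + w \<bullet> (offdiag B *\<^sub>v w))"
    using sign_vecs_form_offdiag[OF B] ws(1) by (intro arg_cong[of _ _ sum_list] map_cong) auto
  also have "\<dots> = real (length ws) * trace_mat B + (\<Sum>w\<leftarrow>ws. w \<bullet> (offdiag B *\<^sub>v w))"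
    by (simp add: sum_list_addf sum_list_triv)
  finally show ?thesis using ws(2) by (simp add: hutchinson_def add_divide_distrib)
qed

lemma abs_list_mean_diff_le:
  fixes f g :: "'a \<Rightarrow> real"
  assumes "\<And>w. w \<in> set ws \<Longrightarrow> \<bar>f w - g w\<bar> \<le> e" "ws \<noteq> []"
  shows "\<bar>(\<Sum>w\<leftarrow>ws. f w) / real (length ws) - (\<Sum>w\<leftarrow>ws. g w) / real (length ws)\<bar> \<le> e"
proof -
  have "\<bar>(\<Sum>w\<leftarrow>ws. f w) - (\<Sum>w\<leftarrow>ws. g w)\<bar> \<le> (\<Sum>w\<leftarrow>ws. \<bar>f w - g w\<bar>)"
    using sum_list_abs[of "map (\<lambda>w. f w - g w) ws"] by (simp add: sum_list_subtractf o_def)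
  also have "\<dots> \<le> (\<Sum>w\<leftarrow>ws. e)" using assms(1) by (rule sum_list_mono)
  also have "\<dots> = real (length ws) * e" by (simp add: sum_list_triv)
  finally show ?thesis using assms(2) by (simp add: field_simps abs_divide flip: diff_divide_distrib)
qed

section \<open>Uniform error of stochastic Lanczos quadrature\<close>

lemma slq_hutchinson_error:
  assumes A: "A \<in> loewner_interval m \<alpha> \<beta>" and \<alpha>: "0 < \<alpha>" and m: "0 < m"
    and ws: "set ws \<subseteq> sign_vecs m" "ws \<noteq> []" and K: "0 < K"
    and p: "degree p < 2 * K" "\<And>x. x \<in> {\<alpha>..\<beta>} \<Longrightarrow> \<bar>ln x - poly p x\<bar> \<le> e"
  shows "\<bar>slq K A ws - hutchinson (mat_log A) ws\<bar> \<le> real m * (2 * e)"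
  unfolding slq_def hutchinson_def
proof (rule abs_list_mean_diff_le[OF _ ws(2)])
  fix w assume "w \<in> set ws"
  hence w: "w \<in> sign_vecs m" using ws(1) by blast
  have "\<bar>slq_quad K A w - w \<bullet> (mat_log A *\<^sub>v w)\<bar> \<le> (w \<bullet> w) * (2 * e)"
    using m
    by (intro slq_quad_error[OF A \<alpha> sign_vecs_carrier[OF w] _ K p])
      (auto simp: sign_vecs_scalar_prod_self[OF w])
  thus "\<bar>slq_quad K A w - w \<bullet> (mat_log A *\<^sub>v w)\<bar> \<le> real m * (2 * e)"
    by (simp add: sign_vecs_scalar_prod_self[OF w])
qed

lemma hutchinson_log_lipschitz:
  assumes A: "A \<in> loewner_interval m \<alpha> \<beta>" and B: "B \<in> loewner_interval m \<alpha> \<beta>"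
    and m: "0 < m" and \<alpha>: "0 < \<alpha>" and ws: "set ws \<subseteq> sign_vecs m" "ws \<noteq> []"
  shows "\<bar>hutchinson (mat_log A) ws - hutchinson (mat_log B) ws\<bar> \<le> real m * spec_norm (A - B) / \<alpha>"
  unfolding hutchinson_def
proof (rule abs_list_mean_diff_le[OF _ ws(2)])
  fix w assume "w \<in> set ws"
  hence w: "w \<in> sign_vecs m" using ws(1) by blast
  show "\<bar>w \<bullet> (mat_log A *\<^sub>v w) - w \<bullet> (mat_log B *\<^sub>v w)\<bar> \<le> real m * spec_norm (A - B) / \<alpha>"
    using log_form_lipschitz[OF A B m \<alpha> sign_vecs_carrier[OF w]]
    by (simp add: sign_vecs_scalar_prod_self[OF w] mult.commute)
qed

text \<open>The error budget is \<open>3/20 + 4/15 + 19/60 + 4/15 = 1\<close>: Lanczos quadrature, passage to \<open>B\<close>,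
  sampling error at \<open>B\<close>, and passage back to \<open>A\<close>.\<close>
lemma slq_error_le_near:
  assumes A: "A \<in> loewner_interval m \<alpha> \<beta>" and B: "B \<in> loewner_interval m \<alpha> \<beta>"
    and \<alpha>: "0 < \<alpha>" and m: "0 < m" and ws: "set ws \<subseteq> sign_vecs m" "ws \<noteq> []" and K: "0 < K"
    and p: "degree p < 2 * K" "\<And>x. x \<in> {\<alpha>..\<beta>} \<Longrightarrow> \<bar>ln x - poly p x\<bar> \<le> 3 / 40 * \<epsilon> / real m"
    and near: "real m * spec_norm (A - B) / \<alpha> \<le> 4 / 15 * \<epsilon>"
    and sample: "\<bar>hutchinson (offdiag (mat_log B)) ws\<bar> \<le> 19 / 60 * \<epsilon>"
  shows "\<bar>slq K A ws - ln (det A)\<bar> \<le> \<epsilon>"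
proof -
  have "\<bar>slq K A ws - hutchinson (mat_log A) ws\<bar> \<le> 3 / 20 * \<epsilon>"
    using slq_hutchinson_error[OF A \<alpha> m ws K p] m by simp
  moreover have "\<bar>hutchinson (mat_log A) ws - hutchinson (mat_log B) ws\<bar> \<le> 4 / 15 * \<epsilon>"
    using hutchinson_log_lipschitz[OF A B m \<alpha> ws] near by linarith
  moreover have "\<bar>hutchinson (mat_log B) ws - ln (det B)\<bar> \<le> 19 / 60 * \<epsilon>"
    using sample hutchinson_offdiag[OF mat_log_carrier[OF B] ws] ln_det_eq_trace_mat_log[OF B \<alpha>] by simp
  moreover have "\<bar>ln (det A) - ln (det B)\<bar> \<le> 4 / 15 * \<epsilon>"
    using ln_det_lipschitz[OF A B m \<alpha>] near by linarith
  ultimately show ?thesis by linarith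
qed

lemma prob_avoid_finite_union_ge:
  fixes p :: "'a pmf"
  assumes T: "finite T" "real (card T) \<le> \<gamma>" and \<gamma>: "0 < \<gamma>" and \<delta>: "0 \<le> \<delta>"
    and bad: "\<And>t. t \<in> T \<Longrightarrow> measure_pmf.prob p (bad t) \<le> \<delta> / \<gamma>"
  shows "1 - \<delta> \<le> measure_pmf.prob p (- (\<Union>t\<in>T. bad t))"
proof -
  have "measure_pmf.prob p (\<Union>t\<in>T. bad t) \<le> (\<Sum>t\<in>T. measure_pmf.prob p (bad t))"
    by (rule measure_pmf.finite_measure_subadditive_finite) (use T in auto)
  also have "\<dots> \<le> real (card T) * (\<delta> / \<gamma>)" using sum_mono[OF bad] by simp
  also have "\<dots> \<le> \<gamma> * (\<delta> / \<gamma>)" using T(2) \<delta> \<gamma> by (intro mult_right_mono) auto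
  finally show ?thesis
    using measure_pmf.prob_compl[of "\<Union>t\<in>T. bad t" p] \<gamma> by (simp add: Compl_eq_Diff_UNIV)
qed

theorem slq_uniform_error_prob:
  fixes \<A> \<T> :: "real mat set"
  assumes \<delta>: "0 < \<delta>" "\<delta> < 1" and \<epsilon>: "0 < \<epsilon>" and \<alpha>: "0 < \<alpha>" "\<alpha> \<le> \<beta>"
    and m: "0 < m" and K: "0 < K" and N: "0 < N"
    and K_ge: "sqrt (\<beta>/\<alpha> + 1) / 4 *
      ln (4 * (5/2) * inverse \<epsilon> * real m * (sqrt (\<beta>/\<alpha> + 1) + 1) * ln (2 * (\<beta>/\<alpha>))) \<le> real K"
    and N_ge: "32 * ((25/4) * inverse \<epsilon> ^ 2 * F + (5/2) * inverse \<epsilon> * S) * ln (2 * \<gamma> / \<delta>) \<le> real N"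
    and \<A>: "\<A> \<subseteq> loewner_interval m \<alpha> \<beta>"
    and net: "finite \<T>" "\<T> \<subseteq> \<A>" "real (card \<T>) \<le> \<gamma>" "1 \<le> \<gamma>"
      "\<And>A. A \<in> \<A> \<Longrightarrow> \<exists>B\<in>\<T>. real m * spec_norm (A - B) / \<alpha> \<le> 4 / 15 * \<epsilon>"
    and F: "\<And>B. B \<in> \<T> \<Longrightarrow> (frob_norm (offdiag (mat_log B)))\<^sup>2 \<le> F"
    and S: "\<And>B. B \<in> \<T> \<Longrightarrow> spec_norm (offdiag (mat_log B)) \<le> S"
  shows "1 - \<delta> \<le> measure_pmf.prob (pmf_of_set (rademacher_tuples N m))
    {ws. \<forall>A\<in>\<A>. \<bar>slq K A ws - ln (det A)\<bar> \<le> \<epsilon>}"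
proof -
  let ?p = "pmf_of_set (rademacher_tuples N m)"
  define bad where "bad B = {ws. 19 / 24 * (2 / 5 * \<epsilon>) \<le> \<bar>hutchinson (offdiag (mat_log B)) ws\<bar>}" for B
  obtain p where p: "degree p < 2 * K" "\<And>x. x \<in> {\<alpha>..\<beta>} \<Longrightarrow> \<bar>ln x - poly p x\<bar> \<le> 3 / 40 * \<epsilon> / real m"
    using exists_quadrature_poly[OF \<alpha> \<epsilon> _ K K_ge] m by auto
  have \<Lambda>: "0 < ln (2 * \<gamma> / \<delta>)" using net(4) \<delta> by (simp add: field_simps)
  have N_ge': "32 * (F / (2 / 5 * \<epsilon>)\<^sup>2 + S / (2 / 5 * \<epsilon>)) * ln (2 * \<gamma> / \<delta>) \<le> real N"
    using N_ge by (simp add: power_mult_distrib power_divide inverse_eq_divide)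
  have "measure_pmf.prob ?p (bad B) \<le> 2 * exp (- ln (2 * \<gamma> / \<delta>))" if "B \<in> \<T>" for B
  proof -
    have B: "B \<in> loewner_interval m \<alpha> \<beta>" using that \<A> net(2) by blast
    note log = mat_log_carrier[OF B] mat_log_sym[OF B]
    show ?thesis unfolding bad_def
      by (rule hutchinson_tail[OF offdiag_carrier[OF log(1)] offdiag_sym[OF log] offdiag_diagonal[OF log(1)]
            m S[OF that] F[OF that] _ \<Lambda> N N_ge']) (use \<epsilon> in auto)
  qed
  hence "1 - \<delta> \<le> measure_pmf.prob ?p (- (\<Union>B\<in>\<T>. bad B))"
    using net(1,3,4) \<delta> by (intro prob_avoid_finite_union_ge[of _ \<gamma>]) (auto simp: exp_minus)
  also have "\<dots> \<le> measure_pmf.prob ?p {ws. \<forall>A\<in>\<A>. \<bar>slq K A ws - ln (det A)\<bar> \<le> \<epsilon>}"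
  proof (rule measure_pmf.finite_measure_mono_AE,
      unfold AE_measure_pmf_iff set_pmf_rademacher_tuples, safe)
    fix ws A assume ws: "ws \<in> rademacher_tuples N m" "ws \<notin> (\<Union>B\<in>\<T>. bad B)" and A: "A \<in> \<A>"
    obtain B where B: "B \<in> \<T>" "real m * spec_norm (A - B) / \<alpha> \<le> 4 / 15 * \<epsilon>" using net(5)[OF A] by blast
    have "set ws \<subseteq> sign_vecs m" "ws \<noteq> []" using ws(1) N by (auto simp: rademacher_tuples_eq)
    moreover have "\<bar>hutchinson (offdiag (mat_log B)) ws\<bar> \<le> 19 / 60 * \<epsilon>"
      using ws(2) B(1) by (auto simp: bad_def not_le)
    ultimately show "\<bar>slq K A ws - ln (det A)\<bar> \<le> \<epsilon>"
      using A B \<A> net(2) by (intro slq_error_le_near[OF _ _ \<alpha>(1) m _ _ K p]) auto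
  qed auto
  finally show ?thesis .
qed

lemma frob_norm_offdiag_mat_log_le:
  assumes A: "A \<in> loewner_interval m \<alpha> \<beta>" and \<alpha>: "0 < \<alpha>"
  shows "(frob_norm (offdiag (mat_log A)))\<^sup>2 \<le> real m * (\<bar>ln \<alpha>\<bar> + \<bar>ln \<beta>\<bar>)\<^sup>2"
proof -
  obtain u \<mu> where u: "eigenbasis m A u \<mu>" "\<And>k. k < m \<Longrightarrow> \<mu> k \<in> {\<alpha>..\<beta>}"
    using loewner_interval_eigenbasis[OF A] by blast
  have "(ln (\<mu> k))\<^sup>2 \<le> (\<bar>ln \<alpha>\<bar> + \<bar>ln \<beta>\<bar>)\<^sup>2" if "k < m" for k
  proof -
    have "ln \<alpha> \<le> ln (\<mu> k)" "ln (\<mu> k) \<le> ln \<beta>" using u(2)[OF that] \<alpha> by auto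
    hence "\<bar>ln (\<mu> k)\<bar> \<le> \<bar>ln \<alpha>\<bar> + \<bar>ln \<beta>\<bar>" by linarith
    from power_mono[OF this, of 2] show ?thesis by simp
  qed
  hence "(frob_norm (mat_log A))\<^sup>2 \<le> (\<Sum>k<m. (\<bar>ln \<alpha>\<bar> + \<bar>ln \<beta>\<bar>)\<^sup>2)"
    unfolding mat_log_def eigenbasis.frob_norm_mat_fun[OF u(1)] by (intro sum_mono) simp
  thus ?thesis using order_trans[OF frob_norm_offdiag_le[OF mat_log_carrier[OF A]]] by simp
qed

lemma bdd_above_offdiag_mat_log:
  assumes \<Psi>: "\<And>\<theta>. \<theta> \<in> \<Theta> \<Longrightarrow> \<Psi> \<theta> \<in> loewner_interval m \<alpha> \<beta>" and \<alpha>: "0 < \<alpha>" and m: "0 < m"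
  shows "bdd_above ((\<lambda>\<theta>. (frob_norm (offdiag (mat_log (\<Psi> \<theta>))))\<^sup>2) ` \<Theta>)"
    and "bdd_above ((\<lambda>\<theta>. spec_norm (offdiag (mat_log (\<Psi> \<theta>)))) ` \<Theta>)"
proof -
  define C where "C = real m * (\<bar>ln \<alpha>\<bar> + \<bar>ln \<beta>\<bar>)\<^sup>2"
  have frob: "(frob_norm (offdiag (mat_log (\<Psi> \<theta>))))\<^sup>2 \<le> C" if "\<theta> \<in> \<Theta>" for \<theta>
    unfolding C_def by (rule frob_norm_offdiag_mat_log_le[OF \<Psi>[OF that] \<alpha>])
  thus "bdd_above ((\<lambda>\<theta>. (frob_norm (offdiag (mat_log (\<Psi> \<theta>))))\<^sup>2) ` \<Theta>)" by (rule bdd_aboveI2)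
  have "spec_norm (offdiag (mat_log (\<Psi> \<theta>))) \<le> sqrt C" if "\<theta> \<in> \<Theta>" for \<theta>
    using spec_norm_le_frob_norm[OF offdiag_carrier[OF mat_log_carrier[OF \<Psi>[OF that]]] m]
      real_le_rsqrt[OF frob[OF that]] by linarith
  thus "bdd_above ((\<lambda>\<theta>. spec_norm (offdiag (mat_log (\<Psi> \<theta>)))) ` \<Theta>)" by (rule bdd_aboveI2)
qed

theorem theorem4p3:
  fixes \<Theta> :: "(real^'p) set"
    and \<Psi> :: "real^'p \<Rightarrow> real mat"
    and m K N :: nat and \<delta> \<epsilon> r L\<^sub>\<Psi> \<alpha> \<beta> :: real
  assumes "0 < \<delta>" "\<delta> < 1" "0 < \<epsilon>"
    and "compact \<Theta>" "0 < r" "\<exists>c. \<Theta> \<subseteq> cball c r"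
    and "0 < m"
    and "\<And>\<theta>. \<theta> \<in> \<Theta> \<Longrightarrow> \<Psi> \<theta> \<in> carrier_mat m m \<and> sym_mat (\<Psi> \<theta>)"
    and "0 \<le> L\<^sub>\<Psi>"
    and "\<And>\<theta> \<theta>'. \<theta> \<in> \<Theta> \<Longrightarrow> \<theta>' \<in> \<Theta> \<Longrightarrow> spec_norm (\<Psi> \<theta> - \<Psi> \<theta>') \<le> L\<^sub>\<Psi> * norm (\<theta> - \<theta>')"
    and "0 < \<alpha>" "\<alpha> \<le> \<beta>"
    and "\<And>\<theta>. \<theta> \<in> \<Theta> \<Longrightarrow> loewner_between \<alpha> (\<Psi> \<theta>) \<beta>"
    and "1 \<le> K" "1 \<le> N"
    and "real K \<ge> sqrt (\<beta>/\<alpha> + 1) / 4 *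
           ln (4 * (5/2) * inverse \<epsilon> * real m * (sqrt (\<beta>/\<alpha> + 1) + 1) * ln (2 * (\<beta>/\<alpha>)))"
    and "real N \<ge> 32 * ((25/4) * inverse \<epsilon> ^ 2 * (SUP \<theta>\<in>\<Theta>. (frob_norm (offdiag (mat_log (\<Psi> \<theta>))))^2)
                        + (5/2) * inverse \<epsilon> * (SUP \<theta>\<in>\<Theta>. spec_norm (offdiag (mat_log (\<Psi> \<theta>)))))
                 * ln (2 * max ((3 * r / (\<alpha> * \<epsilon> / (5 * real m * L\<^sub>\<Psi>))) ^ CARD('p)) 1 / \<delta>)"
  shows "measure_pmf.prob (pmf_of_set (rademacher_tuples N m))
           {ws. \<forall>\<theta>\<in>\<Theta>. \<bar>slq K (\<Psi> \<theta>) ws - ln (det (\<Psi> \<theta>))\<bar> \<le> \<epsilon>} \<ge> 1 - \<delta>"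
proof (cases "\<Theta> = {}")
  case False
  note m = assms(7) and \<alpha> = assms(11,12) and K_ge = assms(16) and N_ge = assms(17)
  have \<Psi>: "\<Psi> \<theta> \<in> loewner_interval m \<alpha> \<beta>" if "\<theta> \<in> \<Theta>" for \<theta>
    using assms(8,13)[OF that] by (simp add: loewner_interval_def)
  have lipschitz: "real m * spec_norm (\<Psi> \<theta> - \<Psi> \<theta>') / \<alpha> \<le> (real m * L\<^sub>\<Psi> / \<alpha>) * norm (\<theta> - \<theta>')"
    if "\<theta> \<in> \<Theta>" "\<theta>' \<in> \<Theta>" for \<theta> \<theta>'
    using divide_right_mono[OF mult_left_mono[OF assms(10)[OF that]], of "real m" \<alpha>] \<alpha> by simp
  define \<gamma> where "\<gamma> = max ((3 * r / (\<alpha> * \<epsilon> / (5 * real m * L\<^sub>\<Psi>))) ^ CARD('p)) 1"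
  obtain c where ball: "\<Theta> \<subseteq> cball c r" using assms(6) by blast
  obtain T where T: "finite T" "T \<subseteq> \<Theta>" "real (card T) \<le> \<gamma>"
    "\<And>\<theta>. \<theta> \<in> \<Theta> \<Longrightarrow> \<exists>\<theta>'\<in>T. real m * spec_norm (\<Psi> \<theta> - \<Psi> \<theta>') / \<alpha> \<le> 4 / 15 * \<epsilon>"
    using finite_net_lipschitz[OF ball False assms(5) _ _ lipschitz, of "\<epsilon> / 5"] assms(3,9) \<alpha>
    by (auto simp: \<gamma>_def mult_ac)
  have "1 - \<delta> \<le> measure_pmf.prob (pmf_of_set (rademacher_tuples N m))
      {ws. \<forall>A\<in>\<Psi> ` \<Theta>. \<bar>slq K A ws - ln (det A)\<bar> \<le> \<epsilon>}"
  proof (rule slq_uniform_error_prob[OF assms(1-3) \<alpha> m _ _ K_ge N_ge[folded \<gamma>_def]])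
    show "real (card (\<Psi> ` T)) \<le> \<gamma>" using card_image_le[OF T(1), of \<Psi>] T(3) by linarith
    fix B assume "B \<in> \<Psi> ` T"
    thus "(frob_norm (offdiag (mat_log B)))\<^sup>2 \<le> (SUP \<theta>\<in>\<Theta>. (frob_norm (offdiag (mat_log (\<Psi> \<theta>))))\<^sup>2)"
      and "spec_norm (offdiag (mat_log B)) \<le> (SUP \<theta>\<in>\<Theta>. spec_norm (offdiag (mat_log (\<Psi> \<theta>))))"
      using T(2) bdd_above_offdiag_mat_log[OF \<Psi> \<alpha>(1) m] by (auto intro!: cSUP_upper)
  qed (use assms(14,15) T(1,2,4) \<Psi> in \<open>auto simp: \<gamma>_def\<close>)
  thus ?thesis by simp
qed (use assms(1) in simp)

end
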